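(* Let $\mathcal{A}$ be a cluster algebra of rank two (with arbitrary coefficients). Then \[\mathrm{QAut}_0(\mathcal{A})\cong \mathrm{Aut}^+(\mathcal{A}_{triv})\cong\begin{cases} \mathbb{Z}_5 &\text{in type }\mathbb{A}_2;\\ \mathbb{Z}_3 &\text{in type }\mathbb{B}_2;\\ \mathbb{Z}_3 &\text{in type }\mathbb{C}_2;\\ \mathbb{Z}_4 &\text{in type }\mathbb{G}_2;\\ \mathbb{Z} &\text{in all other rank 2 types.} \end{cases}\]
   Context: **Seeds and cluster algebras.** A labeled seed of rank $n$ is a triple $\Sigma=(\mathbf{x},\mathbf{p},B)$ with $\mathbf{x}=(x_1,\dots,x_n)$ (the cluster; its elements are cluster variables), $\mathbf{p}=(x_{n+1},\dots,x_m)$ (the coefficient or frozen variables), and $B=(b_{ji})$ an $m\times n$ integer matrix (rows indexed by $\mathbf{x}\sqcup\mathbf{p}$, columns by $\mathbf{x}$) whose top $n\times n$ part $\underline{B}$ (the exchange matrix, or principal part) is skew-symmetrizable, i.e. $D\underline{B}$ is skew-symmetric for some diagonal matrix $D$ with positive integer entries. $\mathbb{P}$ is the free abelian group (written multiplicatively) on $\mathbf{p}$, $\mathbb{Z}\mathbb{P}$ its group ring, $\mathbb{Q}\mathbb{P}$ the fraction field of $\mathbb{Z}\mathbb{P}$, and $\mathcal{F}=\mathbb{Q}\mathbb{P}(x_1,\dots,x_n)$, with $x_1,\dots,x_n$ independent variables for the initial seed. With $[a]_+=\max(a,0)$, mutation $\mu_k$ in direction $k\in\{1,\dots,n\}$ replaces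 $x_k$ by $x_k'$, where $x_kx_k'=\prod_{j=1}^m x_j^{[b_{jk}]_+}+\prod_{j=1}^m x_j^{[-b_{jk}]_+}$, keeps $\mathbf{p}$, and replaces $B$ by $(b'_{ji})$ with $b'_{ji}=-b_{ji}$ if $i=k$ or $j=k$, and $b'_{ji}=b_{ji}+[-b_{jk}]_+b_{ki}+b_{jk}[b_{ki}]_+$ otherwise. The seeds of $\mathcal{A}$ are those obtained from an initial seed by finite sequences of mutations and simultaneous relabelings of the cluster variables (with rows and columns of $B$); $\mathbf{p}$ is kept fixed. The cluster algebra $\mathcal{A}$ is the $\mathbb{Z}\mathbb{P}$-subalgebra of $\mathcal{F}$ generated by all cluster variables. Throughout, $B$ and $\underline{B}$ are indecomposable; so in rank $2$, $\underline{B}=\pm\left(\begin{smallmatrix}0&s\\-t&0\end{smallmatrix}\right)$ with positive integers $s,t$. $\mathcal{A}_{triv}$ is the cluster algebra with no frozen variables with initial seed $(\mathbf{x},\underline{B})$. **Quasi-automorphisms.** For a seed put $\hat y_i=\prod_{j=1}^m x_j^{b_{ji}}$ ($1\le i\le n$). A quasi-homomorphism $\mathcal{A}\to\mathcal{A}$ is a field homomorphism $\Psi:\mathcal{F}\to\mathcal{F}$ with $\Psi(\mathbb{P})\subset\mathbb{P}$ such that there are seeds $\Sigma,\overline{\Sigma}$ of $\mathcal{A}$ with $\Psi(\Sigma)\asymp\overline\Sigma$ (proportional), meaning $\Psi(x_i)/\overline{x}_i\in\mathbb{P}$ and $\Psi(\hat y_i)=\hat{\overline{y}}_i$ for $1\le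 i\le n$, and $\underline{B}=\underline{\overline{B}}$. Two quasi-homomorphisms $\Psi_1,\Psi_2$ are proportional if for some (equivalently every) seed of $\mathcal{A}$, $\Psi_1(x_i)/\Psi_2(x_i)\in\mathbb{P}$ and $\Psi_1(\hat y_i)=\Psi_2(\hat y_i)$ for all $i$. A quasi-automorphism of $\mathcal{A}$ is a quasi-homomorphism $\Psi:\mathcal{A}\to\mathcal{A}$ for which there is a quasi-homomorphism $\Phi:\mathcal{A}\to\mathcal{A}$ with $\Phi\circ\Psi$ proportional to the identity. $\mathrm{QAut}_0(\mathcal{A})$ is the group, under composition, of proportionality classes of quasi-automorphisms of $\mathcal{A}$. **Cluster automorphisms.** For $x,x'$ in a cluster $\mathbf{x}$, $\mu_{x,\mathbf{x}}(x')$ is the new cluster variable obtained by mutating $\mathbf{x}$ at $x$ if $x'=x$, and is $x'$ otherwise. A cluster automorphism of a cluster algebra with no frozen variables is a $\mathbb{Z}$-algebra automorphism $f$ such that for some seed $(\mathbf{x},\underline{B})$: $f(\mathbf{x})$ is a cluster, and $f(\mu_{x,\mathbf{x}}(x'))=\mu_{f(x),f(\mathbf{x})}(f(x'))$ for all $x,x'\in\mathbf{x}$. It is direct if the exchange matrix $\underline{B}'$ of the seed with cluster $f(\mathbf{x})$ satisfies $b'_{f(x_j)f(x_i)}=b_{x_jx_i}$ for all $i,j$. $\mathrm{Aut}^+(\mathcal{A}_{triv})$ is the group of direct cluster automorphisms of $\mathcal{A}_{triv}$. **Types.** $\mathcal{A}$ is of type $\mathbb{A}_2$, $\mathbb{B}_2$,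 $\mathbb{C}_2$ or $\mathbb{G}_2$ if the Cartan counterpart of its exchange matrix (diagonal entries $2$, off-diagonal entries $-|b_{ij}|$) is the Cartan matrix of that type; i.e. $st=1$ for $\mathbb{A}_2$, $st=2$ for $\mathbb{B}_2$ and $\mathbb{C}_2$, $st=3$ for $\mathbb{G}_2$. $\mathbb{Z}_k=\mathbb{Z}/k\mathbb{Z}$. *)

theory Defs
  imports
    "HOL-Library.Poly_Mapping"
    "HOL-Computational_Algebra.Fraction_Field"
    "HOL-Combinatorics.Permutations"
    "HOL-Algebra.Elementary_Groups"
    "HOL-Algebra.Generated_Fields"
    "HOL-Algebra.QuotRing"
    "HOL-Algebra.Bij"
begin

text \<open>
  Conventions. All indices start at 0: in rank \<open>n\<close> with \<open>m\<close> extended variables, the indices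
  \<open>i < n\<close> are mutable and \<open>n \<le> j < m\<close> are frozen. An \<open>m \<times> n\<close> matrix is a function \<open>B\<close> with
  \<open>B j i\<close> the entry in row \<open>j\<close> and column \<open>i\<close>; values outside the range are never read.
\<close>

section \<open>The ambient field\<close>

text \<open>The field of rational functions over the rationals in countably many variables, as fraction
  field of the ring of polynomials with integer coefficients.\<close>

type_synonym ratfun = "((nat \<Rightarrow>\<^sub>0 nat) \<Rightarrow>\<^sub>0 int) fract"

definition indet :: "nat \<Rightarrow> ratfun" where
  "indet i = Fraction_Field.Fract (Poly_Mapping.single (Poly_Mapping.single i 1) 1) 1"

definition ring_on :: "ratfun set \<Rightarrow> ratfun ring" where
  "ring_on K = \<lparr>carrier = K, monoid.mult = (*), one = 1, ring.zero = 0, ring.add = (+)\<rparr>"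

definition ambient :: "nat \<Rightarrow> ratfun set" where
  "ambient m = generate_field (ring_on UNIV) (indet ` {..<m})"

definition coeff_group :: "nat \<Rightarrow> nat \<Rightarrow> ratfun set" where
  "coeff_group m n = range (\<lambda>e :: nat \<Rightarrow> int. \<Prod>j\<in>{n..<m}. indet j powi e j)"


section \<open>Seeds and mutation\<close>

definition skew_symmetrizable :: "nat \<Rightarrow> (nat \<Rightarrow> nat \<Rightarrow> int) \<Rightarrow> bool" where
  "skew_symmetrizable n B \<longleftrightarrow>
     (\<exists>d :: nat \<Rightarrow> int. (\<forall>i<n. d i > 0) \<and> (\<forall>i<n. \<forall>j<n. d i * B i j = - (d j * B j i)))"

text \<open>An \<open>m \<times> n\<close> matrix is decomposable if a simultaneous reordering of its rows and columns
  (frozen indices label rows only) makes it block diagonal, both blocks having some index.\<close>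

definition indecomposable :: "nat \<Rightarrow> nat \<Rightarrow> (nat \<Rightarrow> nat \<Rightarrow> int) \<Rightarrow> bool" where
  "indecomposable m n B \<longleftrightarrow>
     \<not> (\<exists>I \<subset> {..<m}. I \<noteq> {} \<and> (\<forall>j<m. \<forall>i<n. (j \<in> I) \<noteq> (i \<in> I) \<longrightarrow> B j i = 0))"

text \<open>A labeled seed is the extended cluster \<open>(x\<^sub>j)\<close>, \<open>j < m\<close>, together with the matrix.\<close>

type_synonym seed = "(nat \<Rightarrow> ratfun) \<times> (nat \<Rightarrow> nat \<Rightarrow> int)"

definition mutate :: "nat \<Rightarrow> nat \<Rightarrow> seed \<Rightarrow> seed" where
  "mutate m k = (\<lambda>(x, B).
     (x(k := ((\<Prod>j<m. x j powi max (B j k) 0) + (\<Prod>j<m. x j powi max (- B j k) 0)) / x k),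
      \<lambda>j i. if i = k \<or> j = k then - B j i
             else B j i + max (- B j k) 0 * B k i + B j k * max (B k i) 0))"

definition relabel :: "(nat \<Rightarrow> nat) \<Rightarrow> seed \<Rightarrow> seed" where
  "relabel \<sigma> = (\<lambda>(x, B). (\<lambda>j. x (\<sigma> j), \<lambda>j i. B (\<sigma> j) (\<sigma> i)))"

text \<open>The seeds of the cluster algebra of rank \<open>n\<close> with initial extended cluster \<open>indet\<close> and
  initial matrix \<open>B\<close>. With \<open>m = n\<close> these are the seeds of the coefficient-free algebra, since then
  only the principal part of \<open>B\<close> is read.\<close>

inductive_set seeds :: "nat \<Rightarrow> nat \<Rightarrow> (nat \<Rightarrow> nat \<Rightarrow> int) \<Rightarrow> seed set"
  for m n :: nat and B :: "nat \<Rightarrow> nat \<Rightarrow> int" where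
  initial: "(indet, B) \<in> seeds m n B"
| mutation: "S \<in> seeds m n B \<Longrightarrow> k < n \<Longrightarrow> mutate m k S \<in> seeds m n B"
| relabeling: "S \<in> seeds m n B \<Longrightarrow> \<sigma> permutes {..<n} \<Longrightarrow> relabel \<sigma> S \<in> seeds m n B"

definition cluster :: "nat \<Rightarrow> seed \<Rightarrow> ratfun set" where
  "cluster n S = fst S ` {..<n}"

definition cluster_algebra :: "nat \<Rightarrow> nat \<Rightarrow> (nat \<Rightarrow> nat \<Rightarrow> int) \<Rightarrow> ratfun set" where
  "cluster_algebra m n B =
     generate_ring (ring_on UNIV) (coeff_group m n \<union> (\<Union>S \<in> seeds m n B. cluster n S))"


section \<open>Quasi-automorphisms\<close>

definition yhat :: "nat \<Rightarrow> seed \<Rightarrow> nat \<Rightarrow> ratfun" where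
  "yhat m S i = (\<Prod>j<m. fst S j powi snd S j i)"

definition image_proportional :: "nat \<Rightarrow> nat \<Rightarrow> (ratfun \<Rightarrow> ratfun) \<Rightarrow> seed \<Rightarrow> seed \<Rightarrow> bool" where
  "image_proportional m n \<Psi> S S' \<longleftrightarrow>
     (\<forall>i<n. \<Psi> (fst S i) / fst S' i \<in> coeff_group m n \<and> \<Psi> (yhat m S i) = yhat m S' i) \<and>
     (\<forall>j<n. \<forall>i<n. snd S j i = snd S' j i)"

text \<open>Maps on the ambient field are taken to be extensional, so that equality of functions is
  equality on the field.\<close>

definition quasi_homs :: "nat \<Rightarrow> nat \<Rightarrow> (nat \<Rightarrow> nat \<Rightarrow> int) \<Rightarrow> (ratfun \<Rightarrow> ratfun) set" where
  "quasi_homs m n B =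
     {\<Psi> \<in> extensional (ambient m) \<inter> ring_hom (ring_on (ambient m)) (ring_on (ambient m)).
        \<Psi> ` coeff_group m n \<subseteq> coeff_group m n \<and>
        (\<exists>S \<in> seeds m n B. \<exists>S' \<in> seeds m n B. image_proportional m n \<Psi> S S')}"

definition proportional ::
  "nat \<Rightarrow> nat \<Rightarrow> (nat \<Rightarrow> nat \<Rightarrow> int) \<Rightarrow> (ratfun \<Rightarrow> ratfun) \<Rightarrow> (ratfun \<Rightarrow> ratfun) \<Rightarrow> bool" where
  "proportional m n B \<Psi>\<^sub>1 \<Psi>\<^sub>2 \<longleftrightarrow>
     (\<exists>S \<in> seeds m n B. \<forall>i<n. \<Psi>\<^sub>1 (fst S i) / \<Psi>\<^sub>2 (fst S i) \<in> coeff_group m n \<and>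
                             \<Psi>\<^sub>1 (yhat m S i) = \<Psi>\<^sub>2 (yhat m S i))"

definition quasi_auts :: "nat \<Rightarrow> nat \<Rightarrow> (nat \<Rightarrow> nat \<Rightarrow> int) \<Rightarrow> (ratfun \<Rightarrow> ratfun) set" where
  "quasi_auts m n B =
     {\<Psi> \<in> quasi_homs m n B. \<exists>\<Phi> \<in> quasi_homs m n B.
        proportional m n B (compose (ambient m) \<Phi> \<Psi>) (\<lambda>x \<in> ambient m. x)}"

definition prop_rel ::
  "nat \<Rightarrow> nat \<Rightarrow> (nat \<Rightarrow> nat \<Rightarrow> int) \<Rightarrow> ((ratfun \<Rightarrow> ratfun) \<times> (ratfun \<Rightarrow> ratfun)) set" where
  "prop_rel m n B = {(\<Psi>\<^sub>1, \<Psi>\<^sub>2) \<in> quasi_auts m n B \<times> quasi_auts m n B. proportional m n B \<Psi>\<^sub>1 \<Psi>\<^sub>2}"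

text \<open>The product of two classes is the class of the composite of any representatives, written as
  a union over all of them.\<close>

definition QAut0 :: "nat \<Rightarrow> nat \<Rightarrow> (nat \<Rightarrow> nat \<Rightarrow> int) \<Rightarrow> (ratfun \<Rightarrow> ratfun) set monoid" where
  "QAut0 m n B =
     \<lparr>carrier = quasi_auts m n B // prop_rel m n B,
      monoid.mult = (\<lambda>P Q. \<Union>\<Phi>\<in>P. \<Union>\<Psi>\<in>Q. prop_rel m n B `` {compose (ambient m) \<Phi> \<Psi>}),
      one = prop_rel m n B `` {\<lambda>x \<in> ambient m. x}\<rparr>"


section \<open>Direct cluster automorphisms of a coefficient-free cluster algebra\<close>

definition var_index :: "nat \<Rightarrow> seed \<Rightarrow> ratfun \<Rightarrow> nat" where
  "var_index n S x = inv_into {..<n} (fst S) x"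

text \<open>\<open>cluster_mut n S x x'\<close> is \<open>\<mu>\<^bsub>x,\<^bold>x\<^esub>(x')\<close>, where \<open>\<^bold>x\<close> is the cluster of \<open>S\<close>. Permuting the
  labels of \<open>S\<close> does not change it.\<close>

definition cluster_mut :: "nat \<Rightarrow> seed \<Rightarrow> ratfun \<Rightarrow> ratfun \<Rightarrow> ratfun" where
  "cluster_mut n S x x' =
     (if x' = x then fst (mutate n (var_index n S x) S) (var_index n S x) else x')"

definition mut_compatible :: "nat \<Rightarrow> (ratfun \<Rightarrow> ratfun) \<Rightarrow> seed \<Rightarrow> seed \<Rightarrow> bool" where
  "mut_compatible n f S S' \<longleftrightarrow>
     f ` cluster n S = cluster n S' \<and>
     (\<forall>x \<in> cluster n S. \<forall>x' \<in> cluster n S. f (cluster_mut n S x x') = cluster_mut n S' (f x) (f x'))"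

definition cluster_auts :: "nat \<Rightarrow> (nat \<Rightarrow> nat \<Rightarrow> int) \<Rightarrow> (ratfun \<Rightarrow> ratfun) set" where
  "cluster_auts n B =
     {f \<in> extensional (cluster_algebra n n B) \<inter>
            ring_iso (ring_on (cluster_algebra n n B)) (ring_on (cluster_algebra n n B)).
        \<exists>S \<in> seeds n n B. \<exists>S' \<in> seeds n n B. mut_compatible n f S S'}"

definition direct_cluster_auts :: "nat \<Rightarrow> (nat \<Rightarrow> nat \<Rightarrow> int) \<Rightarrow> (ratfun \<Rightarrow> ratfun) set" where
  "direct_cluster_auts n B =
     {f \<in> cluster_auts n B.
        \<exists>S \<in> seeds n n B. \<exists>S' \<in> seeds n n B. mut_compatible n f S S' \<and>
          (\<forall>j<n. \<forall>i<n. snd S' (var_index n S' (f (fst S j))) (var_index n S' (f (fst S i))) = snd S j i)}"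

definition Aut_plus_triv :: "nat \<Rightarrow> (nat \<Rightarrow> nat \<Rightarrow> int) \<Rightarrow> (ratfun \<Rightarrow> ratfun) monoid" where
  "Aut_plus_triv n B = (BijGroup (cluster_algebra n n B)) \<lparr>carrier := direct_cluster_auts n B\<rparr>"


section \<open>Types\<close>

definition cartan_counterpart :: "(nat \<Rightarrow> nat \<Rightarrow> int) \<Rightarrow> nat \<Rightarrow> nat \<Rightarrow> int" where
  "cartan_counterpart B i j = (if i = j then 2 else - \<bar>B i j\<bar>)"

text \<open>Cartan matrices are compared up to simultaneous relabeling, as seeds are; consequently
  \<open>B\<^sub>2\<close> and \<open>C\<^sub>2\<close> name the same type.\<close>

definition of_cartan_type :: "nat \<Rightarrow> int list list \<Rightarrow> (nat \<Rightarrow> nat \<Rightarrow> int) \<Rightarrow> bool" where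
  "of_cartan_type n C B \<longleftrightarrow>
     (\<exists>\<sigma>. \<sigma> permutes {..<n} \<and> (\<forall>i<n. \<forall>j<n. cartan_counterpart B (\<sigma> i) (\<sigma> j) = C ! i ! j))"

definition cartan_A2 :: "int list list" where "cartan_A2 = [[2, -1], [-1, 2]]"
definition cartan_B2 :: "int list list" where "cartan_B2 = [[2, -2], [-1, 2]]"
definition cartan_C2 :: "int list list" where "cartan_C2 = [[2, -1], [-2, 2]]"
definition cartan_G2 :: "int list list" where "cartan_G2 = [[2, -1], [-3, 2]]"

end

theory Submission
  imports Defs
begin

text \<open>
  In rank two the seeds form a line: mutation followed by a swap of the two labels leads from a
  seed with cluster \<open>(x\<^sub>k, x\<^bsub>k+1\<^esub>)\<close> to one with cluster \<open>(x\<^bsub>k+1\<^esub>, x\<^bsub>k+2\<^esub>)\<close> and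
  keeps the signs of the exchange matrix. Call the seeds on this line \<open>T k\<close>, for integers \<open>k\<close>. Every
  seed is some \<open>T k\<close> or its relabeling (\<open>seeds_cases\<close>). A quasi-automorphism, or a direct cluster
  automorphism, sends \<open>T 0\<close> to some \<open>T k\<close>, then every \<open>T j\<close> to \<open>T (j + k)\<close>, and is determined by
  the shift \<open>k\<close> up to proportionality. Both groups are therefore of the form \<open>d\<int> / N\<int>\<close>: the
  shifts that are realized by a map, modulo the shifts \<open>k\<close> for which \<open>T k\<close> is proportional to
  \<open>T 0\<close>.

  The number \<open>N\<close> depends only on \<open>p = st\<close>, the product of the two off-diagonal entries in absolute
  value (\<open>id_links_iff\<close>). For \<open>p \<le> 3\<close> the variables \<open>z\<^sub>k\<close>, reciprocals of the \<open>y\<close>-variables, satisfy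
  \<open>z\<^bsub>k+1\<^esub> z\<^bsub>k-1\<^esub> = (1 + z\<^sub>k)\<^sup>s\<close> with \<open>s\<close> alternating between the two entries, and this
  recurrence closes up after 5, 6 or 8 steps; the exchange relations, which modulo frozen monomials
  read \<open>x\<^bsub>k+2\<^esub> x\<^sub>k = 1 + z\<^sub>k\<close>, carry the periodicity over to the cluster variables. That no
  smaller shift, and for \<open>p \<ge> 4\<close> no nonzero shift at all, gives a proportional seed is seen by
  setting all indeterminates to 1: frozen monomials disappear and the cluster variables become a
  sequence of positive numbers which returns to \<open>1, 1\<close> only at multiples of the period, and for \<open>p \<ge> 4\<close> never
  (\<open>exchange_recurrence_growth\<close>).

  A shift can only be realized if the exchange matrices agree, so it must be even unless \<open>s = t\<close>.
  Conversely a map with shift \<open>k\<close> is built by substituting the variables of \<open>T k\<close>, multiplied by frozen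
  monomials, for those of \<open>T 0\<close>, and the powers \<open>\<plusminus>1\<close> of the frozen variables for themselves
  (\<open>links_exists\<close>). Such monomials exist if the frozen rows of \<open>T k\<close> and \<open>\<plusminus>\<close> those of \<open>T 0\<close> are
  congruent modulo the row lattice of the exchange matrix. Two shifts negate the frozen rows
  modulo that lattice (\<open>c_even\<close>), so every even shift is realized with any coefficients; odd shifts
  are realized if \<open>s = t = 1\<close>, where the lattice is everything, and if \<open>s = t\<close> and there are no
  frozen variables. When \<open>s = t \<ge> 2\<close> it depends on the coefficients whether \<open>d\<close> is 1 or 2 for
  quasi-automorphisms, but then \<open>N = 0\<close> and the group is infinite cyclic either way.

  The substitutions are homomorphisms of the ambient field only if they kill no polynomial. This
  holds because a tuple whose values exhaust the positive points is algebraically independent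
  (\<open>algebraically_independentI\<close>), and because mutation is invertible on positive points
  (\<open>cluster_values\<close>).
\<close>

section \<open>Evaluating polynomials and rational functions\<close>

type_synonym int_mpoly = "(nat \<Rightarrow>\<^sub>0 nat) \<Rightarrow>\<^sub>0 int"

definition mon_eval :: "(nat \<Rightarrow> 'a::comm_ring_1) \<Rightarrow> (nat \<Rightarrow>\<^sub>0 nat) \<Rightarrow> 'a" where
  "mon_eval z e = (\<Prod>j\<in>Poly_Mapping.keys e. z j ^ Poly_Mapping.lookup e j)"

definition poly_eval :: "(nat \<Rightarrow> 'a::comm_ring_1) \<Rightarrow> int_mpoly \<Rightarrow> 'a" where
  "poly_eval z p = (\<Sum>e\<in>Poly_Mapping.keys p. of_int (Poly_Mapping.lookup p e) * mon_eval z e)"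

lemma mon_eval_superset:
  assumes "finite K" "Poly_Mapping.keys e \<subseteq> K"
  shows "mon_eval z e = (\<Prod>j\<in>K. z j ^ Poly_Mapping.lookup e j)"
  unfolding mon_eval_def
  by (rule prod.mono_neutral_left) (use assms in \<open>auto simp: in_keys_iff\<close>)

lemma mon_eval_add: "mon_eval z (e + f) = mon_eval z e * mon_eval z f"
proof -
  let ?K = "Poly_Mapping.keys e \<union> Poly_Mapping.keys f"
  have "mon_eval z (e + f) = (\<Prod>j\<in>?K. z j ^ Poly_Mapping.lookup (e + f) j)"
    by (rule mon_eval_superset) (auto simp: in_keys_iff lookup_add)
  also have "\<dots> = (\<Prod>j\<in>?K. z j ^ Poly_Mapping.lookup e j) * (\<Prod>j\<in>?K. z j ^ Poly_Mapping.lookup f j)"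
    by (simp add: lookup_add power_add prod.distrib)
  also have "\<dots> = mon_eval z e * mon_eval z f"
    by (simp add: mon_eval_superset[of ?K e] mon_eval_superset[of ?K f])
  finally show ?thesis .
qed

lemma mon_eval_0 [simp]: "mon_eval z 0 = 1"
  by (simp add: mon_eval_def)

lemma mon_eval_single [simp]: "mon_eval z (Poly_Mapping.single j n) = z j ^ n"
  by (simp add: mon_eval_superset[of "{j}"])

lemma mon_eval_pos:
  fixes a :: "nat \<Rightarrow> real"
  assumes "\<And>j. a j > 0"
  shows "mon_eval a e > 0"
  unfolding mon_eval_def using assms by (intro prod_pos) auto

lemma poly_eval_superset:
  assumes "finite K" "Poly_Mapping.keys p \<subseteq> K"
  shows "poly_eval z p = (\<Sum>e\<in>K. of_int (Poly_Mapping.lookup p e) * mon_eval z e)"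
  unfolding poly_eval_def
  by (rule sum.mono_neutral_left) (use assms in \<open>auto simp: in_keys_iff\<close>)

lemma poly_eval_add: "poly_eval z (p + q) = poly_eval z p + poly_eval z q"
proof -
  let ?K = "Poly_Mapping.keys p \<union> Poly_Mapping.keys q"
  have "poly_eval z (p + q) = (\<Sum>e\<in>?K. of_int (Poly_Mapping.lookup (p + q) e) * mon_eval z e)"
    by (rule poly_eval_superset) (auto simp: in_keys_iff lookup_add)
  also have "\<dots> = poly_eval z p + poly_eval z q"
    by (simp add: lookup_add poly_eval_superset[of ?K] distrib_right sum.distrib)
  finally show ?thesis .
qed

lemma poly_eval_0 [simp]: "poly_eval z 0 = 0"
  by (simp add: poly_eval_def)

lemma poly_eval_single: "poly_eval z (Poly_Mapping.single e c) = of_int c * mon_eval z e"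
  by (simp add: poly_eval_superset[of "{e}"])

lemma poly_eval_1 [simp]: "poly_eval z 1 = 1"
  using poly_eval_single[of z 0 1] by simp

lemma mpoly_induct [case_names add single]:
  fixes p :: int_mpoly
  assumes "\<And>p q. P p \<Longrightarrow> P q \<Longrightarrow> P (p + q)"
    and "\<And>e c. P (Poly_Mapping.single e c)"
  shows "P p"
proof (induction p rule: update_induct)
  case const
  then show ?case using assms(2)[of 0 0] by simp
next
  case (update p e c)
  have "Poly_Mapping.update e c p = p + Poly_Mapping.single e c"
    using update(1) by (intro poly_mapping_eqI)
      (auto simp: lookup_update lookup_add lookup_single in_keys_iff when_def)
  then show ?case using assms update by simp
qed

lemma poly_eval_mult: "poly_eval z (p * q) = poly_eval z p * poly_eval z q"
proof (induction p rule: mpoly_induct)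
  case (add p p')
  then show ?case by (simp add: distrib_right poly_eval_add)
next
  case (single e c)
  show ?case
    by (induction q rule: mpoly_induct)
      (simp_all add: distrib_left poly_eval_add mult_single poly_eval_single mon_eval_add)
qed

lemma mon_eval_inj:
  fixes e f :: "nat \<Rightarrow>\<^sub>0 nat"
  assumes "e \<noteq> f"
  shows "\<exists>a :: nat \<Rightarrow> real. (\<forall>j. a j > 0) \<and> mon_eval a e \<noteq> mon_eval a f"
proof -
  obtain j where j: "Poly_Mapping.lookup e j \<noteq> Poly_Mapping.lookup f j"
    using assms by (metis poly_mapping_eqI)
  define a :: "nat \<Rightarrow> real" where "a = (\<lambda>i. if i = j then 2 else 1)"
  have "mon_eval a g = 2 ^ Poly_Mapping.lookup g j" for g
  proof -
    have "mon_eval a g = (\<Prod>i\<in>insert j (Poly_Mapping.keys g). a i ^ Poly_Mapping.lookup g i)"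
      by (rule mon_eval_superset) auto
    also have "\<dots> = (\<Prod>i\<in>insert j (Poly_Mapping.keys g). if i = j then 2 ^ Poly_Mapping.lookup g i else 1)"
      by (intro prod.cong) (auto simp: a_def)
    finally show ?thesis by (simp add: prod.delta)
  qed
  then have "mon_eval a e \<noteq> mon_eval a f" using j by simp
  moreover have "\<forall>j. a j > 0" by (simp add: a_def)
  ultimately show ?thesis by blast
qed

lemma mon_eval_mult_point: "mon_eval (\<lambda>j. a j * b j) e = mon_eval a e * mon_eval b e"
  by (simp add: mon_eval_def power_mult_distrib prod.distrib)

text \<open>Dedekind's argument: the monomials are pairwise distinct characters of the multiplicative
  group of positive points, hence linearly independent as functions there.\<close>

lemma monomials_independent:
  fixes c :: "(nat \<Rightarrow>\<^sub>0 nat) \<Rightarrow> real"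
  assumes "finite E"
    and "\<And>a. (\<forall>j. a j > 0) \<Longrightarrow> (\<Sum>e\<in>E. c e * mon_eval a e) = 0"
  shows "\<forall>e\<in>E. c e = 0"
  using assms
proof (induction E arbitrary: c rule: finite_induct)
  case empty
  then show ?case by simp
next
  case (insert e E)
  have E: "c f = 0" if f: "f \<in> E" for f
  proof -
    have "f \<noteq> e" using insert f by auto
    then obtain b :: "nat \<Rightarrow> real" where b: "\<forall>j. b j > 0" "mon_eval b f \<noteq> mon_eval b e"
      using mon_eval_inj by blast
    \<comment> \<open>Translating the relation by \<open>b\<close> and subtracting a multiple of it removes the term of \<open>e\<close>.\<close>
    have "\<forall>g\<in>E. c g * (mon_eval b g - mon_eval b e) = 0"
    proof (rule insert.IH)
      fix a :: "nat \<Rightarrow> real" assume a: "\<forall>j. a j > 0"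
      have "(\<Sum>g\<in>insert e E. c g * mon_eval (\<lambda>j. b j * a j) g) = 0"
        by (rule insert.prems) (use a b in simp)
      moreover have "(\<Sum>g\<in>insert e E. c g * mon_eval a g) = 0"
        by (rule insert.prems) (use a in simp)
      ultimately have "(\<Sum>g\<in>insert e E. c g * mon_eval (\<lambda>j. b j * a j) g)
          - mon_eval b e * (\<Sum>g\<in>insert e E. c g * mon_eval a g) = 0"
        by simp
      then show "(\<Sum>g\<in>E. c g * (mon_eval b g - mon_eval b e) * mon_eval a g) = 0"
        using insert.hyps
        by (simp add: mon_eval_mult_point sum_distrib_left sum_subtractf algebra_simps)
    qed
    then show ?thesis using b f by auto
  qed
  have "(\<Sum>g\<in>insert e E. c g * mon_eval (\<lambda>_. 1) g) = 0"
    by (rule insert.prems) simp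
  then have "c e * mon_eval (\<lambda>_. 1 :: real) e = 0" using insert.hyps E by simp
  then have "c e = 0" using mon_eval_pos[of "\<lambda>_. 1" e] by simp
  then show ?case using E by simp
qed

lemma poly_eval_nonzero_point:
  fixes p :: int_mpoly
  assumes "p \<noteq> 0"
  shows "\<exists>a :: nat \<Rightarrow> real. (\<forall>j. a j > 0) \<and> poly_eval a p \<noteq> 0"
proof (rule ccontr)
  assume "\<not> ?thesis"
  then have "\<forall>e\<in>Poly_Mapping.keys p. real_of_int (Poly_Mapping.lookup p e) = 0"
    by (intro monomials_independent) (auto simp: poly_eval_def)
  then have "p = 0" by (intro poly_mapping_eqI) (auto simp: in_keys_iff)
  then show False using assms by simp
qed


text \<open>Evaluation at a point is partial, hence a relation. One representation with a denominator
  that does not vanish at the point suffices, since any two representations agree after cross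
  multiplication.\<close>

definition has_val :: "(nat \<Rightarrow> real) \<Rightarrow> ratfun \<Rightarrow> real \<Rightarrow> bool" where
  "has_val a f r \<longleftrightarrow> (\<exists>p q. poly_eval a q \<noteq> 0 \<and> f = Fraction_Field.Fract p q \<and> r = poly_eval a p / poly_eval a q)"

lemma has_val_Fract: "poly_eval a q \<noteq> 0 \<Longrightarrow> has_val a (Fraction_Field.Fract p q) (poly_eval a p / poly_eval a q)"
  by (auto simp: has_val_def)

lemma has_val_unique:
  assumes "has_val a f r" "has_val a f r'"
  shows "r = r'"
proof -
  obtain p q p' q' where *: "poly_eval a q \<noteq> 0" "f = Fraction_Field.Fract p q" "r = poly_eval a p / poly_eval a q"
    "poly_eval a q' \<noteq> 0" "f = Fraction_Field.Fract p' q'" "r' = poly_eval a p' / poly_eval a q'"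
    using assms unfolding has_val_def by blast
  then have "q \<noteq> 0" "q' \<noteq> 0" by auto
  then have "p * q' = p' * q" using *(2,5) by (simp add: eq_fract)
  then have "poly_eval a p * poly_eval a q' = poly_eval a p' * poly_eval a q"
    by (metis poly_eval_mult)
  then show ?thesis using *(1,3,4,6) by (simp add: frac_eq_eq)
qed

lemma has_val_add: "has_val a f r \<Longrightarrow> has_val a g s \<Longrightarrow> has_val a (f + g) (r + s)"
proof -
  assume "has_val a f r" "has_val a g s"
  then obtain p q p' q' where *: "poly_eval a q \<noteq> 0" "f = Fraction_Field.Fract p q" "r = poly_eval a p / poly_eval a q"
    "poly_eval a q' \<noteq> 0" "g = Fraction_Field.Fract p' q'" "s = poly_eval a p' / poly_eval a q'"
    unfolding has_val_def by blast
  then have "q \<noteq> 0" "q' \<noteq> 0" by auto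
  then show ?thesis
    using * has_val_Fract[of a "q * q'" "p * q' + p' * q"]
    by (simp add: poly_eval_mult poly_eval_add add_frac_eq)
qed

lemma has_val_mult: "has_val a f r \<Longrightarrow> has_val a g s \<Longrightarrow> has_val a (f * g) (r * s)"
proof -
  assume "has_val a f r" "has_val a g s"
  then obtain p q p' q' where *: "poly_eval a q \<noteq> 0" "f = Fraction_Field.Fract p q" "r = poly_eval a p / poly_eval a q"
    "poly_eval a q' \<noteq> 0" "g = Fraction_Field.Fract p' q'" "s = poly_eval a p' / poly_eval a q'"
    unfolding has_val_def by blast
  then show ?thesis
    using has_val_Fract[of a "q * q'" "p * p'"] by (simp add: poly_eval_mult)
qed

lemma has_val_1: "has_val a 1 1"
  using has_val_Fract[of a 1 1] by (simp add: One_fract_def)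

lemma has_val_0: "has_val a 0 0"
  using has_val_Fract[of a 1 0] by (simp add: Zero_fract_def)

lemma has_val_inverse: "has_val a f r \<Longrightarrow> r \<noteq> 0 \<Longrightarrow> has_val a (inverse f) (inverse r)"
proof -
  assume "has_val a f r" "r \<noteq> 0"
  then obtain p q where *: "poly_eval a q \<noteq> 0" "f = Fraction_Field.Fract p q" "r = poly_eval a p / poly_eval a q"
    unfolding has_val_def by blast
  then show ?thesis
    using has_val_Fract[of a p q] \<open>r \<noteq> 0\<close> by simp
qed

lemma has_val_divide: "has_val a f r \<Longrightarrow> has_val a g s \<Longrightarrow> s \<noteq> 0 \<Longrightarrow> has_val a (f / g) (r / s)"
  by (simp add: divide_inverse has_val_mult has_val_inverse)

lemma has_val_power: "has_val a f r \<Longrightarrow> has_val a (f ^ n) (r ^ n)"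
  by (induction n) (auto intro: has_val_1 has_val_mult)

lemma has_val_powi: "has_val a f r \<Longrightarrow> r \<noteq> 0 \<Longrightarrow> has_val a (f powi k) (r powi k)"
  by (auto simp: power_int_def intro: has_val_power has_val_inverse)

lemma has_val_prod: "(\<And>j. j \<in> J \<Longrightarrow> has_val a (f j) (r j)) \<Longrightarrow> has_val a (prod f J) (prod r J)"
  by (induction J rule: infinite_finite_induct) (auto intro: has_val_1 has_val_mult)

lemma has_val_sum: "(\<And>j. j \<in> J \<Longrightarrow> has_val a (f j) (r j)) \<Longrightarrow> has_val a (sum f J) (sum r J)"
  by (induction J rule: infinite_finite_induct) (auto intro: has_val_0 has_val_add)

lemma has_val_indet: "has_val a (indet j) (a j)"
  using has_val_Fract[of a 1 "Poly_Mapping.single (Poly_Mapping.single j 1) 1"]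
  by (simp add: indet_def poly_eval_single)

lemma has_val_of_int: "has_val a (of_int c) (of_int c)"
proof -
  have "has_val a (Fraction_Field.Fract (of_int c) 1) (of_int c)"
    using has_val_Fract[of a 1 "of_int c"]
    by (simp add: single_of_int[symmetric] poly_eval_single)
  moreover have "(of_int c :: ratfun) = Fraction_Field.Fract (of_int c) 1"
    by (cases c) (auto simp: of_nat_fract One_fract_def)
  ultimately show ?thesis by simp
qed

section \<open>Substitutions into rational functions\<close>

definition algebraically_independent :: "(nat \<Rightarrow> ratfun) \<Rightarrow> bool" where
  "algebraically_independent z \<longleftrightarrow> (\<forall>p. p \<noteq> 0 \<longrightarrow> poly_eval z p \<noteq> 0)"

text \<open>Independent of the chosen representation as soon as no denominator is sent to \<open>0\<close>, that is for
  algebraically independent \<open>z\<close>.\<close>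

definition subst :: "(nat \<Rightarrow> ratfun) \<Rightarrow> ratfun \<Rightarrow> ratfun" where
  "subst z f = (THE w. \<exists>p q. q \<noteq> 0 \<and> f = Fraction_Field.Fract p q \<and> w = poly_eval z p / poly_eval z q)"

lemma has_val_poly_eval:
  assumes "\<And>j. has_val a (z j) (b j)"
  shows "has_val a (poly_eval z p) (poly_eval b p)"
  unfolding poly_eval_def mon_eval_def
  by (intro has_val_sum has_val_mult has_val_of_int has_val_prod has_val_power assms)

text \<open>A dominant tuple, one whose values exhaust the positive points, admits no polynomial
  relation: such a relation would be a polynomial vanishing at all positive points.\<close>

lemma algebraically_independentI:
  assumes "\<And>b. (\<forall>j. b j > 0) \<Longrightarrow> \<exists>a. \<forall>j. has_val a (z j) (b j)"
  shows "algebraically_independent z"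
  unfolding algebraically_independent_def
proof (intro allI impI notI)
  fix p :: int_mpoly assume "p \<noteq> 0" and 0: "poly_eval z p = 0"
  then obtain b :: "nat \<Rightarrow> real" where b: "\<forall>j. b j > 0" "poly_eval b p \<noteq> 0"
    using poly_eval_nonzero_point by blast
  obtain a where "\<forall>j. has_val a (z j) (b j)" using assms b by blast
  then have "has_val a 0 (poly_eval b p)" using has_val_poly_eval[of a z b p] 0 by simp
  then show False using b has_val_0 has_val_unique by blast
qed

context
  fixes z :: "nat \<Rightarrow> ratfun"
  assumes indep: "algebraically_independent z"
begin

lemma subst_Fract:
  assumes "q \<noteq> 0"
  shows "subst z (Fraction_Field.Fract p q) = poly_eval z p / poly_eval z q"
  unfolding subst_def
proof (rule the_equality)
  show "\<exists>p' q'. q' \<noteq> 0 \<and> Fraction_Field.Fract p q = Fraction_Field.Fract p' q' \<and>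
      poly_eval z p / poly_eval z q = poly_eval z p' / poly_eval z q'"
    using assms by blast
next
  fix w assume "\<exists>p' q'. q' \<noteq> 0 \<and> Fraction_Field.Fract p q = Fraction_Field.Fract p' q' \<and>
      w = poly_eval z p' / poly_eval z q'"
  then obtain p' q' where *: "q' \<noteq> 0" "Fraction_Field.Fract p q = Fraction_Field.Fract p' q'"
      "w = poly_eval z p' / poly_eval z q'"
    by blast
  then have "p * q' = p' * q" using assms by (simp add: eq_fract)
  then have "poly_eval z p * poly_eval z q' = poly_eval z p' * poly_eval z q"
    by (metis poly_eval_mult)
  moreover have "poly_eval z q \<noteq> 0" "poly_eval z q' \<noteq> 0"
    using indep assms *(1) by (auto simp: algebraically_independent_def)
  ultimately show "w = poly_eval z p / poly_eval z q"
    using *(3) by (simp add: frac_eq_eq)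
qed

lemma subst_indet: "subst z (indet j) = z j"
  by (simp add: indet_def subst_Fract poly_eval_single)

lemma subst_1: "subst z 1 = 1"
  by (simp add: One_fract_def subst_Fract)

lemma subst_mult: "subst z (f * g) = subst z f * subst z g"
proof (cases f, cases g)
  fix p q p' q'
  assume "f = Fraction_Field.Fract p q" "q \<noteq> 0" "g = Fraction_Field.Fract p' q'" "q' \<noteq> 0"
  then show ?thesis by (simp add: subst_Fract poly_eval_mult)
qed

lemma subst_add: "subst z (f + g) = subst z f + subst z g"
proof (cases f, cases g)
  fix p q p' q'
  assume *: "f = Fraction_Field.Fract p q" "q \<noteq> 0" "g = Fraction_Field.Fract p' q'" "q' \<noteq> 0"
  moreover have "poly_eval z q \<noteq> 0" "poly_eval z q' \<noteq> 0"
    using indep * by (auto simp: algebraically_independent_def)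
  ultimately show ?thesis by (simp add: subst_Fract poly_eval_mult poly_eval_add add_frac_eq)
qed

end


section \<open>The ambient field and its endomorphisms\<close>

lemma ring_on_simps [simp]:
  "carrier (ring_on K) = K" "monoid.mult (ring_on K) = (*)" "one (ring_on K) = 1"
  "ring.zero (ring_on K) = 0" "ring.add (ring_on K) = (+)"
  by (simp_all add: ring_on_def)

lemma abelian_group_ring_on_UNIV: "abelian_group (ring_on UNIV)"
proof (rule abelian_groupI)
  fix x :: ratfun
  show "\<exists>y\<in>carrier (ring_on UNIV). y \<oplus>\<^bsub>ring_on UNIV\<^esub> x = \<zero>\<^bsub>ring_on UNIV\<^esub>"
    by (rule bexI[of _ "- x"]) auto
qed (auto simp: algebra_simps)

lemma a_inv_ring_on: "\<ominus>\<^bsub>ring_on UNIV\<^esub> x = - x"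
  by (rule abelian_group.minus_equality[OF abelian_group_ring_on_UNIV]) auto

lemma m_inv_ring_on: "x \<noteq> 0 \<Longrightarrow> inv\<^bsub>ring_on UNIV\<^esub> x = inverse x"
  unfolding m_inv_def by (rule the_equality) (auto simp: field_simps)

lemma ambient_1: "1 \<in> ambient m"
  using generate_field.one[of "ring_on UNIV"] by (simp add: ambient_def)

lemma ambient_indet: "j < m \<Longrightarrow> indet j \<in> ambient m"
  unfolding ambient_def by (rule generate_field.incl) simp

lemma ambient_uminus: "f \<in> ambient m \<Longrightarrow> - f \<in> ambient m"
  using generate_field.a_inv[of f "ring_on UNIV"] by (simp add: ambient_def a_inv_ring_on)

lemma ambient_add: "f \<in> ambient m \<Longrightarrow> g \<in> ambient m \<Longrightarrow> f + g \<in> ambient m"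
  using generate_field.eng_add[of f "ring_on UNIV"] by (simp add: ambient_def)

lemma ambient_mult: "f \<in> ambient m \<Longrightarrow> g \<in> ambient m \<Longrightarrow> f * g \<in> ambient m"
  using generate_field.eng_mult[of f "ring_on UNIV"] by (simp add: ambient_def)

lemma ambient_0: "0 \<in> ambient m"
  using ambient_add[OF ambient_1 ambient_uminus[OF ambient_1]] by simp

lemma ambient_inverse: "f \<in> ambient m \<Longrightarrow> inverse f \<in> ambient m"
  using generate_field.m_inv[of f "ring_on UNIV"] ambient_0
  by (cases "f = 0") (auto simp: ambient_def m_inv_ring_on)

lemma ambient_divide: "f \<in> ambient m \<Longrightarrow> g \<in> ambient m \<Longrightarrow> f / g \<in> ambient m"
  by (simp add: divide_inverse ambient_mult ambient_inverse)

lemma ambient_power: "f \<in> ambient m \<Longrightarrow> f ^ n \<in> ambient m"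
  by (induction n) (auto intro: ambient_1 ambient_mult)

lemma ambient_powi: "f \<in> ambient m \<Longrightarrow> f powi k \<in> ambient m"
  by (auto simp: power_int_def intro: ambient_power ambient_inverse)

lemma ambient_prod: "(\<And>j. j \<in> J \<Longrightarrow> f j \<in> ambient m) \<Longrightarrow> prod f J \<in> ambient m"
  by (induction J rule: infinite_finite_induct) (auto intro: ambient_1 ambient_mult)

lemmas ambient_intros = ambient_1 ambient_indet ambient_add ambient_mult ambient_inverse
  ambient_divide ambient_power ambient_powi ambient_prod

lemma ambient_induct [consumes 1, case_names one indet uminus inverse add mult]:
  assumes "f \<in> ambient m" "P 1" "\<And>j. j < m \<Longrightarrow> P (indet j)"
    "\<And>f. f \<in> ambient m \<Longrightarrow> P f \<Longrightarrow> P (- f)"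
    "\<And>f. f \<in> ambient m \<Longrightarrow> f \<noteq> 0 \<Longrightarrow> P f \<Longrightarrow> P (inverse f)"
    "\<And>f g. f \<in> ambient m \<Longrightarrow> g \<in> ambient m \<Longrightarrow> P f \<Longrightarrow> P g \<Longrightarrow> P (f + g)"
    "\<And>f g. f \<in> ambient m \<Longrightarrow> g \<in> ambient m \<Longrightarrow> P f \<Longrightarrow> P g \<Longrightarrow> P (f * g)"
  shows "P f"
  using assms(1) unfolding ambient_def
proof (induction rule: generate_field.induct)
  case one
  then show ?case using assms(2) by simp
next
  case (incl h)
  then show ?case using assms(3) by auto
next
  case (a_inv h)
  then show ?case using assms(4) by (simp add: a_inv_ring_on ambient_def)
next
  case (m_inv h)
  then show ?case using assms(5)[of h] by (simp add: m_inv_ring_on ambient_def)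
next
  case (eng_add f g)
  then show ?case using assms(6) by (simp add: ambient_def)
next
  case (eng_mult f g)
  then show ?case using assms(7) by (simp add: ambient_def)
qed

abbreviation endo :: "nat \<Rightarrow> (ratfun \<Rightarrow> ratfun) \<Rightarrow> bool" where
  "endo m \<Psi> \<equiv> \<Psi> \<in> ring_hom (ring_on (ambient m)) (ring_on (ambient m))"

lemma endo_closed: "endo m \<Psi> \<Longrightarrow> f \<in> ambient m \<Longrightarrow> \<Psi> f \<in> ambient m"
  by (auto dest: ring_hom_closed)

lemma endo_1: "endo m \<Psi> \<Longrightarrow> \<Psi> 1 = 1"
  by (auto dest: ring_hom_one)

lemma endo_mult: "endo m \<Psi> \<Longrightarrow> f \<in> ambient m \<Longrightarrow> g \<in> ambient m \<Longrightarrow> \<Psi> (f * g) = \<Psi> f * \<Psi> g"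
  using ring_hom_mult[of \<Psi> "ring_on (ambient m)" "ring_on (ambient m)" f g] by simp

lemma endo_add: "endo m \<Psi> \<Longrightarrow> f \<in> ambient m \<Longrightarrow> g \<in> ambient m \<Longrightarrow> \<Psi> (f + g) = \<Psi> f + \<Psi> g"
  using ring_hom_add[of \<Psi> "ring_on (ambient m)" "ring_on (ambient m)" f g] by simp

lemma endo_nonzero: "endo m \<Psi> \<Longrightarrow> f \<in> ambient m \<Longrightarrow> f \<noteq> 0 \<Longrightarrow> \<Psi> f \<noteq> 0"
  using endo_mult[of \<Psi> m f "inverse f"] endo_1[of \<Psi> m] ambient_inverse[of f m] by auto

lemma endo_0: "endo m \<Psi> \<Longrightarrow> \<Psi> 0 = 0"
  using endo_add[of \<Psi> m 0 0] ambient_0[of m] by (metis add.right_neutral add_left_cancel)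

lemma endo_inverse: "endo m \<Psi> \<Longrightarrow> f \<in> ambient m \<Longrightarrow> \<Psi> (inverse f) = inverse (\<Psi> f)"
  using endo_mult[of \<Psi> m f "inverse f"] endo_1[of \<Psi> m] ambient_inverse[of f m]
    endo_nonzero[of \<Psi> m f] endo_0[of \<Psi> m]
  by (cases "f = 0") (auto simp: field_simps)

lemma endo_divide: "endo m \<Psi> \<Longrightarrow> f \<in> ambient m \<Longrightarrow> g \<in> ambient m \<Longrightarrow> \<Psi> (f / g) = \<Psi> f / \<Psi> g"
  by (simp add: divide_inverse endo_mult endo_inverse ambient_inverse)

lemma endo_power: "endo m \<Psi> \<Longrightarrow> f \<in> ambient m \<Longrightarrow> \<Psi> (f ^ n) = \<Psi> f ^ n"
  by (induction n) (auto simp: endo_1 endo_mult ambient_power)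

lemma endo_powi: "endo m \<Psi> \<Longrightarrow> f \<in> ambient m \<Longrightarrow> \<Psi> (f powi k) = \<Psi> f powi k"
  by (auto simp: power_int_def endo_power endo_inverse ambient_inverse)

lemma endo_prod:
  "endo m \<Psi> \<Longrightarrow> (\<And>j. j \<in> J \<Longrightarrow> f j \<in> ambient m) \<Longrightarrow> \<Psi> (prod f J) = (\<Prod>j\<in>J. \<Psi> (f j))"
  by (induction J rule: infinite_finite_induct) (auto simp: endo_1 endo_mult ambient_prod)

lemma endo_id: "endo m (\<lambda>x\<in>ambient m. x)"
  by (rule ring_hom_memI) (auto intro: ambient_intros)

lemma endo_compose: "endo m \<Phi> \<Longrightarrow> endo m \<Psi> \<Longrightarrow> endo m (compose (ambient m) \<Phi> \<Psi>)"
  by (rule ring_hom_memI)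
    (auto simp: compose_eq endo_closed endo_mult endo_add endo_1 ambient_intros)

lemma endo_subst:
  assumes "algebraically_independent z" "\<And>j. j < m \<Longrightarrow> z j \<in> ambient m"
  shows "endo m (restrict (subst z) (ambient m))"
proof -
  note s = subst_1[OF assms(1)] subst_mult[OF assms(1)] subst_add[OF assms(1)]
    subst_indet[OF assms(1)]
  have s0: "subst z 0 = 0" using s(3)[of 0 0] by (metis add.right_neutral add_left_cancel)
  have sm: "subst z (- f) = - subst z f" for f
    using s(3)[of f "- f"] s0 by (simp add: eq_neg_iff_add_eq_0 add.commute)
  have si: "subst z (inverse f) = inverse (subst z f)" if "f \<noteq> 0" for f
    using s(2)[of f "inverse f"] s(1) that by (metis inverse_unique right_inverse)
  have "subst z f \<in> ambient m" if "f \<in> ambient m" for f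
    using that
    by (induction rule: ambient_induct)
      (auto simp: s sm si assms(2) intro: ambient_intros ambient_uminus)
  then show ?thesis
    by (intro ring_hom_memI) (auto simp: s ambient_intros)
qed


section \<open>Frozen monomials\<close>

abbreviation frozen_monomials :: "nat \<Rightarrow> ratfun set" where
  "frozen_monomials m \<equiv> coeff_group m 2"

definition frozen_mon :: "nat \<Rightarrow> (nat \<Rightarrow> int) \<Rightarrow> ratfun" where
  "frozen_mon m e = (\<Prod>j\<in>{2..<m}. indet j powi e j)"

lemma indet_nonzero [simp]: "indet j \<noteq> 0"
  using has_val_indet[of "\<lambda>_. 1" j] has_val_0[of "\<lambda>_. 1"] has_val_unique by fastforce

lemma frozen_mon_nonzero [simp]: "frozen_mon m e \<noteq> 0"
  by (simp add: frozen_mon_def)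

lemma frozen_monomials_eq: "frozen_monomials m = range (frozen_mon m)"
  by (auto simp: coeff_group_def frozen_mon_def)

lemma frozen_mon_in [simp]: "frozen_mon m e \<in> frozen_monomials m"
  by (auto simp: frozen_monomials_eq)

lemma frozen_mon_ambient [simp]: "frozen_mon m e \<in> ambient m"
  by (auto simp: frozen_mon_def intro!: ambient_intros)

lemma frozen_monomials_ambient: "p \<in> frozen_monomials m \<Longrightarrow> p \<in> ambient m"
  by (auto simp: frozen_monomials_eq)

lemma frozen_mon_add: "frozen_mon m (\<lambda>j. e j + f j) = frozen_mon m e * frozen_mon m f"
  by (simp add: frozen_mon_def power_int_add prod.distrib)

lemma frozen_mon_0: "frozen_mon m (\<lambda>_. 0) = 1"
  by (simp add: frozen_mon_def)

lemma frozen_mon_uminus: "frozen_mon m (\<lambda>j. - e j) = inverse (frozen_mon m e)"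
  by (simp add: frozen_mon_def power_int_minus prod_inversef[unfolded o_def, symmetric])

lemma frozen_mon_powi: "frozen_mon m e powi k = frozen_mon m (\<lambda>j. k * e j)"
proof -
  have "(\<Prod>j\<in>J. indet j powi e j) powi k = (\<Prod>j\<in>J. indet j powi (k * e j))" for J
    by (induction J rule: infinite_finite_induct)
      (auto simp: power_int_mult_distrib power_int_mult mult.commute[of k])
  then show ?thesis by (simp add: frozen_mon_def)
qed

lemma frozen_monomials_1 [simp]: "1 \<in> frozen_monomials m"
  using frozen_mon_in[of m "\<lambda>_. 0"] by (simp add: frozen_mon_0)

lemma frozen_monomials_mult:
  "p \<in> frozen_monomials m \<Longrightarrow> q \<in> frozen_monomials m \<Longrightarrow> p * q \<in> frozen_monomials m"
  by (auto simp: frozen_monomials_eq simp flip: frozen_mon_add)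

lemma frozen_monomials_inverse:
  "p \<in> frozen_monomials m \<Longrightarrow> inverse p \<in> frozen_monomials m"
  by (auto simp: frozen_monomials_eq simp flip: frozen_mon_uminus)

lemma frozen_monomials_divide:
  "p \<in> frozen_monomials m \<Longrightarrow> q \<in> frozen_monomials m \<Longrightarrow> p / q \<in> frozen_monomials m"
  by (simp add: divide_inverse frozen_monomials_mult frozen_monomials_inverse)

lemma frozen_monomials_powi: "p \<in> frozen_monomials m \<Longrightarrow> p powi k \<in> frozen_monomials m"
  by (auto simp: frozen_monomials_eq frozen_mon_powi)

lemma frozen_monomials_nonzero: "p \<in> frozen_monomials m \<Longrightarrow> p \<noteq> 0"
  by (auto simp: frozen_monomials_eq)

lemma frozen_monomials_trivial: "frozen_monomials 2 = {1}"
  by (auto simp: frozen_monomials_eq frozen_mon_def)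

lemma frozen_mon_val:
  assumes "\<And>j. a j > 0"
  shows "has_val a (frozen_mon m e) (\<Prod>j\<in>{2..<m}. a j powi e j)"
  unfolding frozen_mon_def
proof (intro has_val_prod has_val_powi has_val_indet)
  show "a j \<noteq> 0" for j using assms[of j] by simp
qed

text \<open>Equality of nonzero elements modulo frozen monomials. As \<open>0\<close> is not a frozen monomial,
  both sides are nonzero as soon as the relation holds.\<close>

definition assoc :: "nat \<Rightarrow> ratfun \<Rightarrow> ratfun \<Rightarrow> bool" where
  "assoc m f g \<longleftrightarrow> f / g \<in> frozen_monomials m"

lemma assoc_iff: "assoc m f g \<longleftrightarrow> g \<noteq> 0 \<and> (\<exists>p\<in>frozen_monomials m. f = p * g)"
  unfolding assoc_def
  using frozen_monomials_nonzero[of 0 m] by (auto simp: field_simps intro!: bexI[of _ "f / g"])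

lemma assocI: "g \<noteq> 0 \<Longrightarrow> p \<in> frozen_monomials m \<Longrightarrow> f = p * g \<Longrightarrow> assoc m f g"
  by (auto simp: assoc_iff)

lemma assoc_refl: "f \<noteq> 0 \<Longrightarrow> assoc m f f"
  by (simp add: assoc_def)

lemma assoc_nonzero: "assoc m f g \<Longrightarrow> f \<noteq> 0 \<and> g \<noteq> 0"
  using frozen_monomials_nonzero by (auto simp: assoc_iff)

lemma assoc_sym: "assoc m f g \<Longrightarrow> assoc m g f"
  unfolding assoc_def using frozen_monomials_inverse[of "f / g" m] by simp

lemma assoc_trans: "assoc m f g \<Longrightarrow> assoc m g h \<Longrightarrow> assoc m f h"
  using assoc_nonzero[of m f g] frozen_monomials_mult[of "f / g" m "g / h"]
  unfolding assoc_def by simp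

lemma assoc_mult: "assoc m f g \<Longrightarrow> assoc m f' g' \<Longrightarrow> assoc m (f * f') (g * g')"
  using frozen_monomials_mult[of "f / g" m "f' / g'"] unfolding assoc_def by simp

lemma assoc_divide: "assoc m f g \<Longrightarrow> assoc m f' g' \<Longrightarrow> assoc m (f / f') (g / g')"
  using frozen_monomials_divide[of "f / g" m "f' / g'"] unfolding assoc_def
  by (simp add: field_simps)

lemma assoc_frozen: "p \<in> frozen_monomials m \<Longrightarrow> q \<in> frozen_monomials m \<Longrightarrow> assoc m p q"
  by (simp add: assoc_def frozen_monomials_divide)

lemma assoc_trivial: "assoc 2 f g \<longleftrightarrow> g \<noteq> 0 \<and> f = g"
  by (auto simp: assoc_iff frozen_monomials_trivial)

lemma assoc_endo:
  assumes "endo m \<Psi>" "\<Psi> ` frozen_monomials m \<subseteq> frozen_monomials m"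
    and "f \<in> ambient m" "g \<in> ambient m" "assoc m f g"
  shows "assoc m (\<Psi> f) (\<Psi> g)"
  using assms unfolding assoc_def by (metis endo_divide image_subset_iff)

text \<open>Cluster variables are built from the indeterminates without subtraction, and positivity is
  preserved by the operations involved; it serves to show that they and their exchange binomials
  do not vanish.\<close>

definition positive :: "ratfun \<Rightarrow> bool" where
  "positive f \<longleftrightarrow> (\<forall>a. (\<forall>j. a j > 0) \<longrightarrow> (\<exists>r>0. has_val a f r))"

lemma positive_nonzero: "positive f \<Longrightarrow> f \<noteq> 0"
proof
  assume "positive f" "f = 0"
  then obtain r :: real where "r > 0" "has_val (\<lambda>_. 1) 0 r" by (force simp: positive_def)
  then show False using has_val_0 has_val_unique by blast
qed

lemma positive_add: "positive f \<Longrightarrow> positive g \<Longrightarrow> positive (f + g)"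
  unfolding positive_def by (meson has_val_add add_pos_pos)

lemma positive_mult: "positive f \<Longrightarrow> positive g \<Longrightarrow> positive (f * g)"
  unfolding positive_def by (meson has_val_mult mult_pos_pos)

lemma positive_1: "positive 1"
  unfolding positive_def by (meson has_val_1 zero_less_one)

lemma positive_indet: "positive (indet j)"
  unfolding positive_def by (meson has_val_indet)

lemma positive_inverse: "positive f \<Longrightarrow> positive (inverse f)"
  unfolding positive_def by (metis has_val_inverse less_numeral_extra(3) positive_imp_inverse_positive)

lemma positive_divide: "positive f \<Longrightarrow> positive g \<Longrightarrow> positive (f / g)"
  by (simp add: divide_inverse positive_mult positive_inverse)

lemma positive_power: "positive f \<Longrightarrow> positive (f ^ n)"
  by (induction n) (auto intro: positive_1 positive_mult)

lemma positive_powi: "positive f \<Longrightarrow> positive (f powi k)"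
  by (auto simp: power_int_def intro: positive_power positive_inverse)

lemma positive_prod: "(\<And>j. j \<in> J \<Longrightarrow> positive (f j)) \<Longrightarrow> positive (prod f J)"
  by (induction J rule: infinite_finite_induct) (auto intro: positive_1 positive_mult)

lemma positive_frozen_mon: "positive (frozen_mon m e)"
  unfolding frozen_mon_def by (intro positive_prod positive_powi positive_indet)

lemmas positive_intros = positive_1 positive_indet positive_add positive_mult positive_inverse
  positive_divide positive_power positive_powi positive_prod positive_frozen_mon

section \<open>Seeds of rank two along a line\<close>

definition swap :: "seed \<Rightarrow> seed" where
  "swap = relabel (Transposition.transpose 0 1)"

lemma swap_simps [simp]:
  "fst (swap S) 0 = fst S 1" "fst (swap S) (Suc 0) = fst S 0"
  "j \<ge> 2 \<Longrightarrow> fst (swap S) j = fst S j"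
  "snd (swap S) 0 0 = snd S 1 1" "snd (swap S) 0 (Suc 0) = snd S 1 0"
  "snd (swap S) (Suc 0) 0 = snd S 0 1" "snd (swap S) (Suc 0) (Suc 0) = snd S 0 0"
  "j \<ge> 2 \<Longrightarrow> snd (swap S) j 0 = snd S j 1" "j \<ge> 2 \<Longrightarrow> snd (swap S) j (Suc 0) = snd S j 0"
  by (auto simp: swap_def relabel_def split: prod.splits)

lemma swap_swap [simp]: "swap (swap S) = S"
  by (cases S) (simp add: swap_def relabel_def)

lemma lessThan_split:
  assumes "2 \<le> m"
  shows "{..<m} = insert 0 (insert (Suc 0) {2..<m})"
  using assms by auto

lemma prod_split:
  fixes f :: "nat \<Rightarrow> ratfun"
  assumes "2 \<le> m"
  shows "(\<Prod>j<m. f j) = f 0 * f 1 * (\<Prod>j\<in>{2..<m}. f j)"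
  using assms by (simp add: lessThan_split mult.assoc)

lemma fst_mutate_other: "j \<noteq> k \<Longrightarrow> fst (mutate m k S) j = fst S j"
  by (simp add: mutate_def split: prod.splits)

lemma fst_mutate: "fst (mutate m k S) k =
    ((\<Prod>j<m. fst S j powi max (snd S j k) 0) + (\<Prod>j<m. fst S j powi max (- snd S j k) 0)) / fst S k"
  by (simp add: mutate_def split: prod.splits)

lemma snd_mutate: "snd (mutate m k S) j i =
    (if i = k \<or> j = k then - snd S j i
     else snd S j i + max (- snd S j k) 0 * snd S k i + snd S j k * max (snd S k i) 0)"
  by (simp add: mutate_def split: prod.splits)

text \<open>Mutating twice exchanges the two monomials of the exchange binomial, as it negates the column \<open>k\<close>.\<close>

lemma mutate_mutate:
  assumes "snd S k k = 0" "fst S k \<noteq> 0" "fst (mutate m k S) k \<noteq> 0"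
  shows "mutate m k (mutate m k S) = S"
proof (rule prod_eqI; rule ext)
  fix j
  let ?S = "mutate m k S"
  have e: "(\<Prod>j<m. fst ?S j powi max (c * snd ?S j k) 0) = (\<Prod>j<m. fst S j powi max (- (c * snd S j k)) 0)"
    for c
  proof (intro prod.cong refl)
    fix j
    show "fst ?S j powi max (c * snd ?S j k) 0 = fst S j powi max (- (c * snd S j k)) 0"
      by (cases "j = k") (simp_all add: fst_mutate_other snd_mutate assms(1))
  qed
  show "fst (mutate m k ?S) j = fst S j"
  proof (cases "j = k")
    case True
    let ?N = "(\<Prod>j<m. fst S j powi max (snd S j k) 0) + (\<Prod>j<m. fst S j powi max (- snd S j k) 0)"
    have "fst (mutate m k ?S) k = ?N / fst ?S k"
      using e[of 1] e[of "-1"] by (simp add: fst_mutate[of m k ?S] add.commute)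
    moreover have "fst ?S k = ?N / fst S k" by (rule fst_mutate)
    ultimately show ?thesis using True assms(2,3) by auto
  qed (simp add: fst_mutate_other)
next
  fix j
  show "snd (mutate m k (mutate m k S)) j = snd S j"
    by (rule ext) (auto simp: snd_mutate max_def algebra_simps)
qed

text \<open>Relabeling conjugates the two mutations into each other, so that one of them is enough.\<close>

lemma mutate_1:
  assumes "2 \<le> m"
  shows "mutate m 1 S = swap (mutate m 0 (swap S))"
proof (cases S)
  case (Pair x B)
  let ?t = "Transposition.transpose 0 (1::nat)"
  have t: "?t permutes {..<m}" using assms by (intro permutes_swap_id) auto
  have p: "(\<Prod>j<m. f (?t j)) = (\<Prod>j<m. f j)" for f :: "nat \<Rightarrow> ratfun"
    using prod.permute[OF t, of f] by (simp add: o_def)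
  have eq: "?t i = 0 \<longleftrightarrow> i = 1" for i
    by (auto simp: Transposition.transpose_def)
  have inv: "?t (?t i) = i" for i by simp
  have x: "(\<Prod>j<m. x (?t j) powi max (B (?t j) 1) 0) = (\<Prod>j<m. x j powi max (B j 1) 0)"
    "(\<Prod>j<m. x (?t j) powi max (- B (?t j) 1) 0) = (\<Prod>j<m. x j powi max (- B j 1) 0)"
    using p[of "\<lambda>j. x j powi max (B j 1) 0"] p[of "\<lambda>j. x j powi max (- B j 1) 0"] by auto
  show ?thesis
    unfolding Pair swap_def relabel_def mutate_def
    by (auto simp: fun_eq_iff eq[simplified] inv x[simplified])
qed

lemma permutes_two:
  assumes "\<sigma> permutes {..<2::nat}"
  shows "\<sigma> = id \<or> \<sigma> = Transposition.transpose 0 1"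
proof -
  have "{..<2::nat} = {0, 1}" by auto
  then have "\<sigma> permutes {0, 1}" using assms by simp
  then show ?thesis by (metis permutes_doubleton_iff)
qed


text \<open>Mutation reverses the signs of the exchange matrix, and so does swapping the labels. Doing both
  therefore preserves the sign pattern fixed here, which spares all later arguments a distinction
  of signs and of the direction of mutation.\<close>

definition oriented :: "nat \<Rightarrow> seed \<Rightarrow> bool" where
  "oriented m S \<longleftrightarrow> (\<forall>j\<ge>2. fst S j = indet j) \<and> (\<forall>i<2. fst S i \<in> ambient m \<and> positive (fst S i)) \<and>
     snd S 0 0 = 0 \<and> snd S 1 1 = 0 \<and> snd S 0 1 > 0 \<and> snd S 1 0 < 0"

definition shift :: "nat \<Rightarrow> seed \<Rightarrow> seed" where
  "shift m S = swap (mutate m 0 S)"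

definition unshift :: "nat \<Rightarrow> seed \<Rightarrow> seed" where
  "unshift m S = mutate m 0 (swap S)"

lemma orientedD:
  assumes "oriented m S"
  shows "fst S 0 \<in> ambient m" "fst S (Suc 0) \<in> ambient m" "positive (fst S 0)" "positive (fst S (Suc 0))"
    "snd S 0 0 = 0" "snd S (Suc 0) (Suc 0) = 0" "snd S 0 (Suc 0) > 0" "snd S (Suc 0) 0 < 0"
  using assms by (auto simp: oriented_def)

lemma oriented_frozen: "oriented m S \<Longrightarrow> j \<ge> 2 \<Longrightarrow> fst S j = indet j"
  by (simp add: oriented_def)

context
  fixes m :: nat and S :: seed
  assumes m: "2 \<le> m" and S: "oriented m S"
begin

lemma oriented_nonzero: "fst S 0 \<noteq> 0" "fst S (Suc 0) \<noteq> 0"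
  using orientedD(3,4)[OF S] positive_nonzero by auto

lemma frozen_part: "(\<Prod>j\<in>{2..<m}. fst S j powi e j) = frozen_mon m e"
  unfolding frozen_mon_def using S by (intro prod.cong) (auto simp: oriented_frozen)

lemma oriented_yhat_0: "yhat m S 0 = fst S 1 powi snd S 1 0 * frozen_mon m (\<lambda>j. snd S j 0)"
  by (simp add: yhat_def prod_split[OF m] frozen_part orientedD[OF S])

lemma oriented_yhat_1: "yhat m S 1 = fst S 0 powi snd S 0 1 * frozen_mon m (\<lambda>j. snd S j 1)"
  by (simp add: yhat_def prod_split[OF m] frozen_part orientedD[OF S])

lemma fst_shift: "fst (shift m S) 0 = fst S 1"
  "fst (shift m S) 1 = (frozen_mon m (\<lambda>j. max (snd S j 0) 0)
     + fst S 1 powi (- snd S 1 0) * frozen_mon m (\<lambda>j. max (- snd S j 0) 0)) / fst S 0"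
  using orientedD(7,8)[OF S]
  by (simp_all add: shift_def fst_mutate_other fst_mutate prod_split[OF m] frozen_part orientedD(5,6)[OF S])

lemma snd_shift:
  "snd (shift m S) 0 1 = - snd S 1 0" "snd (shift m S) 1 0 = - snd S 0 1"
  "j \<ge> 2 \<Longrightarrow> snd (shift m S) j 0 = snd S j 1 + max (snd S j 0) 0 * snd S 0 1"
  "j \<ge> 2 \<Longrightarrow> snd (shift m S) j 1 = - snd S j 0"
  using S by (auto simp: shift_def snd_mutate oriented_def max_def algebra_simps)

text \<open>Up to a frozen monomial the new cluster variable depends on the frozen rows only through the
  \<open>y\<close>-variable. This is why proportionality of seeds is compatible with mutation.\<close>

lemma exchange_shift:
  "fst (shift m S) 1 * fst S 0 = frozen_mon m (\<lambda>j. max (snd S j 0) 0) * (1 + inverse (yhat m S 0))"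
proof -
  have e: "(\<lambda>j. max (- snd S j 0) 0) = (\<lambda>j. max (snd S j 0) 0 + - snd S j 0)"
    by (auto simp: fun_eq_iff max_def)
  have "frozen_mon m (\<lambda>j. max (- snd S j 0) 0)
      = frozen_mon m (\<lambda>j. max (snd S j 0) 0) * inverse (frozen_mon m (\<lambda>j. snd S j 0))"
    unfolding e frozen_mon_add frozen_mon_uminus ..
  moreover have "fst (shift m S) 1 * fst S 0 = frozen_mon m (\<lambda>j. max (snd S j 0) 0)
     + fst S 1 powi (- snd S 1 0) * frozen_mon m (\<lambda>j. max (- snd S j 0) 0)"
    unfolding fst_shift using oriented_nonzero by simp
  ultimately show ?thesis
    unfolding oriented_yhat_0 by (simp add: power_int_minus distrib_left mult_ac)
qed

lemma oriented_shift: "oriented m (shift m S)"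
proof -
  have "fst (shift m S) 1 \<in> ambient m" "positive (fst (shift m S) 1)"
    unfolding fst_shift(2)
    by (auto simp: orientedD[OF S] intro!: ambient_intros positive_intros)
  moreover have "fst (shift m S) j = indet j" if "j \<ge> 2" for j
    using that S by (simp add: shift_def fst_mutate_other oriented_def)
  moreover have "snd (shift m S) 0 0 = 0" "snd (shift m S) 1 1 = 0"
    using orientedD[OF S] by (auto simp: shift_def snd_mutate max_def)
  ultimately show ?thesis
    using orientedD[OF S] snd_shift(1,2) fst_shift(1) by (simp add: oriented_def less_2_cases_iff)
qed

lemma yhat_shift_1: "yhat m (shift m S) 1 = inverse (yhat m S 0)"
proof -
  have "yhat m (shift m S) 1 = fst (shift m S) 0 powi snd (shift m S) 0 1
      * (\<Prod>j\<in>{2..<m}. indet j powi snd (shift m S) j 1)"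
    by (simp add: yhat_def prod_split[OF m] orientedD[OF oriented_shift] oriented_frozen[OF oriented_shift])
  also have "(\<Prod>j\<in>{2..<m}. indet j powi snd (shift m S) j 1) = frozen_mon m (\<lambda>j. - snd S j 0)"
    unfolding frozen_mon_def by (intro prod.cong) (auto simp: snd_shift(4)[simplified])
  finally show ?thesis
    unfolding fst_shift snd_shift oriented_yhat_0 frozen_mon_uminus by (simp add: power_int_minus)
qed

text \<open>The frozen factor \<open>p\<close> of the new cluster variable cancels against the change of the frozen row.\<close>

lemma rescaling_identity:
  fixes f g p h :: "'a::field"
  assumes "f \<noteq> 0" "p \<noteq> 0"
  shows "(p * h / f) powi (- b) * (g * p powi b) = f powi b * g * h powi (- b)"
proof -
  have "(p * h / f) powi (- b) = p powi (- b) * h powi (- b) * f powi b"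
    by (simp add: power_int_mult_distrib power_int_divide_distrib power_int_minus divide_inverse power_int_inverse)
  moreover have "p powi (- b) * p powi b = 1"
    using assms by (simp add: power_int_minus)
  ultimately show ?thesis by (metis (no_types, opaque_lifting) mult.assoc mult.commute mult.right_neutral)
qed

lemma yhat_shift_0:
  "yhat m (shift m S) 0 = yhat m S 1 * (1 + inverse (yhat m S 0)) powi (- snd S 0 1)"
proof -
  let ?p = "frozen_mon m (\<lambda>j. max (snd S j 0) 0)" and ?b = "snd S 0 1"
  have "yhat m (shift m S) 0 = fst (shift m S) 1 powi snd (shift m S) 1 0
      * (\<Prod>j\<in>{2..<m}. indet j powi snd (shift m S) j 0)"
    by (simp add: yhat_def prod_split[OF m] orientedD[OF oriented_shift] oriented_frozen[OF oriented_shift])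
  also have "(\<Prod>j\<in>{2..<m}. indet j powi snd (shift m S) j 0)
      = frozen_mon m (\<lambda>j. snd S j 1 + ?b * max (snd S j 0) 0)"
    unfolding frozen_mon_def by (intro prod.cong) (auto simp: snd_shift(3) mult.commute)
  also have "\<dots> = frozen_mon m (\<lambda>j. snd S j 1) * ?p powi ?b"
    unfolding frozen_mon_add frozen_mon_powi ..
  also have "fst (shift m S) 1 = ?p * (1 + inverse (yhat m S 0)) / fst S 0"
    using exchange_shift oriented_nonzero by (simp add: field_simps)
  finally show ?thesis
    unfolding snd_shift oriented_yhat_1
    using rescaling_identity[OF oriented_nonzero(1) frozen_mon_nonzero] by metis
qed

lemma oriented_unshift: "oriented m (unshift m S)"
proof -
  have x: "fst (unshift m S) 0 =
     (fst S 0 powi snd S 0 1 * frozen_mon m (\<lambda>j. max (snd S j 1) 0)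
      + frozen_mon m (\<lambda>j. max (- snd S j 1) 0)) / fst S 1"
    using orientedD(7,8)[OF S]
    by (simp add: unshift_def fst_mutate prod_split[OF m] frozen_part orientedD(5,6)[OF S])
  have "fst (unshift m S) 0 \<in> ambient m" "positive (fst (unshift m S) 0)"
    unfolding x
    by (auto simp: orientedD[OF S] intro!: ambient_intros positive_intros)
  moreover have "fst (unshift m S) j = indet j" if "j \<ge> 2" for j
    using that S by (simp add: unshift_def fst_mutate_other oriented_def)
  moreover have "fst (unshift m S) 1 = fst S 0" by (simp add: unshift_def fst_mutate_other)
  moreover have "snd (unshift m S) 0 0 = 0" "snd (unshift m S) 1 1 = 0"
     "snd (unshift m S) 0 1 > 0" "snd (unshift m S) 1 0 < 0"
    using orientedD[OF S] by (auto simp: unshift_def snd_mutate max_def)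
  ultimately show ?thesis
    using orientedD[OF S] by (simp add: oriented_def less_2_cases_iff)
qed

lemma shift_unshift: "shift m (unshift m S) = S"
proof -
  have "fst (unshift m S) 0 \<noteq> 0" 
    by (rule positive_nonzero[OF orientedD(3)[OF oriented_unshift]])
  then have "mutate m 0 (unshift m S) = swap S"
    using mutate_mutate[of "swap S" 0 m] orientedD(6)[OF S] oriented_nonzero(2)
    by (simp add: unshift_def)
  then show ?thesis by (simp add: shift_def)
qed

lemma mutate_shift: "mutate m 0 (swap (shift m S)) = S"
proof -
  have "fst (mutate m 0 S) 0 \<noteq> 0"
    using positive_nonzero[OF orientedD(4)[OF oriented_shift]] by (simp add: shift_def)
  then show ?thesis
    using mutate_mutate[of S 0 m] orientedD(5)[OF S] oriented_nonzero(1)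
    by (simp add: shift_def)
qed

end

lemma indecomposable_two_entries:
  assumes "skew_symmetrizable 2 B" "indecomposable 2 2 B"
  shows "B 0 0 = 0" "B 1 1 = 0" "(B 0 1 > 0 \<and> B 1 0 < 0) \<or> (B 0 1 < 0 \<and> B 1 0 > 0)"
proof -
  obtain d :: "nat \<Rightarrow> int" where d: "\<forall>i<2. d i > 0" "\<forall>i<2. \<forall>j<2. d i * B i j = - (d j * B j i)"
    using assms(1) unfolding skew_symmetrizable_def by blast
  have d0: "d 0 > 0" "d 1 > 0" using d(1) by auto
  have e0: "d 0 * B 0 0 = - (d 0 * B 0 0)" by (rule d(2)[rule_format]) auto
  have e1: "d 1 * B 1 1 = - (d 1 * B 1 1)" by (rule d(2)[rule_format]) auto
  have s: "d 0 * B 0 1 = - (d 1 * B 1 0)" by (rule d(2)[rule_format]) auto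
  have "d 0 * B 0 0 = 0" "d 1 * B 1 1 = 0" using e0 e1 by linarith+
  then show "B 0 0 = 0" "B 1 1 = 0" using d0 by auto
  have n: "B 0 1 \<noteq> 0 \<or> B 1 0 \<noteq> 0"
  proof (rule ccontr)
    assume *: "\<not> ?thesis"
    have "(1::nat) \<in> {..<2}" by simp
    then have "{0} \<noteq> {..<2::nat}" by (metis singletonD zero_neq_one)
    then have "{0} \<subset> {..<2::nat}" by (simp add: psubsetI)
    moreover have "\<forall>j<2. \<forall>i<2. (j \<in> {0::nat}) \<noteq> (i \<in> {0}) \<longrightarrow> B j i = 0"
      using * by (auto simp: less_2_cases_iff)
    ultimately show False using assms(2) unfolding indecomposable_def by blast
  qed
  consider "B 0 1 > 0" | "B 0 1 < 0" | "B 0 1 = 0" by linarith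
  then show "(B 0 1 > 0 \<and> B 1 0 < 0) \<or> (B 0 1 < 0 \<and> B 1 0 > 0)"
  proof cases
    case 1
    then have "d 0 * B 0 1 > 0" using d0 by simp
    then have "d 1 * B 1 0 < 0" using s by simp
    then show ?thesis using 1 d0 by (simp add: mult_less_0_iff)
  next
    case 2
    then have "d 0 * B 0 1 < 0" using d0 by (simp add: mult_pos_neg)
    then have "d 1 * B 1 0 > 0" using s by simp
    then show ?thesis using 2 d0 by (simp add: zero_less_mult_iff)
  next
    case 3
    then have "d 1 * B 1 0 = 0" using s by simp
    then show ?thesis using 3 n d0 by simp
  qed
qed

locale rank_two =
  fixes m :: nat and B :: "nat \<Rightarrow> nat \<Rightarrow> int"
  assumes m: "2 \<le> m"
    and skew_symmetrizable: "skew_symmetrizable 2 B"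
    and indecomposable: "indecomposable 2 2 B"
begin

definition base :: seed where
  "base = (if B 0 1 > 0 then (indet, B) else swap (indet, B))"

definition T :: "int \<Rightarrow> seed" where
  "T k = (if 0 \<le> k then (shift m ^^ nat k) base else (unshift m ^^ nat (- k)) base)"

lemma oriented_base: "oriented m base"
proof -
  note B = indecomposable_two_entries[OF skew_symmetrizable indecomposable]
  have i: "indet 0 \<in> ambient m" "indet (Suc 0) \<in> ambient m" using m by (auto intro: ambient_indet)
  show ?thesis
    using B i by (auto simp: oriented_def base_def less_2_cases_iff positive_indet)
qed

lemma oriented_T: "oriented m (T k)"
proof -
  have "oriented m ((shift m ^^ n) base)" "oriented m ((unshift m ^^ n) base)" for n
    by (induction n) (auto simp: oriented_base intro: oriented_shift[OF m] oriented_unshift[OF m])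
  then show ?thesis by (simp add: T_def)
qed

lemma T_shift: "T (k + 1) = shift m (T k)"
proof (cases "0 \<le> k")
  case True
  then have "nat (k + 1) = Suc (nat k)" by simp
  then show ?thesis using True by (simp add: T_def)
next
  case False
  then have "nat (- k) = Suc (nat (- (k + 1)))" by simp
  then have "T k = unshift m (T (k + 1))"
    using False by (cases "k + 1 = 0") (auto simp: T_def)
  then show ?thesis using shift_unshift[OF m oriented_T] by simp
qed

text \<open>Along the line everything is recorded by four sequences. The seed \<open>T k\<close> has the cluster
  \<open>(x k, x (k + 1))\<close>, the exchange entries \<open>s k\<close> and \<open>- s (k + 1)\<close>, the \<open>y\<close>-variables
  \<open>inverse (z k)\<close> and \<open>z (k - 1)\<close>, and the frozen rows \<open>(c j k, - c j (k - 1))\<close>.\<close>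

definition x :: "int \<Rightarrow> ratfun" where "x k = fst (T k) 0"
definition z :: "int \<Rightarrow> ratfun" where "z k = inverse (yhat m (T k) 0)"
definition s :: "int \<Rightarrow> int" where "s k = snd (T k) 0 1"
definition c :: "nat \<Rightarrow> int \<Rightarrow> int" where "c j k = snd (T k) j 0"

lemma T_fst_1: "fst (T k) 1 = x (k + 1)"
  using fst_shift(1)[OF m oriented_T[of k]] by (simp add: x_def T_shift)

lemma T_snd_10: "snd (T k) 1 0 = - s (k + 1)"
  using snd_shift(1)[OF m oriented_T[of k]] by (simp add: s_def T_shift)

lemma T_snd_1: "2 \<le> j \<Longrightarrow> snd (T k) j 1 = - c j (k - 1)"
  using snd_shift(4)[OF m oriented_T[of "k - 1"], of j] T_shift[of "k - 1"] by (simp add: c_def)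

lemma s_pos: "s k > 0"
  using orientedD(7)[OF oriented_T[of k]] by (simp add: s_def)

lemma s_periodic: "s (k + 2) = s k"
  using snd_shift(2)[OF m oriented_T[of k]] T_snd_10[of "k + 1"] T_shift[of k]
  by (simp add: s_def add.assoc)

lemma s_even: "s (k + 2 * l) = s k"
proof (induction l rule: int_induct[where k = 0])
  case (step1 i)
  then show ?case using s_periodic[of "k + 2 * i"] by (simp add: algebra_simps)
next
  case (step2 i)
  then show ?case using s_periodic[of "k + 2 * (i - 1)"] by (simp add: algebra_simps)
qed simp

lemma c_rec: "2 \<le> j \<Longrightarrow> c j (k + 1) = - c j (k - 1) + max (c j k) 0 * s k"
  using snd_shift(3)[OF m oriented_T[of k], of j] T_snd_1[of j k] T_shift[of k]
  by (simp add: c_def s_def)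

lemma x_ambient [simp]: "x k \<in> ambient m" and x_positive [simp]: "positive (x k)"
  using orientedD(1,3)[OF oriented_T[of k]] by (auto simp: x_def)

lemma x_nonzero [simp]: "x k \<noteq> 0"
  using positive_nonzero by simp

lemma z_eq: "z k = x (k + 1) powi s (k + 1) * frozen_mon m (\<lambda>j. - c j k)"
  using oriented_yhat_0[OF m oriented_T[of k]] T_fst_1[of k] T_snd_10[of k]
  unfolding z_def frozen_mon_uminus by (simp add: power_int_minus c_def)

lemma z_ambient [simp]: "z k \<in> ambient m" and z_positive [simp]: "positive (z k)"
  unfolding z_eq by (auto intro!: ambient_intros positive_intros)

lemma z_nonzero [simp]: "z k \<noteq> 0" and z1_nonzero [simp]: "1 + z k \<noteq> 0"
    and z1_ambient [simp]: "1 + z k \<in> ambient m"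
proof -
  have "positive (1 + z k)" by (simp add: positive_intros)
  then show "1 + z k \<noteq> 0" "z k \<noteq> 0" using positive_nonzero by auto
qed (simp add: ambient_intros)

lemma yhat_T: "yhat m (T k) 0 = inverse (z k)" "yhat m (T k) 1 = z (k - 1)"
  using yhat_shift_1[OF m oriented_T[of "k - 1"]] T_shift[of "k - 1"] by (simp_all add: z_def)

text \<open>The \<open>Y\<close>-system: the coefficients have disappeared.\<close>

lemma z_rec: "z (k + 1) * z (k - 1) = (1 + z k) powi s k"
proof -
  have "inverse (z (k + 1)) = z (k - 1) * (1 + z k) powi (- s k)"
    using yhat_shift_0[OF m oriented_T[of k]] T_shift[of k] yhat_T[of k] yhat_T(1)[of "k + 1"]
    by (simp add: s_def)
  then have "inverse (inverse (z (k + 1))) = inverse (z (k - 1) * inverse ((1 + z k) powi s k))"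
    by (simp only: power_int_minus)
  then show ?thesis by (simp add: field_simps)
qed

lemma x_rec: "x (k + 2) * x k = frozen_mon m (\<lambda>j. max (c j k) 0) * (1 + z k)"
  using exchange_shift[OF m oriented_T[of k]] T_shift[of k] T_fst_1[of "k + 1"]
  by (simp add: x_def z_def c_def add.assoc)


lemma T_in_seeds: "T k \<in> seeds m 2 B"
proof -
  have t: "Transposition.transpose 0 (1::nat) permutes {..<2}" by (intro permutes_swap_id) auto
  have sw: "swap S \<in> seeds m 2 B" if "S \<in> seeds m 2 B" for S
    unfolding swap_def using that t by (rule seeds.relabeling)
  have b: "base \<in> seeds m 2 B"
    using sw[OF seeds.initial] seeds.initial by (simp add: base_def)
  have mu: "mutate m 0 S \<in> seeds m 2 B" if "S \<in> seeds m 2 B" for S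
    using that by (rule seeds.mutation) simp
  have "(shift m ^^ n) base \<in> seeds m 2 B" "(unshift m ^^ n) base \<in> seeds m 2 B" for n
    by (induction n) (auto simp: b shift_def unshift_def intro: sw mu)
  then show "T k \<in> seeds m 2 B" by (simp add: T_def)
qed

lemma mutate_T: "mutate m 0 (T k) = swap (T (k + 1))" "mutate m 0 (swap (T k)) = T (k - 1)"
  "mutate m 1 (T k) = swap (T (k - 1))" "mutate m 1 (swap (T k)) = T (k + 1)"
proof -
  show 1: "mutate m 0 (T k) = swap (T (k + 1))" by (simp add: T_shift shift_def)
  show 2: "mutate m 0 (swap (T k)) = T (k - 1)"
    using mutate_shift[OF m oriented_T[of "k - 1"]] T_shift[of "k - 1"] by simp
  show "mutate m 1 (T k) = swap (T (k - 1))" "mutate m 1 (swap (T k)) = T (k + 1)"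
    by (simp_all only: mutate_1[OF m] 1 2 swap_swap)
qed

lemma seeds_cases:
  assumes "S \<in> seeds m 2 B"
  obtains k where "S = T k" | k where "S = swap (T k)"
proof -
  have "\<exists>k. S = T k \<or> S = swap (T k)"
    using assms
  proof (induction rule: seeds.induct)
    case initial
    have "base = T 0" by (simp add: T_def)
    then have "(indet, B) = T 0 \<or> (indet, B) = swap (T 0)"
      unfolding base_def by (metis swap_swap)
    then show ?case by blast
  next
    case (mutation S k)
    then have "k = 0 \<or> k = 1" by auto
    then show ?case using mutation.IH mutate_T by auto
  next
    case (relabeling S \<sigma>)
    have "relabel id S = S" by (simp add: relabel_def split: prod.splits)
    then have "relabel \<sigma> S = S \<or> relabel \<sigma> S = swap S"
      using permutes_two[OF relabeling.hyps(2)] by (auto simp: swap_def)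
    then show ?case using relabeling.IH by auto
  qed
  then show thesis using that by blast
qed


section \<open>Maps between seeds\<close>

text \<open>Proportionality of the image of \<open>T i\<close> and \<open>T j\<close>, in terms of the four sequences.\<close>

definition links :: "(ratfun \<Rightarrow> ratfun) \<Rightarrow> int \<Rightarrow> int \<Rightarrow> bool" where
  "links \<Psi> i j \<longleftrightarrow> assoc m (\<Psi> (x i)) (x j) \<and> assoc m (\<Psi> (x (i + 1))) (x (j + 1)) \<and>
     \<Psi> (z i) = z j \<and> \<Psi> (z (i - 1)) = z (j - 1) \<and> s i = s j \<and> s (i + 1) = s (j + 1)"

definition coeff_endo :: "(ratfun \<Rightarrow> ratfun) \<Rightarrow> bool" where
  "coeff_endo \<Psi> \<longleftrightarrow> endo m \<Psi> \<and> \<Psi> ` frozen_monomials m \<subseteq> frozen_monomials m"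

lemma coeff_endoD: "coeff_endo \<Psi> \<Longrightarrow> endo m \<Psi>"
  "coeff_endo \<Psi> \<Longrightarrow> p \<in> frozen_monomials m \<Longrightarrow> \<Psi> p \<in> frozen_monomials m"
  by (auto simp: coeff_endo_def)

lemma coeff_endo_assoc:
  "coeff_endo \<Psi> \<Longrightarrow> f \<in> ambient m \<Longrightarrow> g \<in> ambient m \<Longrightarrow> assoc m f g \<Longrightarrow> assoc m (\<Psi> f) (\<Psi> g)"
  unfolding coeff_endo_def by (blast intro: assoc_endo)

lemma coeff_endo_id: "coeff_endo (\<lambda>f\<in>ambient m. f)"
  using endo_id by (auto simp: coeff_endo_def frozen_monomials_ambient)

lemma coeff_endo_compose: "coeff_endo \<Phi> \<Longrightarrow> coeff_endo \<Psi> \<Longrightarrow> coeff_endo (compose (ambient m) \<Phi> \<Psi>)"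
  by (auto simp: coeff_endo_def endo_compose compose_eq frozen_monomials_ambient)

lemma links_iff:
  assumes "endo m \<Psi>"
  shows "image_proportional m 2 \<Psi> (T i) (T j) \<longleftrightarrow> links \<Psi> i j"
proof -
  have "fst (T k) 0 = x k" "snd (T k) 0 1 = s k" "snd (T k) 0 0 = 0" "snd (T k) 1 1 = 0" for k
    using orientedD[OF oriented_T[of k]] by (auto simp: x_def s_def)
  then show ?thesis
    using T_fst_1 T_snd_10 yhat_T endo_inverse[OF assms z_ambient]
    by (auto simp: image_proportional_def links_def assoc_def less_2_cases_iff)
qed

lemma yhat_swap: "yhat m (swap S) 0 = yhat m S 1" "yhat m (swap S) 1 = yhat m S 0"
  by (simp_all add: yhat_def prod_split[OF m] mult.commute)

lemma image_proportional_swap: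
  "image_proportional m 2 \<Psi> (swap S) (swap S') \<longleftrightarrow> image_proportional m 2 \<Psi> S S'"
  using yhat_swap by (auto simp: image_proportional_def less_2_cases_iff)

lemma not_image_proportional_swap:
  "\<not> image_proportional m 2 \<Psi> (swap (T i)) (T j)" "\<not> image_proportional m 2 \<Psi> (T i) (swap (T j))"
  using orientedD(7,8)[OF oriented_T[of i]] orientedD(7,8)[OF oriented_T[of j]]
  by (auto simp: image_proportional_def less_2_cases_iff)

lemma links_seeds:
  assumes "endo m \<Psi>"
  shows "(\<exists>S\<in>seeds m 2 B. \<exists>S'\<in>seeds m 2 B. image_proportional m 2 \<Psi> S S') \<longleftrightarrow> (\<exists>i j. links \<Psi> i j)"
proof
  assume "\<exists>S\<in>seeds m 2 B. \<exists>S'\<in>seeds m 2 B. image_proportional m 2 \<Psi> S S'"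
  then obtain S S' where S: "S \<in> seeds m 2 B" "S' \<in> seeds m 2 B" "image_proportional m 2 \<Psi> S S'"
    by blast
  show "\<exists>i j. links \<Psi> i j"
    by (rule seeds_cases[OF S(1)]; rule seeds_cases[OF S(2)])
      (use S(3) in \<open>auto simp: links_iff[OF assms] image_proportional_swap not_image_proportional_swap\<close>)
next
  assume "\<exists>i j. links \<Psi> i j"
  then show "\<exists>S\<in>seeds m 2 B. \<exists>S'\<in>seeds m 2 B. image_proportional m 2 \<Psi> S S'"
    using T_in_seeds by (auto simp flip: links_iff[OF assms])
qed

text \<open>In one step along the line \<open>z (i + 1)\<close> and, modulo frozen monomials, \<open>x (i + 2)\<close> are rational
  functions of the data of \<open>T i\<close>, and a homomorphism preserves rational expressions.\<close>

lemma links_Suc: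
  assumes "coeff_endo \<Psi>" "links \<Psi> i j"
  shows "links \<Psi> (i + 1) (j + 1)"
proof -
  note E = coeff_endoD(1)[OF assms(1)]
  note L = assms(2)[unfolded links_def]
  have "z (k + 1) = (1 + z k) powi s k / z (k - 1)" for k
    using z_rec[of k] by (simp add: field_simps)
  then have z: "\<Psi> (z (i + 1)) = z (j + 1)"
    using L E by (simp add: endo_divide endo_powi endo_add endo_1 ambient_intros)
  have x: "x (k + 2) = frozen_mon m (\<lambda>j. max (c j k) 0) * (1 + z k) / x k" for k
    using x_rec[of k] by (simp add: field_simps)
  have "\<Psi> (x (i + 2)) = \<Psi> (frozen_mon m (\<lambda>j. max (c j i) 0)) * (1 + z j) / \<Psi> (x i)"
    unfolding x using L E
    by (simp add: endo_divide endo_mult endo_add endo_1 ambient_intros)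
  moreover have "assoc m \<dots> (x (j + 2))"
    unfolding x using L assms(1)
    by (intro assoc_divide[OF assoc_mult[OF assoc_frozen assoc_refl]]) (auto intro: coeff_endoD)
  ultimately show ?thesis
    using L z s_periodic[of i] s_periodic[of j] by (simp add: links_def add.assoc)
qed

lemma links_pred:
  assumes "coeff_endo \<Psi>" "links \<Psi> (i + 1) (j + 1)"
  shows "links \<Psi> i j"
proof -
  note E = coeff_endoD(1)[OF assms(1)]
  have L: "assoc m (\<Psi> (x (i + 1))) (x (j + 1))" "assoc m (\<Psi> (x (i + 2))) (x (j + 2))"
    "\<Psi> (z (i + 1)) = z (j + 1)" "\<Psi> (z i) = z j" "s (i + 1) = s (j + 1)" "s i = s j"
    using assms(2) s_periodic[of i] s_periodic[of j] by (auto simp: links_def add.assoc)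
  have "z (k - 1) = (1 + z k) powi s k / z (k + 1)" for k
    using z_rec[of k] by (simp add: field_simps)
  then have z: "\<Psi> (z (i - 1)) = z (j - 1)"
    using L E by (simp add: endo_divide endo_powi endo_add endo_1 ambient_intros)
  have x: "x k = frozen_mon m (\<lambda>j. max (c j k) 0) * (1 + z k) / x (k + 2)" for k
    using x_rec[of k] by (simp add: field_simps)
  have "\<Psi> (x i) = \<Psi> (frozen_mon m (\<lambda>j. max (c j i) 0)) * (1 + z j) / \<Psi> (x (i + 2))"
    unfolding x[of i] using L E
    by (simp add: endo_divide endo_mult endo_add endo_1 ambient_intros)
  moreover have "assoc m \<dots> (x j)"
    unfolding x[of j] using L assms(1)
    by (intro assoc_divide[OF assoc_mult[OF assoc_frozen assoc_refl]]) (auto intro: coeff_endoD)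
  ultimately show ?thesis
    using L z by (simp add: links_def)
qed

lemma links_add:
  assumes "coeff_endo \<Psi>"
  shows "links \<Psi> (i + k) (j + k) \<longleftrightarrow> links \<Psi> i j"
proof (induction k rule: int_induct[where k = 0])
  case (step1 k)
  then show ?case
    using links_Suc[OF assms, of "i + k" "j + k"] links_pred[OF assms, of "i + k" "j + k"]
    by (auto simp: add.assoc)
next
  case (step2 k)
  then show ?case
    using links_Suc[OF assms, of "i + (k - 1)" "j + (k - 1)"]
      links_pred[OF assms, of "i + (k - 1)" "j + (k - 1)"]
    by (auto simp: add.assoc)
qed simp

lemma links_diff:
  assumes "coeff_endo \<Psi>"
  shows "links \<Psi> i j \<longleftrightarrow> links \<Psi> 0 (j - i)"
  using links_add[OF assms, of 0 i "j - i"] by simp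

lemma links_id: "links (\<lambda>f\<in>ambient m. f) i j \<longleftrightarrow> assoc m (x i) (x j) \<and>
    assoc m (x (i + 1)) (x (j + 1)) \<and> z i = z j \<and> z (i - 1) = z (j - 1) \<and> s i = s j \<and> s (i + 1) = s (j + 1)"
  by (simp add: links_def)

text \<open>Proportionality of \<open>T i\<close> and \<open>T (i + k)\<close>, which does not depend on \<open>i\<close>.\<close>

definition id_links :: "int \<Rightarrow> bool" where
  "id_links k \<longleftrightarrow> links (\<lambda>f\<in>ambient m. f) 0 k"

lemma id_links_diff: "links (\<lambda>f\<in>ambient m. f) i j \<longleftrightarrow> id_links (j - i)"
  unfolding id_links_def using links_diff[OF coeff_endo_id] .

lemma links_compose:
  assumes "coeff_endo \<Phi>" "coeff_endo \<Psi>" "links \<Psi> i j" "links \<Phi> j k"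
  shows "links (compose (ambient m) \<Phi> \<Psi>) i k"
proof -
  have "assoc m (\<Phi> (\<Psi> (x l))) (x l'')"
    if "assoc m (\<Psi> (x l)) (x l')" "assoc m (\<Phi> (x l')) (x l'')" for l l' l''
    using coeff_endo_assoc[OF assms(1) _ x_ambient that(1)] that(2)
      endo_closed[OF coeff_endoD(1)[OF assms(2)] x_ambient] by (metis assoc_trans)
  then show ?thesis
    using assms(3,4) by (auto simp: links_def compose_eq)
qed

lemma links_both:
  assumes "links \<Psi> i j" "links \<Phi> i k"
    and "assoc m (\<Psi> (x i)) (\<Phi> (x i))" "assoc m (\<Psi> (x (i + 1))) (\<Phi> (x (i + 1)))"
      "\<Psi> (z i) = \<Phi> (z i)" "\<Psi> (z (i - 1)) = \<Phi> (z (i - 1))"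
  shows "id_links (k - j)"
  unfolding id_links_diff[symmetric] links_id
  using assms unfolding links_def by (metis assoc_sym assoc_trans)

lemma links_unique:
  assumes "links \<Psi> i j" "links \<Psi> i k"
  shows "id_links (k - j)"
  using assms assoc_nonzero by (intro links_both[OF assms] assoc_refl) (auto simp: links_def)

lemma links_id_links:
  assumes "links \<Psi> i j" "id_links (k - j)"
  shows "links \<Psi> i k"
  using assms(1) assms(2)[folded id_links_diff, unfolded links_id]
  unfolding links_def by (metis assoc_trans)

end

section \<open>Recurrences\<close>

text \<open>Zamolodchikov periodicity in rank two. Every term is a Laurent polynomial in the first two, and in
  each step the factor needed for the division by the term before last splits off.\<close>

lemma pentagon_recurrence:
  fixes w :: "nat \<Rightarrow> 'a::field"
  assumes nz: "\<And>i. w i \<noteq> 0" "\<And>i. 1 + w i \<noteq> 0" and rec: "\<And>i. w (i + 2) * w i = 1 + w (i + 1)"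
  shows "w 5 = w 0" "w 6 = w 1"
proof -
  define a b where "a = w 0" and "b = w 1"
  have ab: "a \<noteq> 0" "b \<noteq> 0" "1 + a \<noteq> 0" "1 + b \<noteq> 0" using nz by (auto simp: a_def b_def)
  have "w 2 * w 0 = 1 + w 1" using rec[of 0] by (simp add: numeral_2_eq_2)
  then have 2: "w 2 = (1 + b) / a" using ab by (simp add: a_def b_def field_simps)
  have "w 3 * w 1 = 1 + w 2" using rec[of 1] by (simp add: eval_nat_numeral)
  then have 3: "w 3 = (1 + a + b) / (a * b)"
    unfolding 2 b_def[symmetric] using ab by (simp add: field_simps)
  have "w 4 * w 2 = 1 + w 3" using rec[of 2] by (simp add: eval_nat_numeral)
  moreover have "1 + w 3 = (1 + a) / b * w 2"
    unfolding 2 3 using ab by (simp add: divide_simps; Groebner_Basis.algebra)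
  ultimately have 4: "w 4 = (1 + a) / b" using nz(1)[of 2] by (metis mult_right_cancel)
  have "w 5 * w 3 = 1 + w 4" using rec[of 3] by (simp add: eval_nat_numeral)
  moreover have "1 + w 4 = a * w 3"
    unfolding 3 4 using ab by (simp add: divide_simps; Groebner_Basis.algebra)
  ultimately have 5: "w 5 = a" using nz(1)[of 3] by (metis mult_right_cancel)
  have "w 6 * w 4 = 1 + w 5" using rec[of 4] by (simp add: eval_nat_numeral)
  then have 6: "w 6 = b" unfolding 4 5 using ab by (simp add: divide_simps)
  show "w 5 = w 0" "w 6 = w 1" using 5 6 by (simp_all add: a_def b_def)
qed

text \<open>The last identity serves to recover cluster variables from their squares.\<close>

lemma hexagon_recurrence:
  fixes w :: "nat \<Rightarrow> 'a::field"
  assumes nz: "\<And>i. w i \<noteq> 0" "\<And>i. 1 + w i \<noteq> 0"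
    and even: "\<And>i. w (2 * i + 2) * w (2 * i) = (1 + w (2 * i + 1)) ^ 2"
    and odd: "\<And>i. w (2 * i + 3) * w (2 * i + 1) = 1 + w (2 * i + 2)"
  shows "w 6 = w 0" "w 7 = w 1" "(1 + w 5) * (1 + w 1) = w 0 * (1 + w 3)"
proof -
  define a b where "a = w 0" and "b = w 1"
  have ab: "a \<noteq> 0" "b \<noteq> 0" "1 + a \<noteq> 0" "1 + b \<noteq> 0" using nz by (auto simp: a_def b_def)
  have "w 2 * w 0 = (1 + w 1) ^ 2" using even[of 0] by (simp add: numeral_2_eq_2)
  then have 2: "w 2 = (1 + b) ^ 2 / a"
    using ab by (simp add: a_def b_def field_simps)
  have "w 3 * w 1 = 1 + w 2" using odd[of 0] by (simp add: eval_nat_numeral)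
  then have 3: "w 3 = (a + (1 + b) ^ 2) / (a * b)"
    unfolding 2 b_def[symmetric] using ab by (simp add: field_simps)
  have s3: "1 + w 3 = (1 + b) * (a + 1 + b) / (a * b)"
    unfolding 3 using ab by (simp add: divide_simps; Groebner_Basis.algebra)
  have n: "a + (1 + b) ^ 2 \<noteq> 0" "a + 1 + b \<noteq> 0" using nz(1)[of 3] nz(2)[of 3] 3 s3 by auto
  have "w 4 * w 2 = (1 + w 3) ^ 2" using even[of 1] by (simp add: eval_nat_numeral)
  then have 4: "w 4 = (a + 1 + b) ^ 2 / (a * b ^ 2)"
    unfolding 2 s3 using ab by (simp add: divide_simps power2_eq_square mult_ac)
  have "w 5 * w 3 = 1 + w 4" using odd[of 1] by (simp add: eval_nat_numeral)
  moreover have "1 + w 4 = (1 + a) / b * w 3"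
    unfolding 3 4 using ab by (simp add: divide_simps; Groebner_Basis.algebra)
  ultimately have 5: "w 5 = (1 + a) / b" using nz(1)[of 3] by (metis mult_right_cancel)
  have "w 6 * w 4 = (1 + w 5) ^ 2" using even[of 2] by (simp add: eval_nat_numeral)
  moreover have "(1 + w 5) ^ 2 = a * w 4"
    unfolding 4 5 using ab by (simp add: divide_simps; Groebner_Basis.algebra)
  ultimately have 6: "w 6 = a" using nz(1)[of 4] by (metis mult_right_cancel)
  have "w 7 * w 5 = 1 + w 6" using odd[of 2] by (simp add: eval_nat_numeral)
  then have 7: "w 7 = b" unfolding 5 6 using ab by (simp add: divide_simps)
  show "w 6 = w 0" "w 7 = w 1" using 6 7 by (simp_all add: a_def b_def)
  show "(1 + w 5) * (1 + w 1) = w 0 * (1 + w 3)"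
    unfolding 5 s3 a_def[symmetric] b_def[symmetric] using ab by (simp add: divide_simps; Groebner_Basis.algebra)
qed

lemma octagon_recurrence:
  fixes w :: "nat \<Rightarrow> 'a::field"
  assumes nz: "\<And>i. w i \<noteq> 0" "\<And>i. 1 + w i \<noteq> 0"
    and even: "\<And>i. w (2 * i + 2) * w (2 * i) = (1 + w (2 * i + 1)) ^ 3"
    and odd: "\<And>i. w (2 * i + 3) * w (2 * i + 1) = 1 + w (2 * i + 2)"
  shows "w 8 = w 0" "w 9 = w 1" "(1 + w 7) * (1 + w 3) = (1 + w 5) * (1 + w 1)"
proof -
  define a c where "a = w 0" and "c = 1 + w 1"
  define b where "b = w 1"
  have ab: "a \<noteq> 0" "b \<noteq> 0" "1 + a \<noteq> 0" "c \<noteq> 0" and c: "c = 1 + b"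
    using nz by (auto simp: a_def b_def c_def)
  \<comment> \<open>The numerator of \<open>w 5\<close>, the cofactor of \<open>a + c ^ 3\<close> in the numerator of \<open>1 + w 4\<close>.\<close>
  define q where "q = a ^ 2 + a * (3 * c - 1) + c ^ 3"
  have "w 2 * w 0 = (1 + w 1) ^ 3" using even[of 0] by (simp add: eval_nat_numeral)
  then have 2: "w 2 = c ^ 3 / a"
    using ab by (simp add: a_def c_def field_simps)
  have "w 3 * b = 1 + w 2" using odd[of 0] by (simp add: eval_nat_numeral b_def)
  then have 3: "w 3 = (a + c ^ 3) / (a * b)"
    unfolding 2 using ab by (simp add: field_simps)
  have s3: "1 + w 3 = c * (a + c ^ 2) / (a * b)"
    unfolding 3 c using ab by (simp add: divide_simps; Groebner_Basis.algebra)
  have n: "a + c ^ 3 \<noteq> 0" "a + c ^ 2 \<noteq> 0" using nz(1)[of 3] nz(2)[of 3] 3 s3 by auto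
  have "w 4 * w 2 = (1 + w 3) ^ 3" using even[of 1] by (simp add: eval_nat_numeral)
  moreover have "(1 + w 3) ^ 3 = (a + c ^ 2) ^ 3 / (a ^ 2 * b ^ 3) * w 2"
    unfolding 2 s3 using ab by (simp add: divide_simps; Groebner_Basis.algebra)
  ultimately have 4: "w 4 = (a + c ^ 2) ^ 3 / (a ^ 2 * b ^ 3)" using nz(1)[of 2] by (metis mult_right_cancel)
  have "w 5 * w 3 = 1 + w 4" using odd[of 1] by (simp add: eval_nat_numeral)
  moreover have "1 + w 4 = q / (a * b ^ 2) * w 3"
    unfolding 3 4 q_def c using ab by (simp add: divide_simps; Groebner_Basis.algebra)
  ultimately have 5: "w 5 = q / (a * b ^ 2)" using nz(1)[of 3] by (metis mult_right_cancel)
  have s5: "1 + w 5 = (a + c) * (a + c ^ 2) / (a * b ^ 2)"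
    unfolding 5 q_def c using ab by (simp add: divide_simps; Groebner_Basis.algebra)
  have n5: "q \<noteq> 0" "a + c \<noteq> 0" using nz(1)[of 5] nz(2)[of 5] 5 s5 by auto
  have "w 6 * w 4 = (1 + w 5) ^ 3" using even[of 2] by (simp add: eval_nat_numeral)
  moreover have "(1 + w 5) ^ 3 = (a + c) ^ 3 / (a * b ^ 3) * w 4"
    unfolding 4 s5 using ab by (simp add: divide_simps; Groebner_Basis.algebra)
  ultimately have 6: "w 6 = (a + c) ^ 3 / (a * b ^ 3)" using nz(1)[of 4] by (metis mult_right_cancel)
  have "w 7 * w 5 = 1 + w 6" using odd[of 2] by (simp add: eval_nat_numeral)
  moreover have "1 + w 6 = (1 + a) / b * w 5"
    unfolding 5 6 q_def c using ab by (simp add: divide_simps; Groebner_Basis.algebra)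
  ultimately have 7: "w 7 = (1 + a) / b" using nz(1)[of 5] by (metis mult_right_cancel)
  have s7: "1 + w 7 = (a + c) / b" unfolding 7 c using ab by (simp add: divide_simps)
  have "w 8 * w 6 = (1 + w 7) ^ 3" using even[of 3] by (simp add: eval_nat_numeral)
  moreover have "(1 + w 7) ^ 3 = a * w 6"
    unfolding 6 s7 using ab by (simp add: divide_simps)
  ultimately have 8: "w 8 = a" using nz(1)[of 6] by (metis mult_right_cancel)
  have "w 9 * w 7 = 1 + w 8" using odd[of 3] by (simp add: eval_nat_numeral)
  then have 9: "w 9 = b" unfolding 7 8 using ab by (simp add: divide_simps)
  show "w 8 = w 0" "w 9 = w 1" using 8 9 by (simp_all add: a_def b_def)
  show "(1 + w 7) * (1 + w 3) = (1 + w 5) * (1 + w 1)"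
    unfolding s7 s3 s5 c_def[symmetric] using ab by (simp add: divide_simps; Groebner_Basis.algebra)
qed

text \<open>The inequality that propagates is \<open>u\<^bsub>n+1\<^esub>\<^sup>2 \<ge> u\<^sub>n\<^bsup>e n\<^esup>\<close>. On the level of logarithms it says that the ratio of
  consecutive terms is at least half the exponent; a ratio \<open>\<rho> \<ge> e n / 2\<close> is followed by one above
  \<open>e (n + 1) - 1 / \<rho> \<ge> e (n + 1) - 2 / e n\<close>, and this is at least \<open>e (n + 1) / 2\<close> because
  \<open>e n * e (n + 1) \<ge> 4\<close>.\<close>

lemma exchange_recurrence_growth:
  fixes u :: "nat \<Rightarrow> real" and e :: "nat \<Rightarrow> nat"
  assumes u01: "u 0 = 1" "u 1 = 1" and pos: "\<And>n. u n > 0"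
    and rec: "\<And>n. u (n + 2) * u n = 1 + u (n + 1) ^ e (n + 1)"
    and e: "\<And>n. e n * e (n + 1) \<ge> 4"
  shows "u (n + 2) > 1"
proof -
  have step: "(u (n + 2))\<^sup>2 > u (n + 1) ^ e (n + 1) \<and> u (n + 2) > 1"
    if I: "u n \<ge> 1" "u (n + 1) \<ge> 1" "(u (n + 1))\<^sup>2 \<ge> u n ^ e n" for n
  proof -
    define v where "v = u (n + 1) ^ e (n + 1)"
    have v1: "v \<ge> 1" unfolding v_def using I(2) by simp
    have "((u n)\<^sup>2)\<^sup>2 = u n ^ 4" by simp
    also have "\<dots> \<le> u n ^ (e n * e (n + 1))" by (rule power_increasing[OF e I(1)])
    also have "\<dots> \<le> ((u (n + 1))\<^sup>2) ^ e (n + 1)"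
      unfolding power_mult using I by (intro power_mono) auto
    also have "\<dots> = v\<^sup>2" unfolding v_def by (simp only: power_mult[symmetric] mult.commute)
    finally have v: "(u n)\<^sup>2 \<le> v"
      by (rule power2_le_imp_le) (use v1 in simp)
    have "v * (u n)\<^sup>2 \<le> v * v" using v v1 by (intro mult_left_mono) auto
    also have "\<dots> < (1 + v) * (1 + v)" using v1 by (intro mult_strict_mono) auto
    also have "\<dots> = (u (n + 2))\<^sup>2 * (u n)\<^sup>2"
      unfolding v_def rec[symmetric] by (simp only: power2_eq_square mult_ac)
    finally have *: "v < (u (n + 2))\<^sup>2" using pos[of n] by simp
    then have "1\<^sup>2 < (u (n + 2))\<^sup>2" using v1 by simp
    then have "1 < u (n + 2)" by (rule power2_less_imp_less) (rule less_imp_le[OF pos])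
    then show ?thesis using * by (simp add: v_def)
  qed
  have I: "u n \<ge> 1 \<and> u (n + 1) \<ge> 1 \<and> (u (n + 1))\<^sup>2 \<ge> u n ^ e n" for n
  proof (induction n)
    case 0
    then show ?case using u01 by simp
  next
    case (Suc n)
    then have "(u (n + 2))\<^sup>2 > u (n + 1) ^ e (n + 1) \<and> u (n + 2) > 1" using step by blast
    then show ?case using Suc by (simp add: less_imp_le)
  qed
  show ?thesis using step I by blast
qed

section \<open>Periodicity of the seeds\<close>

text \<open>The Coxeter number plus 2 in the finite types. In the other types the value 0 stands for the absence of a
  period, as 0 divides only 0.\<close>

definition period :: "int \<Rightarrow> nat" where
  "period p = (if p = 1 then 5 else if p = 2 then 6 else if p = 3 then 8 else 0)"

lemma small_factors:
  fixes a b :: int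
  assumes "0 < a" "0 < b" "a * b \<le> 3"
  obtains "a = 1" "b = 1" | "a = 1" "b = 2" | "a = 2" "b = 1" | "a = 1" "b = 3" | "a = 3" "b = 1"
proof -
  have "a * 1 \<le> a * b" "1 * b \<le> a * b" using assms by (intro mult_left_mono mult_right_mono; simp)+
  then have "a \<le> 3" "b \<le> 3" using assms(3) by linarith+
  then have "a = 1 \<or> a = 2 \<or> a = 3" "b = 1 \<or> b = 2 \<or> b = 3" using assms(1,2) by arith+
  then show thesis using that assms(3) by auto
qed

context rank_two
begin

lemma s_parity: "s k = (if even k then s 0 else s 1)"
proof (cases "even k")
  case True
  then show ?thesis using s_even[of 0 "k div 2"] by simp
next
  case False
  then obtain l where "k = 2 * l + 1" by (elim oddE)
  then show ?thesis using False s_even[of 1 l] by (simp add: add.commute)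
qed

lemma s_prod: "s k * s (k + 1) = s 0 * s 1"
  by (simp add: s_parity[of k] s_parity[of "k + 1"])

lemma id_links_0: "id_links 0"
  using id_links_diff[of 0 0] by (simp add: links_id assoc_refl)

lemma id_links_minus: "id_links (- k) \<longleftrightarrow> id_links k"
  using id_links_diff[of 0 k] id_links_diff[of k 0] assoc_sym by (auto simp: links_id)

lemma id_links_add: "id_links j \<Longrightarrow> id_links k \<Longrightarrow> id_links (j + k)"
  using links_id_links[of "\<lambda>f\<in>ambient m. f" 0 j "j + k"] by (simp add: id_links_def)

lemma id_links_mult: "id_links k \<Longrightarrow> id_links (k * l)"
proof (induction l rule: int_induct[where k = 0])
  case (step1 i)
  then show ?case using id_links_add[of "k * i" k] by (simp add: algebra_simps)
next
  case (step2 i)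
  then show ?case using id_links_add[of "k * i" "- k"] by (simp add: algebra_simps id_links_minus)
qed (simp add: id_links_0)


subsection \<open>Finite types\<close>

lemma x_assoc: "assoc m (x (k + 2) * x k) (1 + z k)"
  using x_rec by (intro assocI) auto

lemma z_assoc: "assoc m (z k) (x (k + 1) powi s (k + 1))"
  using z_eq[of k] by (intro assocI[of _ "frozen_mon m (\<lambda>j. - c j k)"]) (auto simp: mult.commute)

lemma x_assoc_if_z:
  assumes "z i = z j" "s (i + 1) = 1" "s (j + 1) = 1"
  shows "assoc m (x (i + 1)) (x (j + 1))"
  using z_assoc[of i] z_assoc[of j] assms by (auto intro: assoc_sym assoc_trans)

lemma id_links_pentagon:
  assumes "s 0 = 1" "s 1 = 1"
  shows "id_links 5"
proof -
  have s1: "s k = 1" for k using s_parity[of k] assms by simp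
  define w where "w i = z (int i)" for i
  have "w (i + 2) * w i = 1 + w (i + 1)" for i
    using z_rec[of "int i + 1"] by (simp add: w_def s1 add.assoc add.commute)
  then have "w 5 = w 0" "w 6 = w 1"
    by (intro pentagon_recurrence; simp add: w_def)+
  then have z: "z 5 = z 0" "z 6 = z 1" by (simp_all add: w_def)
  have "assoc m (x (0 + 1)) (x (5 + 1))" "assoc m (x (1 + 1)) (x (6 + 1))"
    using z by (intro x_assoc_if_z; simp add: s1)+
  then have "links (\<lambda>f\<in>ambient m. f) 1 6"
    using z s1 by (simp add: links_id)
  then show ?thesis using id_links_diff[of 1 6] by simp
qed

text \<open>One of the two cluster variables is \<open>z (k + 1)\<close> up to a frozen monomial. Of the other, \<open>z k\<close> only
  gives the square; it is reached through three consecutive exchange relations instead.\<close>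

lemma id_links_hexagon:
  assumes s: "s k = 1" "s (k + 1) = 2"
  shows "id_links 6"
proof -
  define w where "w i = z (k + int i)" for i
  have even: "w (2 * i + 2) * w (2 * i) = (1 + w (2 * i + 1)) ^ 2" for i
    using z_rec[of "k + 2 * int i + 1"] s_even[of "k + 1" "int i"] s
    by (simp add: w_def algebra_simps)
  have odd: "w (2 * i + 3) * w (2 * i + 1) = 1 + w (2 * i + 2)" for i
    using z_rec[of "k + 2 * int i + 2"] s_even[of k "int i + 1"] s
    by (simp add: w_def algebra_simps)
  have nz: "w i \<noteq> 0" "1 + w i \<noteq> 0" for i by (simp_all add: w_def)
  note w = hexagon_recurrence[of w, OF nz even odd]
  have "assoc m (x (k + 1 + 1)) (x (k + 7 + 1))"
    using s_even[of k 1] s_even[of k 4] s w(2)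
    by (intro x_assoc_if_z) (simp_all add: w_def add.commute)
  moreover have "assoc m (x (k + 1)) (x (k + 7))"
  proof -
    have "assoc m ((x (k + 5 + 2) * x (k + 5)) * (x (k + 1 + 2) * x (k + 1)) / (x (k + 3 + 2) * x (k + 3)))
        ((1 + w 5) * (1 + w 1) / (1 + w 3))"
      unfolding w_def by (intro assoc_divide assoc_mult) (use x_assoc[of "k + 1"] x_assoc[of "k + 3"] x_assoc[of "k + 5"] x_assoc[of "k + 7"] in simp_all)
    also have "(1 + w 5) * (1 + w 1) / (1 + w 3) = z k"
      unfolding w(3) using nz by (simp add: w_def)
    finally have "assoc m (x (k + 7) * x (k + 1)) (z k)" by (simp add: field_simps)
    then have "assoc m (x (k + 7) * x (k + 1)) (x (k + 1) ^ 2)"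
      using z_assoc[of k] s by (auto intro: assoc_trans)
    then have "assoc m (x (k + 7) * x (k + 1) / x (k + 1)) (x (k + 1) ^ 2 / x (k + 1))"
      by (intro assoc_divide assoc_refl) auto
    then show ?thesis by (simp add: power2_eq_square assoc_sym)
  qed
  moreover have "s (k + 7) = s (k + 1)" "s (k + 8) = s (k + 2)"
    using s_even[of "k + 1" 3] s_even[of "k + 2" 3] by (simp_all add: add.commute)
  ultimately have "links (\<lambda>f\<in>ambient m. f) (k + 1) (k + 7)"
    using w(1,2) by (simp add: links_id w_def add.assoc) (simp add: add.commute)
  then show ?thesis using id_links_diff[of "k + 1" "k + 7"] by simp
qed

text \<open>As before, except that \<open>z k\<close> gives only the cube of \<open>x (k + 1)\<close> and that four exchange relations lead
  from \<open>x (k + 1)\<close> to \<open>x (k + 9)\<close>.\<close>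

lemma id_links_octagon:
  assumes s: "s k = 1" "s (k + 1) = 3"
  shows "id_links 8"
proof -
  define w where "w i = z (k + int i)" for i
  have even: "w (2 * i + 2) * w (2 * i) = (1 + w (2 * i + 1)) ^ 3" for i
    using z_rec[of "k + 2 * int i + 1"] s_even[of "k + 1" "int i"] s
    by (simp add: w_def algebra_simps)
  have odd: "w (2 * i + 3) * w (2 * i + 1) = 1 + w (2 * i + 2)" for i
    using z_rec[of "k + 2 * int i + 2"] s_even[of k "int i + 1"] s
    by (simp add: w_def algebra_simps)
  have nz: "w i \<noteq> 0" "1 + w i \<noteq> 0" for i by (simp_all add: w_def)
  note w = octagon_recurrence[of w, OF nz even odd]
  have "assoc m (x (k + 1 + 1)) (x (k + 9 + 1))"
    using s_even[of k 1] s_even[of k 5] s w(2)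
    by (intro x_assoc_if_z) (simp_all add: w_def add.commute)
  moreover have "assoc m (x (k + 1)) (x (k + 9))"
  proof -
    have "assoc m (((x (k + 7 + 2) * x (k + 7)) * (x (k + 3 + 2) * x (k + 3)))
         / ((x (k + 5 + 2) * x (k + 5)) * (x (k + 1 + 2) * x (k + 1))))
        ((1 + w 7) * (1 + w 3) / ((1 + w 5) * (1 + w 1)))"
      unfolding w_def by (intro assoc_divide assoc_mult) (use x_assoc[of "k + 1"] x_assoc[of "k + 3"] x_assoc[of "k + 5"] x_assoc[of "k + 7"] in simp_all)
    also have "(1 + w 7) * (1 + w 3) / ((1 + w 5) * (1 + w 1)) = 1"
      unfolding w(3) by (rule divide_self) (use nz in simp)
    finally have "assoc m (x (k + 9) / x (k + 1)) 1" by (simp add: field_simps)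
    then have "assoc m (x (k + 9) / x (k + 1) * x (k + 1)) (1 * x (k + 1))"
      by (intro assoc_mult assoc_refl) auto
    then show ?thesis by (simp add: assoc_sym)
  qed
  moreover have "s (k + 9) = s (k + 1)" "s (k + 10) = s (k + 2)"
    using s_even[of "k + 1" 4] s_even[of "k + 2" 4] by (simp_all add: add.commute)
  ultimately have "links (\<lambda>f\<in>ambient m. f) (k + 1) (k + 9)"
    using w(1,2) by (simp add: links_id w_def add.assoc) (simp add: add.commute)
  then show ?thesis using id_links_diff[of "k + 1" "k + 9"] by simp
qed

lemma id_links_period: "id_links (int (period (s 0 * s 1)))"
proof (cases "s 0 * s 1 \<le> 3")
  case True
  have s2: "s 2 = s 0" using s_periodic[of 0] by simp
  show ?thesis
  proof (rule small_factors[OF s_pos s_pos True])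
    assume "s 0 = 1" "s 1 = 1"
    then show ?thesis using id_links_pentagon by (simp add: period_def)
  next
    assume "s 0 = 1" "s 1 = 2"
    then show ?thesis using id_links_hexagon[of 0] by (simp add: period_def)
  next
    assume "s 0 = 2" "s 1 = 1"
    then show ?thesis using id_links_hexagon[of 1] s2 by (simp add: period_def)
  next
    assume "s 0 = 1" "s 1 = 3"
    then show ?thesis using id_links_octagon[of 0] by (simp add: period_def)
  next
    assume "s 0 = 3" "s 1 = 1"
    then show ?thesis using id_links_octagon[of 1] s2 by (simp add: period_def)
  qed
qed (simp add: period_def id_links_0)


subsection \<open>Values at the point with all coordinates one\<close>

text \<open>At this point all frozen monomials have the value 1, so that proportional cluster variables have equal
  values.\<close>

definition u :: "int \<Rightarrow> real" where
  "u k = (THE r. has_val (\<lambda>_. 1) (x k) r)"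

lemma has_val_u: "has_val (\<lambda>_. 1) (x k) (u k)" and u_pos: "u k > 0"
proof -
  obtain r where r: "r > 0" "has_val (\<lambda>_. 1) (x k) r"
    using x_positive[of k] by (force simp: positive_def)
  have "u k = r" unfolding u_def using r(2) has_val_unique by blast
  then show "has_val (\<lambda>_. 1) (x k) (u k)" "u k > 0" using r by auto
qed

lemma frozen_mon_val_1: "has_val (\<lambda>_. 1) (frozen_mon m e) 1"
  using frozen_mon_val[of "\<lambda>_. 1" m e] by simp

lemma u_rec: "u (k + 2) * u k = 1 + u (k + 1) ^ nat (s (k + 1))"
proof -
  have "has_val (\<lambda>_. 1) (x (k + 1) powi s (k + 1)) (u (k + 1) powi s (k + 1))"
    using u_pos[of "k + 1"] by (intro has_val_powi has_val_u) simp
  then have "has_val (\<lambda>_. 1) (x (k + 2) * x k) (1 * (1 + u (k + 1) powi s (k + 1) * 1))"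
    unfolding x_rec z_eq by (intro has_val_mult has_val_add has_val_1 frozen_mon_val_1)
  moreover have "has_val (\<lambda>_. 1) (x (k + 2) * x k) (u (k + 2) * u k)"
    by (intro has_val_mult has_val_u)
  ultimately show ?thesis
    using has_val_unique s_pos[of "k + 1"] by (fastforce simp: power_int_def)
qed

lemma u_initial: "u 0 = 1" "u 1 = 1"
proof -
  have T0: "T 0 = base" by (simp add: T_def)
  have "x 0 = indet 0 \<or> x 0 = indet 1" by (auto simp: x_def T0 base_def)
  then have "has_val (\<lambda>_. 1) (x 0) 1" using has_val_indet[of "\<lambda>_. 1"] by auto
  then show "u 0 = 1" using has_val_u has_val_unique by blast
  have "x 1 = indet 0 \<or> x 1 = indet 1" using T_fst_1[of 0] by (simp add: T0 base_def split: if_splits)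
  then have "has_val (\<lambda>_. 1) (x 1) 1" using has_val_indet[of "\<lambda>_. 1"] by auto
  then show "u 1 = 1" using has_val_u has_val_unique by blast
qed

lemma u_assoc:
  assumes "assoc m (x i) (x j)"
  shows "u i = u j"
proof -
  obtain e where e: "x i = frozen_mon m e * x j"
    using assms by (auto simp: assoc_iff frozen_monomials_eq)
  have "has_val (\<lambda>_. 1) (x i) (1 * u j)"
    unfolding e by (intro has_val_mult frozen_mon_val_1 has_val_u)
  then show ?thesis using has_val_unique[OF has_val_u] by simp
qed

lemma id_links_u: "id_links k \<Longrightarrow> u k = 1 \<and> u (k + 1) = 1"
  using id_links_diff[of 0 k] u_assoc[of 0 k] u_assoc[of 1 "k + 1"] u_initial
  by (simp add: links_id)

lemma u_next: "u (k + 2) = (1 + u (k + 1) ^ nat (s (k + 1))) / u k"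
  using u_rec[of k] u_pos[of k] by (simp add: field_simps)

lemma not_id_links:
  assumes "0 < k" "period (s 0 * s 1) = 0 \<or> k < int (period (s 0 * s 1))"
  shows "\<not> id_links k"
proof -
  have "u k \<noteq> 1 \<or> u (k + 1) \<noteq> 1"
  proof (cases "s 0 * s 1 \<le> 3")
    case True
    have pos: "s 0 * s 1 > 0" using s_pos by simp
    have per: "s 2 = s 0" "s 3 = s 1" "s 4 = s 0" "s 5 = s 1" "s 6 = s 0" "s 7 = s 1"
      by (simp_all add: s_parity[of 2] s_parity[of 3] s_parity[of 4] s_parity[of 5]
          s_parity[of 6] s_parity[of 7])
    consider "s 0 = 1" "s 1 = 1" | "s 0 = 1" "s 1 = 2" | "s 0 = 2" "s 1 = 1"
      | "s 0 = 1" "s 1 = 3" | "s 0 = 3" "s 1 = 1"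
      using small_factors[OF s_pos s_pos True] by blast
    then show ?thesis
    proof cases
      case 1
      have v2: "u 2 = 2" using u_next[of 0] u_initial per 1 by simp
      have v3: "u 3 = 3" using u_next[of 1] u_initial v2 per 1 by simp
      have v4: "u 4 = 2" using u_next[of 2] v2 v3 per 1 by simp
      have "k = 1 \<or> k = 2 \<or> k = 3 \<or> k = 4" using assms 1 by (auto simp: period_def)
      then show ?thesis using v2 v3 v4 by auto
    next
      case 2
      have v2: "u 2 = 2" using u_next[of 0] u_initial per 2 by simp
      have v3: "u 3 = 3" using u_next[of 1] u_initial v2 per 2 by simp
      have v4: "u 4 = 5" using u_next[of 2] v2 v3 per 2 by simp
      have v5: "u 5 = 2" using u_next[of 3] v3 v4 per 2 by simp
      have "k = 1 \<or> k = 2 \<or> k = 3 \<or> k = 4 \<or> k = 5" using assms 2 by (auto simp: period_def)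
      then show ?thesis using v2 v3 v4 v5 by auto
    next
      case 3
      have v2: "u 2 = 2" using u_next[of 0] u_initial per 3 by simp
      have v3: "u 3 = 5" using u_next[of 1] u_initial v2 per 3 by simp
      have v4: "u 4 = 3" using u_next[of 2] v2 v3 per 3 by simp
      have v5: "u 5 = 2" using u_next[of 3] v3 v4 per 3 by simp
      have "k = 1 \<or> k = 2 \<or> k = 3 \<or> k = 4 \<or> k = 5" using assms 3 by (auto simp: period_def)
      then show ?thesis using v2 v3 v4 v5 by auto
    next
      case 4
      have v2: "u 2 = 2" using u_next[of 0] u_initial per 4 by simp
      have v3: "u 3 = 3" using u_next[of 1] u_initial v2 per 4 by simp
      have v4: "u 4 = 14" using u_next[of 2] v2 v3 per 4 by simp
      have v5: "u 5 = 5" using u_next[of 3] v3 v4 per 4 by simp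
      have v6: "u 6 = 9" using u_next[of 4] v4 v5 per 4 by simp
      have v7: "u 7 = 2" using u_next[of 5] v5 v6 per 4 by simp
      have "k = 1 \<or> k = 2 \<or> k = 3 \<or> k = 4 \<or> k = 5 \<or> k = 6 \<or> k = 7"
        using assms 4 by (auto simp: period_def)
      then show ?thesis using v2 v3 v4 v5 v6 v7 by auto
    next
      case 5
      have v2: "u 2 = 2" using u_next[of 0] u_initial per 5 by simp
      have v3: "u 3 = 9" using u_next[of 1] u_initial v2 per 5 by simp
      have v4: "u 4 = 5" using u_next[of 2] v2 v3 per 5 by simp
      have v5: "u 5 = 14" using u_next[of 3] v3 v4 per 5 by simp
      have v6: "u 6 = 3" using u_next[of 4] v4 v5 per 5 by simp
      have v7: "u 7 = 2" using u_next[of 5] v5 v6 per 5 by simp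
      have "k = 1 \<or> k = 2 \<or> k = 3 \<or> k = 4 \<or> k = 5 \<or> k = 6 \<or> k = 7"
        using assms 5 by (auto simp: period_def)
      then show ?thesis using v2 v3 v4 v5 v6 v7 by auto
    qed
  next
    case False
    have "1 < u (int (n + 2))" for n
    proof (rule exchange_recurrence_growth[where u = "\<lambda>n. u (int n)" and e = "\<lambda>n. nat (s (int n))"])
      fix n :: nat
      show "u (int (n + 2)) * u (int n) = 1 + u (int (n + 1)) ^ nat (s (int (n + 1)))"
        using u_rec[of "int n"] by (simp add: add.commute)
      have "nat (s (int n)) * nat (s (int n + 1)) = nat (s 0 * s 1)"
        using s_prod[of "int n"] s_pos[of "int n"] by (simp flip: nat_mult_distrib)
      then show "4 \<le> nat (s (int n)) * nat (s (int (n + 1)))"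
        using False by (simp add: add.commute)
    qed (use u_initial u_pos in auto)
    from this[of "nat (k - 1)"] show ?thesis using assms(1) by (simp add: add.commute)
  qed
  then show ?thesis using id_links_u by blast
qed

lemma id_links_iff: "id_links k \<longleftrightarrow> int (period (s 0 * s 1)) dvd k"
proof
  let ?N = "int (period (s 0 * s 1))"
  assume "?N dvd k"
  then show "id_links k" using id_links_mult[OF id_links_period] by (elim dvdE) simp
next
  let ?N = "int (period (s 0 * s 1))"
  assume k: "id_links k"
  show "?N dvd k"
  proof (cases "?N = 0")
    case True
    then have "\<not> 0 < k" "\<not> 0 < - k" using not_id_links[of k] not_id_links[of "- k"] k id_links_minus by auto
    then show ?thesis by simp
  next
    case False
    have "id_links (k + ?N * (- (k div ?N)))"
      using k id_links_add id_links_mult id_links_period by blast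
    then have "id_links (k mod ?N)" by (simp add: minus_div_mult_eq_mod[symmetric] mult.commute)
    moreover have "0 \<le> k mod ?N" "k mod ?N < ?N" using False by auto
    ultimately show ?thesis using not_id_links[of "k mod ?N"] by fastforce
  qed
qed

end

section \<open>Groups parametrized by the integers\<close>

text \<open>Both groups of the theorem are handled by enumerating their elements by integers, without verifying
  the group axioms separately.\<close>

lemma integer_parametrization:
  fixes G :: "('a, 'b) monoid_scheme" and f :: "int \<Rightarrow> 'a"
  assumes carrier: "carrier G = range f"
    and mult: "\<And>i j. f i \<otimes>\<^bsub>G\<^esub> f j = f (i + j)"
    and one: "\<one>\<^bsub>G\<^esub> = f 0"
    and eq: "\<And>i j. f i = f j \<longleftrightarrow> int n dvd i - j"
  shows "group G" "G \<cong> integer_mod_group n"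
proof -
  show G: "group G"
  proof (rule groupI)
    fix g assume "g \<in> carrier G"
    then obtain i where "g = f i" using carrier by auto
    then show "\<exists>h\<in>carrier G. h \<otimes>\<^bsub>G\<^esub> g = \<one>\<^bsub>G\<^esub>"
      using carrier mult[of "- i" i] one by auto
  qed (auto simp: carrier mult one add.assoc)
  have mod: "f (i mod int n) = f i" for i
    using eq by (simp add: mod_eq_dvd_iff[symmetric])
  have "f \<in> iso (integer_mod_group n) G"
  proof (rule isoI)
    show "f \<in> hom (integer_mod_group n) G"
      by (rule homI) (auto simp: carrier mult mod)
    have "inj_on f (carrier (integer_mod_group n))"
      by (auto simp: inj_on_def eq carrier_integer_mod_group mod_eq_dvd_iff[symmetric] split: if_splits)
    moreover have "f i \<in> f ` carrier (integer_mod_group n)" for i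
      by (rule image_eqI[of _ _ "i mod int n"]) (auto simp: mod carrier_integer_mod_group)
    ultimately show "bij_betw f (carrier (integer_mod_group n)) (carrier G)"
      by (auto simp: bij_betw_def carrier)
  qed
  then have "integer_mod_group n \<cong> G" by (rule is_isoI)
  then show "G \<cong> integer_mod_group n" by (rule group.iso_sym[OF group_integer_mod_group])
qed


section \<open>Existence of maps between seeds\<close>

lemma frozen_mon_cong:
  "(\<And>j. 2 \<le> j \<Longrightarrow> j < m \<Longrightarrow> e j = f j) \<Longrightarrow> frozen_mon m e = frozen_mon m f"
  by (simp add: frozen_mon_def)

lemma prod_powi_pos:
  fixes b :: "nat \<Rightarrow> real"
  assumes "\<And>j. b j > 0"
  shows "(\<Prod>j\<in>J. b j powi e j) > 0"
  using assms by (intro prod_pos) simp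

context rank_two
begin

lemma initial_variables:
  obtains i0 i1 where "x 0 = indet i0" "x 1 = indet i1" "i0 \<noteq> i1" "{i0, i1} = {0, 1}"
proof (cases "B 0 1 > 0")
  case True
  then have "x 0 = indet 0" "x 1 = indet 1"
    using T_fst_1[of 0] by (auto simp: x_def T_def base_def)
  then show thesis using that[of 0 1] by auto
next
  case False
  then have "x 0 = indet 1" "x 1 = indet 0"
    using T_fst_1[of 0] by (auto simp: x_def T_def base_def)
  then show thesis using that[of 1 0] by auto
qed

lemma exchange_val:
  assumes "\<And>j. b j > 0" "r > 0"
  obtains v where "v > 0" "\<And>a. (\<forall>j. a j > 0) \<Longrightarrow> (\<forall>j\<ge>2. a j = b j) \<Longrightarrow> has_val a (x (k + 1)) r
    \<Longrightarrow> has_val a (x (k + 2) * x k) v"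
proof -
  let ?F = "\<lambda>e. \<Prod>j\<in>{2..<m}. b j powi e j"
  let ?v = "?F (\<lambda>j. max (c j k) 0) * (1 + r powi s (k + 1) * ?F (\<lambda>j. - c j k))"
  have F: "?F e > 0" for e using assms by (intro prod_powi_pos)
  have "has_val a (x (k + 2) * x k) ?v"
    if a: "\<forall>j. a j > 0" "\<forall>j\<ge>2. a j = b j" "has_val a (x (k + 1)) r" for a
  proof -
    have "has_val a (frozen_mon m e) (?F e)" for e
      using frozen_mon_val[of a m e] a by simp
    then show ?thesis
      unfolding x_rec z_eq using a assms
      by (intro has_val_mult has_val_add has_val_1 has_val_powi) auto
  qed
  moreover have "?v > 0" using F assms by (intro mult_pos_pos add_pos_pos) auto
  ultimately show thesis using that by blast
qed

text \<open>Mutation is an invertible change of coordinates on the positive points, so every pair of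
  positive numbers is the value of a given cluster, whatever the values of the frozen variables.\<close>

lemma cluster_values:
  assumes b: "\<And>j. b j > 0" and r: "r0 > 0" "r1 > 0"
  shows "\<exists>a. (\<forall>j. a j > 0) \<and> (\<forall>j\<ge>2. a j = b j) \<and> has_val a (x k) r0 \<and> has_val a (x (k + 1)) r1"
  using r
proof (induction k arbitrary: r0 r1 rule: int_induct[where k = 0])
  case base
  obtain i0 i1 where i: "x 0 = indet i0" "x 1 = indet i1" "i0 \<noteq> i1" "{i0, i1} = {0, 1}"
    by (rule initial_variables)
  define a where "a = b(i0 := r0, i1 := r1)"
  have "i0 < 2" "i1 < 2" using i(4) by (auto simp: doubleton_eq_iff)
  then have a2: "\<forall>j\<ge>2. a j = b j" unfolding a_def by fastforce
  have pos: "\<forall>j. a j > 0" unfolding a_def using b base by simp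
  have "a i0 = r0" "a i1 = r1" unfolding a_def using i(3) by simp_all
  then have v: "has_val a (x 0) r0" "has_val a (x 1) r1"
    using has_val_indet[of a i0] has_val_indet[of a i1] unfolding i(1,2) by metis+
  show ?case by (intro exI[of _ a] conjI pos a2) (simp_all add: v)
next
  case (step1 k)
  obtain v where v: "v > 0" "\<And>a. (\<forall>j. a j > 0) \<Longrightarrow> (\<forall>j\<ge>2. a j = b j) \<Longrightarrow> has_val a (x (k + 1)) r0
      \<Longrightarrow> has_val a (x (k + 2) * x k) v"
    using exchange_val[where b = b and k = k, OF b step1.prems(1)] by blast
  obtain a where a: "\<forall>j. a j > 0" "\<forall>j\<ge>2. a j = b j" "has_val a (x k) (v / r1)" "has_val a (x (k + 1)) r0"
    using step1.IH[of "v / r1" r0] step1.prems v(1) by auto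
  have "has_val a (x (k + 2) * x k / x k) (v / (v / r1))"
    using a v step1.prems by (intro has_val_divide) auto
  then have "has_val a (x (k + 2)) r1" using v by simp
  then show ?case using a by (auto simp: add.assoc)
next
  case (step2 k)
  have e: "k - 1 + 1 = k" "k - 1 + 2 = k + 1" by simp_all
  obtain v where v: "v > 0" "\<And>a. (\<forall>j. a j > 0) \<Longrightarrow> (\<forall>j\<ge>2. a j = b j) \<Longrightarrow> has_val a (x k) r1
      \<Longrightarrow> has_val a (x (k + 1) * x (k - 1)) v"
    using exchange_val[where b = b and k = "k - 1", OF b step2.prems(2), unfolded e] by blast
  obtain a where a: "\<forall>j. a j > 0" "\<forall>j\<ge>2. a j = b j" "has_val a (x k) r1" "has_val a (x (k + 1)) (v / r0)"
    using step2.IH[of r1 "v / r0"] step2.prems v(1) by auto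
  have "has_val a (x (k + 1) * x (k - 1) / x (k + 1)) (v / (v / r0))"
    using a v step2.prems by (intro has_val_divide) auto
  then have "has_val a (x (k - 1)) r0" using v by simp
  then show ?case using a by auto
qed

text \<open>The map sends \<open>x 0\<close> and \<open>x 1\<close> to \<open>x k\<close> and \<open>x (k + 1)\<close> times frozen monomials, and raises frozen
  variables to the power \<open>\<epsilon>\<close>. Preservation of the \<open>y\<close>-variables determines the power \<open>s 0\<close> of the first
  monomial and the power \<open>s 1\<close> of the second; the divisibility assumptions say that the roots exist.\<close>

lemma links_exists:
  assumes s: "s k = s 0" and \<epsilon>: "\<epsilon> = 1 \<or> \<epsilon> = - 1"
    and c0: "\<And>j. 2 \<le> j \<Longrightarrow> j < m \<Longrightarrow> s 1 dvd \<epsilon> * c j 0 - c j k"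
    and c1: "\<And>j. 2 \<le> j \<Longrightarrow> j < m \<Longrightarrow> s 0 dvd \<epsilon> * c j (- 1) - c j (k - 1)"
  shows "\<exists>\<Psi>\<in>extensional (ambient m). coeff_endo \<Psi> \<and> links \<Psi> 0 k"
proof -
  have s1: "s (k + 1) = s 1" using s s_prod[of k] s_pos[of 0] by simp
  obtain i0 i1 where i: "x 0 = indet i0" "x 1 = indet i1" "i0 \<noteq> i1" "{i0, i1} = {0, 1}"
    by (rule initial_variables)
  then have i2: "i0 < 2" "i1 < 2" "\<And>j. j \<noteq> i0 \<Longrightarrow> j \<noteq> i1 \<Longrightarrow> j \<ge> 2"
    by (auto simp: doubleton_eq_iff)
  define e0 where "e0 j = (\<epsilon> * c j (- 1) - c j (k - 1)) div s 0" for j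
  define e1 where "e1 j = (\<epsilon> * c j 0 - c j k) div s 1" for j
  define w where "w j = (if j = i0 then x k * frozen_mon m e0 else if j = i1 then x (k + 1) * frozen_mon m e1
    else if j < m then indet j powi \<epsilon> else indet j)" for j
  have "algebraically_independent w"
  proof (rule algebraically_independentI)
    fix b :: "nat \<Rightarrow> real" assume b: "\<forall>j. b j > 0"
    \<comment> \<open>The frozen coordinates of the preimage of \<open>b\<close>; \<open>\<epsilon>\<close> is its own inverse.\<close>
    define b' where "b' j = (if j < m then b j powi \<epsilon> else b j)" for j
    define F where "F e = (\<Prod>j\<in>{2..<m}. b' j powi e j)" for e
    have b': "b' j > 0" for j using b by (simp add: b'_def)
    then have F: "F e > 0" for e
      unfolding F_def by (intro prod_powi_pos)
    obtain a where a: "\<forall>j. a j > 0" "\<forall>j\<ge>2. a j = b' j"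
      "has_val a (x k) (b i0 / F e0)" "has_val a (x (k + 1)) (b i1 / F e1)"
      using cluster_values[of b' "b i0 / F e0" "b i1 / F e1" k] b b' F by auto
    have f: "has_val a (frozen_mon m e) (F e)" for e
      using frozen_mon_val[of a m e] a by (simp add: F_def)
    have "has_val a (w j) (b j)" for j
    proof -
      consider "j = i0" | "j = i1" | "j \<ge> 2" "j < m" | "j \<ge> m" "j \<ge> 2"
        using i2(3) by (cases "j = i0 \<or> j = i1"; cases "j < m") auto
      then show ?thesis
      proof cases
        case 1
        have "has_val a (x k * frozen_mon m e0) (b i0 / F e0 * F e0)" using a f by (intro has_val_mult)
        then show ?thesis using 1 F[of e0] by (simp add: w_def)
      next
        case 2
        have "has_val a (x (k + 1) * frozen_mon m e1) (b i1 / F e1 * F e1)" using a f by (intro has_val_mult)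
        then show ?thesis using 2 F[of e1] i(3) by (simp add: w_def)
      next
        case 3
        have "b' j \<noteq> 0" using b'[of j] by simp
        then have "has_val a (indet j powi \<epsilon>) (b' j powi \<epsilon>)"
          using has_val_powi[OF has_val_indet[of a j]] a(2) 3 by simp
        moreover have "b' j powi \<epsilon> = b j" using 3 \<epsilon> by (auto simp: b'_def power_int_minus)
        ultimately show ?thesis using 3 i2 by (auto simp: w_def)
      next
        case 4
        then show ?thesis using has_val_indet[of a j] a(2) i2 by (auto simp: w_def b'_def)
      qed
    qed
    then show "\<exists>a. \<forall>j. has_val a (w j) (b j)" by blast
  qed
  note indep = this
  define \<Psi> where "\<Psi> = restrict (subst w) (ambient m)"
  have E: "endo m \<Psi>"
    unfolding \<Psi>_def using indep by (rule endo_subst) (auto simp: w_def intro!: ambient_intros)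
  have gen: "\<Psi> (indet j) = w j" if "j < m" for j
    unfolding \<Psi>_def using that indep by (simp add: ambient_indet subst_indet)
  have x0: "\<Psi> (x 0) = x k * frozen_mon m e0" and x1: "\<Psi> (x 1) = x (k + 1) * frozen_mon m e1"
    using gen[of i0] gen[of i1] i(1-3) i2 m by (auto simp: w_def)
  have frozen: "\<Psi> (frozen_mon m e) = frozen_mon m (\<lambda>j. \<epsilon> * e j)" for e
  proof -
    have "\<Psi> (frozen_mon m e) = (\<Prod>j\<in>{2..<m}. \<Psi> (indet j powi e j))"
      unfolding frozen_mon_def using E by (rule endo_prod) (auto intro: ambient_intros)
    also have "\<dots> = (\<Prod>j\<in>{2..<m}. indet j powi (\<epsilon> * e j))"
    proof (rule prod.cong)
      fix j assume "j \<in> {2..<m}"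
      then have "\<Psi> (indet j powi e j) = (indet j powi \<epsilon>) powi e j"
        using E gen[of j] i2 by (auto simp: endo_powi ambient_indet w_def)
      then show "\<Psi> (indet j powi e j) = indet j powi (\<epsilon> * e j)" by (simp add: power_int_mult)
    qed simp
    finally show ?thesis by (simp add: frozen_mon_def)
  qed
  have coeff: "coeff_endo \<Psi>"
    unfolding coeff_endo_def using E frozen by (auto simp: frozen_monomials_eq)
  have z0: "\<Psi> (z 0) = z k"
  proof -
    have "\<Psi> (z 0) = (x (k + 1) * frozen_mon m e1) powi s 1 * frozen_mon m (\<lambda>j. \<epsilon> * - c j 0)"
      unfolding z_eq[of 0] using E x1 frozen by (simp add: endo_mult endo_powi ambient_powi)
    also have "\<dots> = x (k + 1) powi s 1 * (frozen_mon m (\<lambda>j. s 1 * e1 j) * frozen_mon m (\<lambda>j. \<epsilon> * - c j 0))"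
      by (simp add: power_int_mult_distrib frozen_mon_powi)
    also have "frozen_mon m (\<lambda>j. s 1 * e1 j) * frozen_mon m (\<lambda>j. \<epsilon> * - c j 0) = frozen_mon m (\<lambda>j. - c j k)"
      unfolding frozen_mon_add[symmetric]
      by (rule frozen_mon_cong) (use c0 in \<open>simp add: e1_def\<close>)
    finally show ?thesis by (simp add: z_eq[of k] s1)
  qed
  have z1: "\<Psi> (z (- 1)) = z (k - 1)"
  proof -
    have "\<Psi> (z (- 1)) = (x k * frozen_mon m e0) powi s 0 * frozen_mon m (\<lambda>j. \<epsilon> * - c j (- 1))"
      unfolding z_eq[of "- 1"] using E x0 frozen by (simp add: endo_mult endo_powi ambient_powi)
    also have "\<dots> = x k powi s 0 * (frozen_mon m (\<lambda>j. s 0 * e0 j) * frozen_mon m (\<lambda>j. \<epsilon> * - c j (- 1)))"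
      by (simp add: power_int_mult_distrib frozen_mon_powi)
    also have "frozen_mon m (\<lambda>j. s 0 * e0 j) * frozen_mon m (\<lambda>j. \<epsilon> * - c j (- 1)) = frozen_mon m (\<lambda>j. - c j (k - 1))"
      unfolding frozen_mon_add[symmetric]
      by (rule frozen_mon_cong) (use c1 in \<open>simp add: e0_def\<close>)
    finally show ?thesis by (simp add: z_eq[of "k - 1"] s)
  qed
  have "assoc m (x l * frozen_mon m e) (x l)" for l e
    by (rule assocI[of _ "frozen_mon m e"]) (auto simp: mult.commute)
  then have "links \<Psi> 0 k"
    using x0 x1 z0 z1 s s1 by (simp add: links_def)
  moreover have "\<Psi> \<in> extensional (ambient m)" by (simp add: \<Psi>_def)
  ultimately show ?thesis using coeff by blast
qed

lemma c_step:
  assumes "2 \<le> j"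
  shows "s (k + 1) dvd c j k + c j (k + 2)"
proof -
  have "c j (k + 2) + c j k = max (c j (k + 1)) 0 * s (k + 1)"
    using c_rec[OF assms, of "k + 1"] by (simp add: add.assoc)
  then show ?thesis by (metis add.commute dvd_triv_right)
qed

text \<open>Modulo the row lattice of the exchange matrix two shifts negate the frozen rows, so that inverting
  the frozen variables makes up for them.\<close>

lemma c_even:
  assumes "2 \<le> j"
  shows "s (k + 1) dvd (if even l then 1 else - 1) * c j k - c j (k + 2 * l)"
proof (induction l rule: int_induct[where k = 0])
  case (step1 l)
  have "s (k + 1) dvd c j (k + 2 * l) + c j (k + 2 * (l + 1))"
    using c_step[OF assms, of "k + 2 * l"] s_even[of "k + 1" l] by (simp add: algebra_simps)
  then have "s (k + 1) dvd - ((if even l then 1 else - 1) * c j k - c j (k + 2 * l))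
      - (c j (k + 2 * l) + c j (k + 2 * (l + 1)))"
    using step1 by (intro dvd_diff) (simp_all only: dvd_minus_iff)
  then show ?case by (auto split: if_splits)
next
  case (step2 l)
  have "s (k + 1) dvd c j (k + 2 * (l - 1)) + c j (k + 2 * l)"
    using c_step[OF assms, of "k + 2 * (l - 1)"] s_even[of "k + 1" "l - 1"] by (simp add: algebra_simps)
  then have "s (k + 1) dvd - ((if even l then 1 else - 1) * c j k - c j (k + 2 * l))
      - (c j (k + 2 * (l - 1)) + c j (k + 2 * l))"
    using step2 by (intro dvd_diff) (simp_all only: dvd_minus_iff)
  then show ?case by (auto split: if_splits)
qed simp

definition realized :: "int \<Rightarrow> bool" where
  "realized k \<longleftrightarrow> (\<exists>\<Psi>\<in>extensional (ambient m). coeff_endo \<Psi> \<and> links \<Psi> 0 k)"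

lemma realized_even: "realized (2 * l)"
proof -
  let ?\<epsilon> = "if even l then 1 else - 1"
  have "s 1 dvd ?\<epsilon> * c j 0 - c j (2 * l)" "s 0 dvd ?\<epsilon> * c j (- 1) - c j (2 * l - 1)" if "2 \<le> j" for j
    using c_even[OF that, of 0 l] c_even[OF that, of "- 1" l] by simp_all
  then show ?thesis
    unfolding realized_def using s_even[of 0 l] by (intro links_exists[of _ ?\<epsilon>]) auto
qed

lemma realized_all: "s 0 = 1 \<Longrightarrow> s 1 = 1 \<Longrightarrow> realized k"
  unfolding realized_def using s_parity[of k] by (intro links_exists[of _ 1]) auto

lemma realized_no_frozen: "m = 2 \<Longrightarrow> s k = s 0 \<Longrightarrow> realized k"
  unfolding realized_def by (intro links_exists[of _ 1]) auto

lemma realized_s: "realized k \<Longrightarrow> s k = s 0"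
  by (auto simp: realized_def links_def)

lemma realized_add:
  assumes "realized i" "realized j"
  shows "realized (i + j)"
proof -
  obtain \<Phi> \<Psi> where *: "coeff_endo \<Phi>" "links \<Phi> 0 i" "coeff_endo \<Psi>" "links \<Psi> 0 j"
    using assms by (auto simp: realized_def)
  have "links \<Phi> j (i + j)" using links_add[OF *(1), of 0 j i] * by simp
  then have "links (compose (ambient m) \<Phi> \<Psi>) 0 (i + j)" by (rule links_compose[OF *(1,3,4)])
  moreover have "compose (ambient m) \<Phi> \<Psi> \<in> extensional (ambient m)" by simp
  ultimately show ?thesis unfolding realized_def using coeff_endo_compose[OF *(1,3)] by blast
qed

text \<open>The generator of the group of realized shifts, which contains all even numbers.\<close>

definition step :: int where
  "step = (if \<exists>k. odd k \<and> realized k then 1 else 2)"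

lemma realized_iff: "realized k \<longleftrightarrow> step dvd k"
proof (cases "\<exists>k. odd k \<and> realized k")
  case True
  then obtain l where l: "odd l" "realized l" by blast
  have "realized k"
  proof (cases "even k")
    case True
    then show ?thesis using realized_even[of "k div 2"] by simp
  next
    case False
    then show ?thesis using realized_add[OF l(2) realized_even[of "(k - l) div 2"]] l(1) by simp
  qed
  then show ?thesis using True by (simp add: step_def)
next
  case False
  then show ?thesis using realized_even[of "k div 2"] by (auto simp: step_def)
qed

end

text \<open>The period counted in units of the smallest positive realized shift, with 0 again for infinite order.\<close>

definition rotation_order :: "int \<Rightarrow> nat" where
  "rotation_order p = (if p = 1 then 5 else if p = 2 then 3 else if p = 3 then 4 else 0)"

context rank_two
begin

text \<open>The role of \<open>d\<close> is that of the smallest positive realized shift, which may be 1 or 2 when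
  \<open>s 0 = s 1 > 1\<close>; the period is then 0.\<close>

lemma period_dvd_iff:
  assumes "s 0 \<noteq> s 1 \<Longrightarrow> d = 2" "s 0 = 1 \<Longrightarrow> s 1 = 1 \<Longrightarrow> d = 1" "d \<noteq> (0::int)"
  shows "int (period (s 0 * s 1)) dvd d * k \<longleftrightarrow> int (rotation_order (s 0 * s 1)) dvd k"
proof -
  have "int (period (s 0 * s 1)) = d * int (rotation_order (s 0 * s 1))"
  proof (cases "s 0 * s 1 \<le> 3")
    case True
    then show ?thesis
      by (rule small_factors[OF s_pos s_pos]) (use assms in \<open>auto simp: period_def rotation_order_def\<close>)
  qed (simp add: period_def rotation_order_def)
  then show ?thesis using assms(3) by simp
qed


section \<open>Quasi-automorphisms\<close>

lemma quasi_homs_iff: "\<Psi> \<in> quasi_homs m 2 B \<longleftrightarrow>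
    \<Psi> \<in> extensional (ambient m) \<and> coeff_endo \<Psi> \<and> (\<exists>k. links \<Psi> 0 k)"
proof -
  have "(\<exists>i j. links \<Psi> i j) \<longleftrightarrow> (\<exists>k. links \<Psi> 0 k)" if "coeff_endo \<Psi>"
    using links_diff[OF that] by metis
  then show ?thesis
    unfolding quasi_homs_def coeff_endo_def using links_seeds[of \<Psi>] by (auto simp: coeff_endo_def)
qed

text \<open>The seed at which two maps are compared does not matter: both shift the whole line.\<close>

lemma proportional_iff:
  assumes "coeff_endo \<Psi>" "links \<Psi> 0 k" "coeff_endo \<Phi>" "links \<Phi> 0 l"
  shows "proportional m 2 B \<Psi> \<Phi> \<longleftrightarrow> id_links (l - k)"
proof
  assume "proportional m 2 B \<Psi> \<Phi>"
  then obtain S where S: "S \<in> seeds m 2 B"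
    "\<forall>i<2. assoc m (\<Psi> (fst S i)) (\<Phi> (fst S i)) \<and> \<Psi> (yhat m S i) = \<Phi> (yhat m S i)"
    by (auto simp: proportional_def assoc_def)
  then have S01: "assoc m (\<Psi> (fst S 0)) (\<Phi> (fst S 0))" "assoc m (\<Psi> (fst S 1)) (\<Phi> (fst S 1))"
    "\<Psi> (yhat m S 0) = \<Phi> (yhat m S 0)" "\<Psi> (yhat m S 1) = \<Phi> (yhat m S 1)" by auto
  have "\<exists>i. assoc m (\<Psi> (x i)) (\<Phi> (x i)) \<and> assoc m (\<Psi> (x (i + 1))) (\<Phi> (x (i + 1)))
      \<and> \<Psi> (inverse (z i)) = \<Phi> (inverse (z i)) \<and> \<Psi> (z (i - 1)) = \<Phi> (z (i - 1))"
  proof (rule seeds_cases[OF S(1)])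
    fix i assume "S = T i"
    then show ?thesis
      using S01 T_fst_1[of i] yhat_T[of i] x_def[of i] by (intro exI[of _ i]) simp
  next
    fix i assume "S = swap (T i)"
    then show ?thesis
      using S01 T_fst_1[of i] yhat_T[of i] x_def[of i] yhat_swap[of "T i"] by (intro exI[of _ i]) simp
  qed
  then obtain i where i: "assoc m (\<Psi> (x i)) (\<Phi> (x i))" "assoc m (\<Psi> (x (i + 1))) (\<Phi> (x (i + 1)))"
    "\<Psi> (inverse (z i)) = \<Phi> (inverse (z i))" "\<Psi> (z (i - 1)) = \<Phi> (z (i - 1))" by blast
  have "\<Psi> (z i) = \<Phi> (z i)"
    using i(3) assms(1,3) coeff_endoD(1) endo_inverse[OF _ z_ambient] by (metis inverse_inverse_eq)
  moreover have "links \<Psi> i (k + i)" "links \<Phi> i (l + i)"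
    using links_add[OF assms(1), of 0 i k] links_add[OF assms(3), of 0 i l] assms(2,4) by simp_all
  ultimately have "id_links (l + i - (k + i))" using i by (intro links_both)
  then show "id_links (l - k)" by simp
next
  assume "id_links (l - k)"
  then have *: "links \<Psi> 0 l" using assms(2) by (rule links_id_links[rotated])
  note L = *[unfolded links_def] assms(4)[unfolded links_def]
  have "assoc m (\<Psi> (x 0)) (\<Phi> (x 0))" "assoc m (\<Psi> (x 1)) (\<Phi> (x 1))"
    using L by (auto intro: assoc_sym assoc_trans)
  moreover have "\<Psi> (inverse (z 0)) = \<Phi> (inverse (z 0))" "\<Psi> (z (- 1)) = \<Phi> (z (- 1))"
    using L endo_inverse[OF coeff_endoD(1)[OF assms(1)] z_ambient]
      endo_inverse[OF coeff_endoD(1)[OF assms(3)] z_ambient] by simp_all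
  ultimately show "proportional m 2 B \<Psi> \<Phi>"
    unfolding proportional_def using T_in_seeds[of 0] T_fst_1[of 0] yhat_T[of 0]
    by (intro bexI[of _ "T 0"]) (auto simp: less_2_cases_iff assoc_def x_def)
qed

lemma proportional_id_iff:
  assumes "coeff_endo \<Psi>" "links \<Psi> 0 k"
  shows "proportional m 2 B \<Psi> (\<lambda>f\<in>ambient m. f) \<longleftrightarrow> id_links k"
  using proportional_iff[OF assms coeff_endo_id id_links_0[unfolded id_links_def]] id_links_minus by simp

lemma compose_quasi_homs:
  assumes "\<Phi> \<in> quasi_homs m 2 B" "links \<Phi> 0 i" "\<Psi> \<in> quasi_homs m 2 B" "links \<Psi> 0 j"
  shows "compose (ambient m) \<Phi> \<Psi> \<in> quasi_homs m 2 B" "links (compose (ambient m) \<Phi> \<Psi>) 0 (i + j)"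
proof -
  have c: "coeff_endo \<Phi>" "coeff_endo \<Psi>" using assms by (auto simp: quasi_homs_iff)
  have "links \<Phi> j (i + j)" using links_add[OF c(1), of 0 j i] assms(2) by simp
  then show *: "links (compose (ambient m) \<Phi> \<Psi>) 0 (i + j)" by (rule links_compose[OF c assms(4)])
  show "compose (ambient m) \<Phi> \<Psi> \<in> quasi_homs m 2 B"
    unfolding quasi_homs_iff using * coeff_endo_compose[OF c] by auto
qed

lemma quasi_homs_step: "\<Psi> \<in> quasi_homs m 2 B \<Longrightarrow> \<exists>i. links \<Psi> 0 (step * i)"
proof -
  assume "\<Psi> \<in> quasi_homs m 2 B"
  then obtain k where k: "\<Psi> \<in> extensional (ambient m)" "coeff_endo \<Psi>" "links \<Psi> 0 k"
    unfolding quasi_homs_iff by blast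
  then have "step dvd k" unfolding realized_iff[symmetric] realized_def by blast
  then show ?thesis using k(3) by (elim dvdE) auto
qed

lemma quasi_homs_exists: "\<exists>\<Psi>\<in>quasi_homs m 2 B. links \<Psi> 0 (step * i)"
proof -
  have "realized (step * i)" by (simp add: realized_iff)
  then show ?thesis unfolding realized_def Bex_def quasi_homs_iff by blast
qed

text \<open>Realized shifts are closed under negation.\<close>

lemma quasi_auts_eq: "quasi_auts m 2 B = quasi_homs m 2 B"
proof -
  have "\<exists>\<Phi>\<in>quasi_homs m 2 B. proportional m 2 B (compose (ambient m) \<Phi> \<Psi>) (\<lambda>f\<in>ambient m. f)"
    if \<Psi>: "\<Psi> \<in> quasi_homs m 2 B" for \<Psi>
  proof -
    obtain i where i: "links \<Psi> 0 (step * i)" using quasi_homs_step[OF \<Psi>] by blast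
    obtain \<Phi> where \<Phi>: "\<Phi> \<in> quasi_homs m 2 B" "links \<Phi> 0 (step * - i)"
      using quasi_homs_exists by blast
    have "coeff_endo (compose (ambient m) \<Phi> \<Psi>)" "links (compose (ambient m) \<Phi> \<Psi>) 0 0"
      using compose_quasi_homs[OF \<Phi> \<Psi> i] by (auto simp: quasi_homs_iff)
    then have "proportional m 2 B (compose (ambient m) \<Phi> \<Psi>) (\<lambda>f\<in>ambient m. f)"
      using proportional_id_iff id_links_0 by simp
    then show ?thesis using \<Phi>(1) by blast
  qed
  then show ?thesis by (auto simp: quasi_auts_def)
qed

definition shift_class :: "int \<Rightarrow> (ratfun \<Rightarrow> ratfun) set" where
  "shift_class i = {\<Psi> \<in> quasi_homs m 2 B. links \<Psi> 0 (step * i)}"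

text \<open>A proportionality class consists of all maps with the same shift.\<close>

lemma prop_rel_class:
  assumes "\<Psi> \<in> shift_class i"
  shows "prop_rel m 2 B `` {\<Psi>} = shift_class i"
proof -
  have \<Psi>: "\<Psi> \<in> quasi_homs m 2 B" "coeff_endo \<Psi>" "links \<Psi> 0 (step * i)"
    using assms by (auto simp: shift_class_def quasi_homs_iff)
  have "proportional m 2 B \<Psi> \<Phi> \<longleftrightarrow> links \<Phi> 0 (step * i)" if \<Phi>: "\<Phi> \<in> quasi_homs m 2 B" for \<Phi>
  proof -
    obtain l where l: "coeff_endo \<Phi>" "links \<Phi> 0 l" using \<Phi> unfolding quasi_homs_iff by blast
    have "proportional m 2 B \<Psi> \<Phi> \<longleftrightarrow> id_links (step * i - l)"
      using proportional_iff[OF \<Psi>(2,3) l] id_links_minus[of "step * i - l"] by simp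
    also have "\<dots> \<longleftrightarrow> links \<Phi> 0 (step * i)"
      using l(2) links_id_links[of \<Phi> 0 l "step * i"] links_unique[of \<Phi> 0 l "step * i"] by blast
    finally show ?thesis .
  qed
  then show ?thesis
    using \<Psi>(1) by (auto simp: prop_rel_def quasi_auts_eq shift_class_def)
qed

lemma shift_class_nonempty: "\<exists>\<Psi>. \<Psi> \<in> shift_class i"
  using quasi_homs_exists[of i] by (auto simp: shift_class_def)

lemma shift_class_eq_iff: "shift_class i = shift_class j \<longleftrightarrow> int (rotation_order (s 0 * s 1)) dvd i - j"
proof -
  obtain \<Psi> where i: "\<Psi> \<in> shift_class i" using shift_class_nonempty by blast
  then have \<Psi>: "\<Psi> \<in> quasi_homs m 2 B" "links \<Psi> 0 (step * i)"
    unfolding shift_class_def by blast+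
  have "shift_class i = shift_class j \<longleftrightarrow> \<Psi> \<in> shift_class j"
    using i prop_rel_class[of \<Psi> i] prop_rel_class[of \<Psi> j] by metis
  also have "\<dots> \<longleftrightarrow> links \<Psi> 0 (step * j)" using \<Psi>(1) unfolding shift_class_def by blast
  also have "\<dots> \<longleftrightarrow> id_links (step * j - step * i)"
    using \<Psi>(2) links_id_links[of \<Psi> 0 "step * i" "step * j"] links_unique[of \<Psi> 0 "step * i" "step * j"]
    by blast
  also have "\<dots> \<longleftrightarrow> id_links (step * i - step * j)"
    using id_links_minus[of "step * i - step * j"] by simp
  also have "\<dots> \<longleftrightarrow> int (period (s 0 * s 1)) dvd step * (i - j)"
    by (simp add: id_links_iff right_diff_distrib)
  also have "\<dots> \<longleftrightarrow> int (rotation_order (s 0 * s 1)) dvd i - j"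
  proof (rule period_dvd_iff)
    show "step = 2" if "s 0 \<noteq> s 1"
    proof -
      have "\<not> realized k" if "odd k" for k
        using realized_s[of k] s_parity[of k] \<open>odd k\<close> \<open>s 0 \<noteq> s 1\<close> by auto
      then show ?thesis by (auto simp: step_def)
    qed
    show "step = 1" if "s 0 = 1" "s 1 = 1"
      using realized_all[OF that, of 1] by (auto simp: step_def intro!: exI[of _ 1])
  qed (simp add: step_def)
  finally show ?thesis .
qed

lemma QAut0_group: "group (QAut0 m 2 B)"
  and QAut0_iso: "QAut0 m 2 B \<cong> integer_mod_group (rotation_order (s 0 * s 1))"
proof -
  have carrier: "carrier (QAut0 m 2 B) = range shift_class"
  proof
    show "carrier (QAut0 m 2 B) \<subseteq> range shift_class"
    proof
      fix P assume "P \<in> carrier (QAut0 m 2 B)"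
      then obtain \<Psi> where \<Psi>: "\<Psi> \<in> quasi_homs m 2 B" "P = prop_rel m 2 B `` {\<Psi>}"
        by (auto simp: QAut0_def quasi_auts_eq elim: quotientE)
      then obtain i where "\<Psi> \<in> shift_class i"
        using quasi_homs_step[of \<Psi>] by (auto simp: shift_class_def)
      then show "P \<in> range shift_class" using \<Psi>(2) prop_rel_class by blast
    qed
    show "range shift_class \<subseteq> carrier (QAut0 m 2 B)"
    proof
      fix P assume "P \<in> range shift_class"
      then obtain i \<Psi> where \<Psi>: "P = shift_class i" "\<Psi> \<in> shift_class i" using shift_class_nonempty by blast
      then have "P = prop_rel m 2 B `` {\<Psi>}" using prop_rel_class by simp
      moreover have "\<Psi> \<in> quasi_homs m 2 B" using \<Psi>(2) unfolding shift_class_def by blast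
      ultimately show "P \<in> carrier (QAut0 m 2 B)"
        by (simp add: QAut0_def quasi_auts_eq quotientI)
    qed
  qed
  have mult: "shift_class i \<otimes>\<^bsub>QAut0 m 2 B\<^esub> shift_class j = shift_class (i + j)" for i j
  proof -
    have "prop_rel m 2 B `` {compose (ambient m) \<Phi> \<Psi>} = shift_class (i + j)"
      if "\<Phi> \<in> shift_class i" "\<Psi> \<in> shift_class j" for \<Phi> \<Psi>
      using that compose_quasi_homs[of \<Phi> "step * i" \<Psi> "step * j"]
      by (intro prop_rel_class) (simp add: shift_class_def distrib_left)
    then show ?thesis
      using shift_class_nonempty[of i] shift_class_nonempty[of j] by (auto simp: QAut0_def)
  qed
  have "(\<lambda>f\<in>ambient m. f) \<in> shift_class 0"
    using id_links_0 coeff_endo_id by (auto simp: shift_class_def quasi_homs_iff id_links_def)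
  then have one: "\<one>\<^bsub>QAut0 m 2 B\<^esub> = shift_class 0"
    using prop_rel_class by (simp add: QAut0_def)
  show "group (QAut0 m 2 B)" "QAut0 m 2 B \<cong> integer_mod_group (rotation_order (s 0 * s 1))"
    by (rule integer_parametrization[OF carrier mult one shift_class_eq_iff])+
qed

lemma s_product: "s 0 * s 1 = \<bar>B 0 1\<bar> * \<bar>B 1 0\<bar>"
proof -
  note e = indecomposable_two_entries(3)[OF skew_symmetrizable indecomposable]
  have "s 0 = snd base 0 1" "s 1 = - snd base 1 0"
    using T_snd_10[of 0] by (simp_all add: s_def T_def)
  then show ?thesis using e by (auto simp: base_def)
qed

end

section \<open>Direct cluster automorphisms\<close>

locale coefficient_free = rank_two 2 B for B
begin

abbreviation algebra_of_clusters :: "ratfun set" where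
  "algebra_of_clusters \<equiv> cluster_algebra 2 2 B"

lemma algebra_1: "1 \<in> algebra_of_clusters"
  using generate_ring.one[of "ring_on UNIV"] by (simp add: cluster_algebra_def)

lemma algebra_uminus: "f \<in> algebra_of_clusters \<Longrightarrow> - f \<in> algebra_of_clusters"
  using generate_ring.a_inv[of f "ring_on UNIV"] by (simp add: cluster_algebra_def a_inv_ring_on)

lemma algebra_add:
  "f \<in> algebra_of_clusters \<Longrightarrow> g \<in> algebra_of_clusters \<Longrightarrow> f + g \<in> algebra_of_clusters"
  using generate_ring.eng_add[of f "ring_on UNIV"] by (simp add: cluster_algebra_def)

lemma algebra_mult:
  "f \<in> algebra_of_clusters \<Longrightarrow> g \<in> algebra_of_clusters \<Longrightarrow> f * g \<in> algebra_of_clusters"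
  using generate_ring.eng_mult[of f "ring_on UNIV"] by (simp add: cluster_algebra_def)

lemma algebra_power: "f \<in> algebra_of_clusters \<Longrightarrow> f ^ n \<in> algebra_of_clusters"
  by (induction n) (auto intro: algebra_1 algebra_mult)

lemma cluster_T: "cluster 2 (T k) = {x k, x (k + 1)}" "cluster 2 (swap (T k)) = {x k, x (k + 1)}"
proof -
  have "{..<2::nat} = {0, 1}" by auto
  then show "cluster 2 (T k) = {x k, x (k + 1)}" "cluster 2 (swap (T k)) = {x k, x (k + 1)}"
    using T_fst_1[of k] by (auto simp: cluster_def x_def)
qed

lemma clusters: "(\<Union>S\<in>seeds 2 2 B. cluster 2 S) = range x"
proof
  show "(\<Union>S\<in>seeds 2 2 B. cluster 2 S) \<subseteq> range x"
  proof
    fix f assume "f \<in> (\<Union>S\<in>seeds 2 2 B. cluster 2 S)"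
    then obtain S where S: "S \<in> seeds 2 2 B" "f \<in> cluster 2 S" by blast
    show "f \<in> range x"
      by (rule seeds_cases[OF S(1)]) (use S(2) cluster_T in auto)
  qed
  show "range x \<subseteq> (\<Union>S\<in>seeds 2 2 B. cluster 2 S)"
    using T_in_seeds cluster_T(1) by blast
qed

lemma algebra_x [simp]: "x k \<in> algebra_of_clusters"
  unfolding cluster_algebra_def clusters by (rule generate_ring.incl) simp

lemma algebra_induct [consumes 1, case_names one x uminus add mult]:
  assumes "f \<in> algebra_of_clusters" "P 1" "\<And>k. P (x k)"
    "\<And>f. f \<in> algebra_of_clusters \<Longrightarrow> P f \<Longrightarrow> P (- f)"
    "\<And>f g. f \<in> algebra_of_clusters \<Longrightarrow> g \<in> algebra_of_clusters \<Longrightarrow> P f \<Longrightarrow> P g \<Longrightarrow> P (f + g)"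
    "\<And>f g. f \<in> algebra_of_clusters \<Longrightarrow> g \<in> algebra_of_clusters \<Longrightarrow> P f \<Longrightarrow> P g \<Longrightarrow> P (f * g)"
  shows "P f"
  using assms(1) unfolding cluster_algebra_def
proof (induction rule: generate_ring.induct)
  case one
  then show ?case using assms(2) by simp
next
  case (incl h)
  then show ?case using assms(2,3) by (auto simp: clusters frozen_monomials_trivial)
next
  case (a_inv h)
  then show ?case using assms(4) by (simp add: a_inv_ring_on cluster_algebra_def)
next
  case (eng_add f g)
  then show ?case using assms(5) by (simp add: cluster_algebra_def)
next
  case (eng_mult f g)
  then show ?case using assms(6) by (simp add: cluster_algebra_def)
qed

lemma algebra_ambient: "f \<in> algebra_of_clusters \<Longrightarrow> f \<in> ambient 2"
  by (induction rule: algebra_induct) (auto intro: ambient_intros ambient_uminus)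

abbreviation algebra_endo :: "(ratfun \<Rightarrow> ratfun) \<Rightarrow> bool" where
  "algebra_endo \<phi> \<equiv> \<phi> \<in> ring_hom (ring_on algebra_of_clusters) (ring_on algebra_of_clusters)"

lemma algebra_endoD:
  assumes "algebra_endo \<phi>"
  shows "\<phi> 1 = 1" "f \<in> algebra_of_clusters \<Longrightarrow> \<phi> f \<in> algebra_of_clusters"
    "f \<in> algebra_of_clusters \<Longrightarrow> g \<in> algebra_of_clusters \<Longrightarrow> \<phi> (f * g) = \<phi> f * \<phi> g"
    "f \<in> algebra_of_clusters \<Longrightarrow> g \<in> algebra_of_clusters \<Longrightarrow> \<phi> (f + g) = \<phi> f + \<phi> g"
  using ring_hom_one[OF assms] ring_hom_closed[OF assms] ring_hom_mult[OF assms]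
    ring_hom_add[OF assms] by auto

lemma algebra_endo_power:
  assumes "algebra_endo \<phi>" "f \<in> algebra_of_clusters"
  shows "\<phi> (f ^ n) = \<phi> f ^ n"
  by (induction n) (use assms in \<open>auto simp: algebra_endoD algebra_power\<close>)

lemma algebra_endo_uminus:
  assumes "algebra_endo \<phi>" "f \<in> algebra_of_clusters"
  shows "\<phi> (- f) = - \<phi> f"
proof -
  have 0: "0 \<in> algebra_of_clusters" using algebra_add[OF algebra_1 algebra_uminus[OF algebra_1]] by simp
  have "\<phi> 0 = 0"
    using algebra_endoD(4)[OF assms(1) 0 0] by (metis add.right_neutral add_left_cancel)
  moreover have "\<phi> (f + - f) = \<phi> f + \<phi> (- f)"
    by (intro algebra_endoD(4)[OF assms(1,2)] algebra_uminus assms(2))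
  ultimately show ?thesis by (simp add: eq_neg_iff_add_eq_0 add.commute)
qed

lemma algebra_endo_eqI:
  assumes "algebra_endo \<phi>" "algebra_endo \<psi>" "\<And>k. \<phi> (x k) = \<psi> (x k)" "f \<in> algebra_of_clusters"
  shows "\<phi> f = \<psi> f"
  using assms(4)
  by (induction rule: algebra_induct) (use assms(1-3) in \<open>auto simp: algebra_endoD algebra_endo_uminus\<close>)

lemma x_exchange: "x (k + 2) * x k = 1 + x (k + 1) ^ nat (s (k + 1))"
  using x_rec[of k] s_pos[of "k + 1"] by (simp add: z_eq frozen_mon_def power_int_def)

text \<open>The exchange relations carry the effect of a ring endomorphism on one cluster to the
  neighbouring clusters without any division in the cluster algebra.\<close>

lemma algebra_endo_shift:
  assumes \<phi>: "algebra_endo \<phi>" and init: "\<phi> (x i) = x (i + k)" "\<phi> (x (i + 1)) = x (i + 1 + k)"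
    and s: "\<And>j. s (j + k) = s j"
  shows "\<phi> (x j) = x (j + k)"
proof -
  have ex: "\<phi> (x (l + 2)) * \<phi> (x l) = 1 + \<phi> (x (l + 1)) ^ nat (s (l + 1))" for l
  proof -
    have "\<phi> (x (l + 2) * x l) = \<phi> (1 + x (l + 1) ^ nat (s (l + 1)))" by (simp only: x_exchange)
    then show ?thesis
      using \<phi> by (simp add: algebra_endoD algebra_1 algebra_power algebra_endo_power)
  qed
  have "\<phi> (x (i + l)) = x (i + l + k) \<and> \<phi> (x (i + l + 1)) = x (i + l + 1 + k)" for l
  proof (induction l rule: int_induct[where k = 0])
    case base
    then show ?case using init by simp
  next
    case (step1 l)
    have "\<phi> (x (i + l + 2)) * x (i + l + k) = x (i + l + k + 2) * x (i + l + k)"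
      using ex[of "i + l"] x_exchange[of "i + l + k"] step1.IH s[of "i + l + 1"]
      by (simp add: algebra_simps)
    then show ?case using step1.IH by (simp add: add_ac)
  next
    case (step2 l)
    have "x (i + l + 1 + k) * \<phi> (x (i + l - 1)) = x (i + l + 1 + k) * x (i + l - 1 + k)"
      using ex[of "i + l - 1"] x_exchange[of "i + l - 1 + k"] step2.IH s[of "i + l"]
      by (simp add: algebra_simps)
    then have "\<phi> (x (i + l - 1)) = x (i + l - 1 + k)" by simp
    then show ?case using step2.IH by (simp add: algebra_simps)
  qed
  from this[of "j - i"] show ?thesis by simp
qed

lemma s_shift: "s k = s 0 \<Longrightarrow> s (j + k) = s j"
  using s_parity[of k] s_parity[of j] s_parity[of "j + k"] by (auto split: if_splits)

text \<open>The choice of \<open>\<Psi>\<close> is immaterial: without frozen variables its values on the cluster variables, which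
  generate the algebra, are determined by the shift.\<close>

definition rotation :: "int \<Rightarrow> ratfun \<Rightarrow> ratfun" where
  "rotation k = restrict (SOME \<Psi>. coeff_endo \<Psi> \<and> links \<Psi> 0 k) algebra_of_clusters"

lemma rotation:
  assumes "s k = s 0"
  shows rotation_x: "rotation k (x j) = x (j + k)" and rotation_endo: "algebra_endo (rotation k)"
proof -
  define \<Psi> where "\<Psi> = (SOME \<Psi>. coeff_endo \<Psi> \<and> links \<Psi> 0 k)"
  have "\<exists>\<Psi>. coeff_endo \<Psi> \<and> links \<Psi> 0 k"
    using realized_no_frozen[OF refl assms] by (auto simp: realized_def)
  then have \<Psi>: "coeff_endo \<Psi> \<and> links \<Psi> 0 k" unfolding \<Psi>_def by (rule someI_ex)
  have x: "\<Psi> (x j) = x (j + k)" for j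
    using links_add[of \<Psi> 0 j k] \<Psi> by (auto simp: links_def assoc_trivial add.commute)
  note E = coeff_endoD(1)[OF \<Psi>[THEN conjunct1]]
  have um: "\<Psi> (- f) = - \<Psi> f" if "f \<in> ambient 2" for f
    using endo_add[OF E that ambient_uminus[OF that]] endo_0[OF E]
    by (simp add: eq_neg_iff_add_eq_0 add.commute)
  have closed: "\<Psi> f \<in> algebra_of_clusters" if "f \<in> algebra_of_clusters" for f
    using that
    by (induction rule: algebra_induct)
      (simp_all add: x um endo_1[OF E] endo_add[OF E] endo_mult[OF E] algebra_ambient
        algebra_1 algebra_uminus algebra_add algebra_mult)
  show "rotation k (x j) = x (j + k)" by (simp add: rotation_def \<Psi>_def[symmetric] x)
  show "algebra_endo (rotation k)"
    unfolding rotation_def \<Psi>_def[symmetric]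
    by (rule ring_hom_memI)
      (simp_all add: closed endo_1[OF E] endo_add[OF E] endo_mult[OF E] algebra_ambient
        algebra_1 algebra_add algebra_mult)
qed

lemma rotation_extensional: "rotation k \<in> extensional algebra_of_clusters"
  by (simp add: rotation_def)

lemma rotation_eqI:
  assumes "s k = s 0" "\<phi> \<in> extensional algebra_of_clusters" "algebra_endo \<phi>"
    "\<And>j. \<phi> (x j) = x (j + k)"
  shows "\<phi> = rotation k"
  by (rule extensionalityI[OF assms(2) rotation_extensional])
    (use assms in \<open>auto intro: algebra_endo_eqI simp: rotation\<close>)

lemma rotation_compose:
  assumes "s k = s 0" "s l = s 0"
  shows "compose algebra_of_clusters (rotation k) (rotation l) = rotation (k + l)"
proof (rule rotation_eqI)
  show "s (k + l) = s 0" using s_shift[OF assms(2)] assms(1) by simp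
  show "algebra_endo (compose algebra_of_clusters (rotation k) (rotation l))"
    by (rule ring_hom_memI)
      (simp_all add: compose_eq algebra_endoD[OF rotation_endo[OF assms(1)]]
        algebra_endoD[OF rotation_endo[OF assms(2)]] algebra_1 algebra_add algebra_mult)
  show "compose algebra_of_clusters (rotation k) (rotation l) (x j) = x (j + (k + l))" for j
    using assms by (simp add: compose_eq rotation_x add.assoc add.commute[of k l])
qed simp

lemma rotation_0: "rotation 0 = (\<lambda>f\<in>algebra_of_clusters. f)"
proof (rule rotation_eqI[symmetric])
  show "algebra_endo (\<lambda>f\<in>algebra_of_clusters. f)"
    by (rule ring_hom_memI) (auto simp: algebra_1 algebra_add algebra_mult)
qed auto

lemma rotation_Bij:
  assumes "s k = s 0"
  shows "rotation k \<in> Bij algebra_of_clusters"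
proof -
  have s: "s (- k) = s 0" using s_shift[OF assms, of "- k"] by simp
  have inv: "rotation k (rotation (- k) f) = f" "rotation (- k) (rotation k f) = f"
    if "f \<in> algebra_of_clusters" for f
    using fun_cong[OF rotation_compose[OF assms s], of f] fun_cong[OF rotation_compose[OF s assms], of f]
      that by (simp_all add: compose_eq rotation_0)
  have "bij_betw (rotation k) algebra_of_clusters algebra_of_clusters"
    by (rule bij_betw_byWitness[where f' = "rotation (- k)"])
      (auto simp: inv algebra_endoD[OF rotation_endo[OF assms]] algebra_endoD[OF rotation_endo[OF s]])
  then show ?thesis using rotation_extensional by (simp add: Bij_def)
qed

lemma rotation_eq_iff:
  assumes "s k = s 0" "s l = s 0"
  shows "rotation k = rotation l \<longleftrightarrow> id_links (k - l)"
proof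
  assume eq: "rotation k = rotation l"
  have x: "x (j + k) = x (j + l)" for j
    using rotation_x[OF assms(1), of j] rotation_x[OF assms(2), of j] eq by simp
  have "s (k + 1) = s (l + 1)" using s_shift[OF assms(1), of 1] s_shift[OF assms(2), of 1] by (simp add: add.commute)
  then have "z k = z l" "z (k - 1) = z (l - 1)"
    using x[of 1] x[of 0] assms by (simp_all add: z_eq frozen_mon_def add.commute)
  then have "links (\<lambda>f\<in>ambient 2. f) l k"
    using x[of 0] x[of 1] assms \<open>s (k + 1) = s (l + 1)\<close>
    by (simp add: links_id assoc_trivial add.commute)
  then show "id_links (k - l)" by (simp add: id_links_diff)
next
  assume id: "id_links (k - l)"
  have "x (j + k) = x (j + l)" for j
    using id id_links_diff[of "j + l" "j + k"] by (simp add: links_id assoc_trivial)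
  then show "rotation k = rotation l"
    using rotation_x[OF assms(1)] rotation_endo[OF assms(1)] rotation_extensional
    by (intro rotation_eqI[OF assms(2)]) auto
qed

lemma x_neq: "x k \<noteq> x (k + 1)"
proof
  assume eq: "x k = x (k + 1)"
  obtain a where "has_val a (x k) 1" "has_val a (x (k + 1)) 2"
    using cluster_values[of "\<lambda>_. 1" 1 2 k] by auto
  then show False using eq has_val_unique[of a "x k" 1 2] by simp
qed

lemma lessThan_2: "{..<2::nat} = {0, 1}"
  by auto

lemma var_index_T: "var_index 2 (T k) (x k) = 0" "var_index 2 (T k) (x (k + 1)) = 1"
proof -
  have f: "fst (T k) 0 = x k" "fst (T k) 1 = x (k + 1)" using T_fst_1 by (auto simp: x_def)
  have inj: "inj_on (fst (T k)) {..<2}"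
    using x_neq[of k] f by (auto simp: inj_on_def lessThan_2)
  show "var_index 2 (T k) (x k) = 0" "var_index 2 (T k) (x (k + 1)) = 1"
    unfolding var_index_def f[symmetric] by (rule inv_into_f_f[OF inj]; simp)+
qed

lemma cluster_mut_other: "f \<noteq> g \<Longrightarrow> cluster_mut 2 S f g = g"
  by (simp add: cluster_mut_def)

lemma cluster_mut_T:
  "cluster_mut 2 (T k) (x k) (x k) = x (k + 2)"
  "cluster_mut 2 (T k) (x (k + 1)) (x (k + 1)) = x (k - 1)"
  using T_fst_1[of "k + 1"] x_def[of "k - 1"]
  by (simp_all add: cluster_mut_def var_index_T mutate_T add.assoc)
    (simp_all add: mutate_T(3)[simplified])

lemma mut_compatible_rotation:
  assumes "s k = s 0"
  shows "mut_compatible 2 (rotation k) (T 0) (T k)"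
proof -
  have r: "rotation k (x 0) = x k" "rotation k (x 1) = x (k + 1)" "rotation k (x 2) = x (k + 2)"
    "rotation k (x (- 1)) = x (k - 1)"
    using rotation_x[OF assms] by (simp_all add: add.commute)
  show ?thesis
    unfolding mut_compatible_def cluster_T
    using r x_neq[of 0] x_neq[of k] cluster_mut_T[of 0] cluster_mut_T[of k]
    by (auto simp: cluster_mut_other)
qed

lemma rotation_direct:
  assumes "s k = s 0"
  shows "rotation k \<in> direct_cluster_auts 2 B"
proof -
  have s1: "s (k + 1) = s 1" using s_shift[OF assms, of 1] by (simp add: add.commute)
  have r: "rotation k (fst (T 0) 0) = x k" "rotation k (fst (T 0) 1) = x (k + 1)"
    using rotation_x[OF assms, of 0] rotation_x[OF assms, of 1] T_fst_1[of 0]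
    by (simp_all add: x_def add.commute)
  have "\<forall>j<2. \<forall>i<2. snd (T k) (var_index 2 (T k) (rotation k (fst (T 0) j)))
      (var_index 2 (T k) (rotation k (fst (T 0) i))) = snd (T 0) j i"
    using r var_index_T[of k] T_snd_10[of k] T_snd_10[of 0] s1 assms s_def[of k] s_def[of 0]
      orientedD(5,6)[OF oriented_T[of k]] orientedD(5,6)[OF oriented_T[of 0]]
    by (auto simp: less_2_cases_iff)
  moreover have "rotation k \<in> ring_iso (ring_on algebra_of_clusters) (ring_on algebra_of_clusters)"
    using rotation_endo[OF assms] rotation_Bij[OF assms] by (simp add: ring_iso_def Bij_def)
  ultimately show ?thesis
    unfolding direct_cluster_auts_def cluster_auts_def
    using T_in_seeds mut_compatible_rotation[OF assms] rotation_extensional by blast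
qed

text \<open>A direct automorphism carries a cluster to a cluster and preserves the signs of the
  exchange matrix; hence it respects the order in which the cluster variables are arranged.\<close>

lemma direct_links:
  assumes "f \<in> direct_cluster_auts 2 B"
  shows "\<exists>i j. f (x i) = x j \<and> f (x (i + 1)) = x (j + 1) \<and> s i = s j"
proof -
  obtain S S' where S: "S \<in> seeds 2 2 B" "S' \<in> seeds 2 2 B" "mut_compatible 2 f S S'"
    "\<forall>j<2. \<forall>i<2. snd S' (var_index 2 S' (f (fst S j))) (var_index 2 S' (f (fst S i))) = snd S j i"
    using assms unfolding direct_cluster_auts_def by blast
  define p where "p i = var_index 2 S' (f (fst S i))" for i
  have p: "p i < 2 \<and> fst S' (p i) = f (fst S i)" if "i < 2" for i
  proof -
    have im: "f (fst S i) \<in> fst S' ` {..<2}"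
      using S(3) that by (auto simp: mut_compatible_def cluster_def)
    then show ?thesis
      using inv_into_into[OF im] f_inv_into_f[OF im] by (simp add: p_def var_index_def)
  qed
  have p0: "p 0 = 0 \<or> p 0 = 1" "fst S' (p 0) = f (fst S 0)"
    and p1: "p 1 = 0 \<or> p 1 = 1" "fst S' (p 1) = f (fst S 1)"
    using p[of 0] p[of 1] by auto
  have B: "snd S' (p 0) (p 1) = snd S 0 1" "snd S' (p 1) (p 0) = snd S 1 0"
    using S(4) unfolding p_def[symmetric] by auto
  have T: "fst (T k) 0 = x k" "fst (T k) 1 = x (k + 1)" "snd (T k) 0 0 = 0" "snd (T k) 1 1 = 0"
    "snd (T k) 0 1 = s k" "snd (T k) 1 0 = - s (k + 1)" for k
    using T_fst_1[of k] T_snd_10[of k] orientedD(5,6)[OF oriented_T[of k]] by (simp_all add: x_def s_def)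
  show ?thesis
  proof (rule seeds_cases[OF S(1)]; rule seeds_cases[OF S(2)])
    fix i j assume e: "S = T i" "S' = T j"
    have "p 0 = 0" "p 1 = 1"
      using p0(1) p1(1) B s_pos[of i] s_pos[of "j + 1"] unfolding e by (auto simp: T[simplified])
    then have "f (x i) = x j" "f (x (i + 1)) = x (j + 1)" "s i = s j"
      using p0(2) p1(2) B unfolding e by (simp_all add: T[simplified])
    then show ?thesis by blast
  next
    fix i j assume e: "S = T i" "S' = swap (T j)"
    have "p 0 = 1" "p 1 = 0"
      using p0(1) p1(1) B s_pos[of i] s_pos[of "j + 1"] unfolding e by (auto simp: T[simplified])
    then have "f (x i) = x j" "f (x (i + 1)) = x (j + 1)" "s i = s j"
      using p0(2) p1(2) B unfolding e by (simp_all add: T[simplified])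
    then show ?thesis by blast
  next
    fix i j assume e: "S = swap (T i)" "S' = T j"
    have "p 0 = 1" "p 1 = 0"
      using p0(1) p1(1) B s_pos[of i] s_pos[of "j + 1"] unfolding e by (auto simp: T[simplified])
    then have "f (x i) = x j" "f (x (i + 1)) = x (j + 1)" "s i = s j"
      using p0(2) p1(2) B unfolding e by (simp_all add: T[simplified])
    then show ?thesis by blast
  next
    fix i j assume e: "S = swap (T i)" "S' = swap (T j)"
    have "p 0 = 0" "p 1 = 1"
      using p0(1) p1(1) B s_pos[of i] s_pos[of "j + 1"] unfolding e by (auto simp: T[simplified])
    then have "f (x i) = x j" "f (x (i + 1)) = x (j + 1)" "s i = s j"
      using p0(2) p1(2) B unfolding e by (simp_all add: T[simplified])
    then show ?thesis by blast
  qed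
qed

lemma direct_cluster_auts_eq: "direct_cluster_auts 2 B = rotation ` {k. s k = s 0}"
proof
  show "rotation ` {k. s k = s 0} \<subseteq> direct_cluster_auts 2 B"
    using rotation_direct by blast
  show "direct_cluster_auts 2 B \<subseteq> rotation ` {k. s k = s 0}"
  proof
    fix f assume f: "f \<in> direct_cluster_auts 2 B"
    then have ext: "f \<in> extensional algebra_of_clusters" and endo: "algebra_endo f"
      by (auto simp: direct_cluster_auts_def cluster_auts_def ring_iso_def)
    obtain i j where ij: "f (x i) = x j" "f (x (i + 1)) = x (j + 1)" "s i = s j"
      using direct_links[OF f] by blast
    have s: "s (j - i) = s 0"
      using ij(3) unfolding s_parity[of i] s_parity[of j] s_parity[of "j - i"]
      by (simp split: if_splits)
    have "f (x l) = x (l + (j - i))" for l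
      by (rule algebra_endo_shift[OF endo _ _ s_shift[OF s], of i]) (use ij in \<open>simp_all add: add.commute\<close>)
    then have "f = rotation (j - i)" by (rule rotation_eqI[OF s ext endo])
    then show "f \<in> rotation ` {k. s k = s 0}" using s by blast
  qed
qed

lemma Aut_plus_triv_group: "group (Aut_plus_triv 2 B)"
  and Aut_plus_triv_iso: "Aut_plus_triv 2 B \<cong> integer_mod_group (rotation_order (s 0 * s 1))"
proof -
  define d :: int where "d = (if s 0 = s 1 then 1 else 2)"
  have d: "s k = s 0 \<longleftrightarrow> d dvd k" for k
    using s_parity[of k] by (auto simp: d_def)
  have carrier: "carrier (Aut_plus_triv 2 B) = range (\<lambda>i. rotation (d * i))"
    unfolding Aut_plus_triv_def by (auto simp: direct_cluster_auts_eq d elim!: dvdE)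
  have mult: "rotation (d * i) \<otimes>\<^bsub>Aut_plus_triv 2 B\<^esub> rotation (d * j) = rotation (d * (i + j))" for i j
  proof -
    have "s (d * i) = s 0" "s (d * j) = s 0" by (simp_all add: d)
    then show ?thesis
      by (simp add: Aut_plus_triv_def BijGroup_def rotation_Bij rotation_compose distrib_left)
  qed
  have one: "\<one>\<^bsub>Aut_plus_triv 2 B\<^esub> = rotation (d * 0)"
    by (simp add: Aut_plus_triv_def BijGroup_def rotation_0)
  have eq: "rotation (d * i) = rotation (d * j) \<longleftrightarrow> int (rotation_order (s 0 * s 1)) dvd i - j" for i j
  proof -
    have "s (d * i) = s 0" "s (d * j) = s 0" by (simp_all add: d)
    then have "rotation (d * i) = rotation (d * j) \<longleftrightarrow> int (period (s 0 * s 1)) dvd d * (i - j)"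
      by (simp add: rotation_eq_iff id_links_iff right_diff_distrib)
    also have "\<dots> \<longleftrightarrow> int (rotation_order (s 0 * s 1)) dvd i - j"
      by (rule period_dvd_iff) (auto simp: d_def)
    finally show ?thesis .
  qed
  show "group (Aut_plus_triv 2 B)"
    "Aut_plus_triv 2 B \<cong> integer_mod_group (rotation_order (s 0 * s 1))"
    by (rule integer_parametrization[OF carrier mult one eq])+
qed

end

section \<open>Cartan types\<close>

lemma of_cartan_type_two:
  "of_cartan_type 2 [[2, - a], [- b, 2]] B \<longleftrightarrow>
     (\<bar>B 0 1\<bar> = a \<and> \<bar>B 1 0\<bar> = b) \<or> (\<bar>B 0 1\<bar> = b \<and> \<bar>B 1 0\<bar> = a)"
proof -
  let ?t = "Transposition.transpose 0 (1::nat)"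
  have t: "?t permutes {..<2}" by (intro permutes_swap_id) auto
  let ?P = "\<lambda>\<sigma>. \<forall>i<2. \<forall>j<2. cartan_counterpart B (\<sigma> i) (\<sigma> j) = [[2, - a], [- b, 2]] ! i ! j"
  have "of_cartan_type 2 [[2, - a], [- b, 2]] B \<longleftrightarrow> ?P id \<or> ?P ?t"
    unfolding of_cartan_type_def using permutes_two t permutes_id by blast
  moreover have "?P id \<longleftrightarrow> \<bar>B 0 1\<bar> = a \<and> \<bar>B 1 0\<bar> = b"
    by (auto simp: less_2_cases_iff cartan_counterpart_def)
  moreover have "?P ?t \<longleftrightarrow> \<bar>B 0 1\<bar> = b \<and> \<bar>B 1 0\<bar> = a"
    by (auto simp: less_2_cases_iff cartan_counterpart_def)
  ultimately show ?thesis by simp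
qed

theorem theorem7p1:
  fixes m :: nat and B :: "nat \<Rightarrow> nat \<Rightarrow> int"
  assumes "2 \<le> m"
    and "skew_symmetrizable 2 B"
    and "indecomposable m 2 B"
    and "indecomposable 2 2 B"
  shows "group (QAut0 m 2 B) \<and> group (Aut_plus_triv 2 B) \<and>
    QAut0 m 2 B \<cong> Aut_plus_triv 2 B \<and>
    Aut_plus_triv 2 B \<cong>
      (if of_cartan_type 2 cartan_A2 B then integer_mod_group 5
       else if of_cartan_type 2 cartan_B2 B then integer_mod_group 3
       else if of_cartan_type 2 cartan_C2 B then integer_mod_group 3
       else if of_cartan_type 2 cartan_G2 B then integer_mod_group 4
       else integer_group)"
proof -
  interpret rank_two m B using assms by unfold_locales
  interpret free: coefficient_free B using assms by unfold_locales auto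
  let ?p = "\<bar>B 0 1\<bar> * \<bar>B 1 0\<bar>"
  let ?n = "rotation_order ?p"
  note Q = QAut0_group QAut0_iso[unfolded s_product]
  note A = free.Aut_plus_triv_group free.Aut_plus_triv_iso[unfolded free.s_product]
  have "QAut0 m 2 B \<cong> Aut_plus_triv 2 B"
    by (rule iso_trans[OF Q(2) group.iso_sym[OF A]])
  moreover have "integer_mod_group ?n =
      (if of_cartan_type 2 cartan_A2 B then integer_mod_group 5
       else if of_cartan_type 2 cartan_B2 B then integer_mod_group 3
       else if of_cartan_type 2 cartan_C2 B then integer_mod_group 3
       else if of_cartan_type 2 cartan_G2 B then integer_mod_group 4
       else integer_group)"
  proof -
    have b: "0 < \<bar>B 0 1\<bar>" "0 < \<bar>B 1 0\<bar>"
      using indecomposable_two_entries(3)[OF assms(2,4)] by auto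
    have types: "of_cartan_type 2 cartan_A2 B \<longleftrightarrow> \<bar>B 0 1\<bar> = 1 \<and> \<bar>B 1 0\<bar> = 1"
      "of_cartan_type 2 cartan_B2 B \<longleftrightarrow> (\<bar>B 0 1\<bar> = 2 \<and> \<bar>B 1 0\<bar> = 1) \<or> (\<bar>B 0 1\<bar> = 1 \<and> \<bar>B 1 0\<bar> = 2)"
      "of_cartan_type 2 cartan_C2 B \<longleftrightarrow> (\<bar>B 0 1\<bar> = 2 \<and> \<bar>B 1 0\<bar> = 1) \<or> (\<bar>B 0 1\<bar> = 1 \<and> \<bar>B 1 0\<bar> = 2)"
      "of_cartan_type 2 cartan_G2 B \<longleftrightarrow> (\<bar>B 0 1\<bar> = 3 \<and> \<bar>B 1 0\<bar> = 1) \<or> (\<bar>B 0 1\<bar> = 1 \<and> \<bar>B 1 0\<bar> = 3)"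
      using of_cartan_type_two[of 1 1 B] of_cartan_type_two[of 2 1 B] of_cartan_type_two[of 1 2 B]
        of_cartan_type_two[of 1 3 B]
      unfolding cartan_A2_def cartan_B2_def cartan_C2_def cartan_G2_def by auto
    show ?thesis
    proof (cases "?p \<le> 3")
      case True
      then show ?thesis
        by (rule small_factors[OF b]) (simp_all add: types rotation_order_def)
    next
      case False
      then show ?thesis
        by (auto simp: types rotation_order_def integer_mod_group_def)
    qed
  qed
  ultimately show ?thesis using Q(1) A by simp
qed

end
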